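(* Let $K$ be a finite-dimensional $1$-connected complex Lie group with simple Lie algebra $\mathfrak{k}$, let $\Sigma$ be a compact connected Riemann surface, $p_1,\dots,p_k\in\Sigma$ distinct points with $k\ge1$, $\Sigma_k=\Sigma\setminus\{p_1,\dots,p_k\}$, and $\lambda\in\mathbb{C}$. There is a bijective correspondence between the coadjoint orbits in $H_\lambda$ and the gauge equivalence classes of flat (holomorphic) connections on the trivial holomorphic principal $K$-bundle $K\times\Sigma_k$.
   Context: $G=\mathcal{O}(\Sigma_k,K)$ is the group of holomorphic maps $\Sigma_k\to K$ under pointwise multiplication, and $\Omega^1(\Sigma_k,\mathfrak{k})$ is the space of holomorphic $\mathfrak{k}$-valued $1$-forms on $\Sigma_k$. The smooth dual $\hat{\mathfrak{g}}_\sigma^*$ is the space of operators $\lambda\partial+\xi$ with $\lambda\in\mathbb{C}$ and $\xi\in\Omega^1(\Sigma_k,\mathfrak{k})$, and $H_\lambda\subset\hat{\mathfrak{g}}_\sigma^*$ is the hyperplane of those with the given fixed value of $\lambda$. The coadjoint action of $f\in G$ is $$f\cdot(\lambda\partial+\xi)=\lambda\partial+\delta(f)+\mathrm{Ad}(f)^{-1}(\xi),\qquad\delta(f)=f^{-1}df,$$ which preserves each $H_\lambda$ (it is a right action); a coadjoint orbit in $H_\lambda$ is an orbit of this action on $H_\lambda$. Two holomorphic connections on the trivial holomorphic principal $K$-bundle over $\Sigma_k$ are gauge equivalent if they are related by a holomorphic bundle automorphism covering the identity, i.e. by an element of $\mathcal{O}(\Sigma_k,K)$. *)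

theory Defs
  imports
    "HOL-Analysis.Analysis"
    "HOL-Algebra.Group_Action"
    "HOL-Library.Function_Algebras"
begin

section \<open>Finite-dimensional complex vector spaces as model spaces\<close>

class complex_euclidean_space = euclidean_space +
  fixes scaleC :: "complex \<Rightarrow> 'a \<Rightarrow> 'a"  (infixr \<open>*\<^sub>C\<close> 75)
  assumes scaleC_add_right: "c *\<^sub>C (x + y) = c *\<^sub>C x + c *\<^sub>C y"
    and scaleC_add_left: "(c + d) *\<^sub>C x = c *\<^sub>C x + d *\<^sub>C x"
    and scaleC_scaleC: "c *\<^sub>C d *\<^sub>C x = (c * d) *\<^sub>C x"
    and scaleC_of_real: "complex_of_real r *\<^sub>C x = r *\<^sub>R x"

instantiation complex :: complex_euclidean_space
begin
definition scaleC_complex :: "complex \<Rightarrow> complex \<Rightarrow> complex"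
  where "scaleC_complex c x = c * x"
instance
  by standard (simp_all add: scaleC_complex_def algebra_simps scaleR_conv_of_real)
end

instantiation prod :: (complex_euclidean_space, complex_euclidean_space) complex_euclidean_space
begin
definition scaleC_prod :: "complex \<Rightarrow> 'a \<times> 'b \<Rightarrow> 'a \<times> 'b"
  where "scaleC_prod c x = (c *\<^sub>C fst x, c *\<^sub>C snd x)"
instance
  by standard (simp_all add: scaleC_prod_def scaleC_add_right scaleC_add_left scaleC_scaleC
      scaleC_of_real prod_eq_iff)
end

instantiation vec :: (complex_euclidean_space, finite) complex_euclidean_space
begin
definition scaleC_vec :: "complex \<Rightarrow> 'a ^ 'b \<Rightarrow> 'a ^ 'b"
  where "scaleC_vec c x = (\<chi> i. c *\<^sub>C (x $ i))"
instance
  by standard (simp_all add: scaleC_vec_def scaleC_add_right scaleC_add_left scaleC_scaleC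
      scaleC_of_real vec_eq_iff)
end

definition holomorphic_at ::
    "('a::complex_euclidean_space \<Rightarrow> 'b::complex_euclidean_space) \<Rightarrow> 'a \<Rightarrow> bool"
  where "holomorphic_at f x \<longleftrightarrow>
    (\<exists>D. (f has_derivative D) (at x) \<and> (\<forall>c v. D (c *\<^sub>C v) = c *\<^sub>C D v))"


section \<open>Complex manifolds, tangent spaces, holomorphic maps\<close>

text \<open>A chart is an open set together with a coordinate map; values of the coordinate map outside
  that set carry no information. A complex manifold is given by an atlas, and its underlying space
  is the union of the chart domains (an open subset of the ambient Hausdorff type).\<close>

type_synonym ('a, 'e) chart = "'a set \<times> ('a \<Rightarrow> 'e)"

definition chart_inv :: "('a, 'e) chart \<Rightarrow> 'e \<Rightarrow> 'a"
  where "chart_inv c = inv_into (fst c) (snd c)"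

definition transition :: "('a, 'e) chart \<Rightarrow> ('a, 'f) chart \<Rightarrow> 'e \<Rightarrow> 'f"
  where "transition c d = snd d \<circ> chart_inv c"

definition complex_atlas :: "('a::t2_space, 'e::complex_euclidean_space) chart set \<Rightarrow> bool"
  where "complex_atlas A \<longleftrightarrow>
    (\<forall>c\<in>A. open (fst c) \<and> open (snd c ` fst c) \<and>
       homeomorphism (fst c) (snd c ` fst c) (snd c) (chart_inv c)) \<and>
    (\<forall>c\<in>A. \<forall>d\<in>A. \<forall>x\<in>snd c ` (fst c \<inter> fst d). holomorphic_at (transition c d) x)"

definition manifold_carrier :: "('a, 'e) chart set \<Rightarrow> 'a set"
  where "manifold_carrier A = (\<Union>c\<in>A. fst c)"

definition charts_at :: "('a, 'e) chart set \<Rightarrow> 'a \<Rightarrow> ('a, 'e) chart set"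
  where "charts_at A p = {c \<in> A. p \<in> fst c}"

definition some_chart :: "('a, 'e) chart set \<Rightarrow> 'a \<Rightarrow> ('a, 'e) chart"
  where "some_chart A p = (SOME c. c \<in> charts_at A p)"

definition open_submanifold :: "('a, 'e) chart set \<Rightarrow> 'a set \<Rightarrow> ('a, 'e) chart set"
  where "open_submanifold A U = (\<lambda>c. (fst c \<inter> U, snd c)) ` A"

definition prod_atlas ::
    "('a, 'e) chart set \<Rightarrow> ('b, 'f) chart set \<Rightarrow> ('a \<times> 'b, 'e \<times> 'f) chart set"
  where "prod_atlas A B =
    (\<lambda>(c, d). (fst c \<times> fst d, map_prod (snd c) (snd d))) ` (A \<times> B)"

definition holomorphic_map ::
    "('a::t2_space, 'e::complex_euclidean_space) chart set \<Rightarrow>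
     ('b::t2_space, 'f::complex_euclidean_space) chart set \<Rightarrow> ('a \<Rightarrow> 'b) \<Rightarrow> bool"
  where "holomorphic_map A B F \<longleftrightarrow>
    F ` manifold_carrier A \<subseteq> manifold_carrier B \<and> continuous_on (manifold_carrier A) F \<and>
    (\<forall>c\<in>A. \<forall>d\<in>B. \<forall>x\<in>snd c ` (fst c \<inter> F -` fst d).
       holomorphic_at (snd d \<circ> F \<circ> chart_inv c) x)"

text \<open>A tangent vector at a point is represented by the family of its coordinate vectors in all
  charts of the atlas around the point, related by the Jacobians of the coordinate changes; the
  entries at all other charts are fixed to be zero. The vector space operations are pointwise.\<close>

type_synonym ('a, 'e) tvec = "('a, 'e) chart \<Rightarrow> 'e"

definition tangent_space ::
    "('a, 'e::complex_euclidean_space) chart set \<Rightarrow> 'a \<Rightarrow> ('a, 'e) tvec set"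
  where "tangent_space A p = {v.
    (\<forall>c. c \<notin> charts_at A p \<longrightarrow> v c = 0) \<and>
    (\<forall>c\<in>charts_at A p. \<forall>d\<in>charts_at A p.
       v d = frechet_derivative (transition c d) (at (snd c p)) (v c))}"

definition scale_tvec ::
    "complex \<Rightarrow> ('a, 'e::complex_euclidean_space) tvec \<Rightarrow> ('a, 'e) tvec"
  where "scale_tvec a v = (\<lambda>c. a *\<^sub>C v c)"

text \<open>The tangent vector at \<open>p\<close> whose coordinate vector in the chart \<open>c\<close> is \<open>w\<close>.\<close>

definition coord_vec ::
    "('a, 'e::complex_euclidean_space) chart set \<Rightarrow> ('a, 'e) chart \<Rightarrow> 'a \<Rightarrow> 'e \<Rightarrow> ('a, 'e) tvec"
  where "coord_vec A c p w = (\<lambda>d.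
    if d \<in> charts_at A p then frechet_derivative (transition c d) (at (snd c p)) w else 0)"

definition tangent_map ::
    "('a, 'e::complex_euclidean_space) chart set \<Rightarrow>
     ('b, 'f::complex_euclidean_space) chart set \<Rightarrow>
     ('a \<Rightarrow> 'b) \<Rightarrow> 'a \<Rightarrow> ('a, 'e) tvec \<Rightarrow> ('b, 'f) tvec"
  where "tangent_map A B F p v = (\<lambda>d.
    if d \<in> charts_at B (F p)
    then let c = some_chart A p in
      frechet_derivative (snd d \<circ> F \<circ> chart_inv c) (at (snd c p)) (v c)
    else 0)"

text \<open>Derivative at \<open>p\<close> in the direction \<open>v\<close> of a function with values in a fixed space of tangent
  vectors (such as a Lie algebra), computed entrywise.\<close>

definition vec_deriv ::
    "('a, 'e::complex_euclidean_space) chart set \<Rightarrow>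
     ('a \<Rightarrow> ('b, 'f::complex_euclidean_space) tvec) \<Rightarrow> 'a \<Rightarrow> ('a, 'e) tvec \<Rightarrow> ('b, 'f) tvec"
  where "vec_deriv A h p v = (\<lambda>d. let c = some_chart A p in
    frechet_derivative (\<lambda>z. h (chart_inv c z) d) (at (snd c p)) (v c))"


section \<open>Complex Lie groups and their Lie algebras\<close>

record ('a, 'e) lie_group = "'a monoid" +
  atlas :: "('a, 'e) chart set"

definition complex_lie_group ::
    "('k::t2_space, 'e::complex_euclidean_space) lie_group \<Rightarrow> bool"
  where "complex_lie_group K \<longleftrightarrow>
    group K \<and> complex_atlas (atlas K) \<and> carrier K = manifold_carrier (atlas K) \<and>
    holomorphic_map (prod_atlas (atlas K) (atlas K)) (atlas K) (\<lambda>(x, y). x \<otimes>\<^bsub>K\<^esub> y) \<and>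
    holomorphic_map (atlas K) (atlas K) (\<lambda>x. inv\<^bsub>K\<^esub> x)"

definition lie_algebra ::
    "('k, 'e::complex_euclidean_space) lie_group \<Rightarrow> ('k, 'e) tvec set"
  where "lie_algebra K = tangent_space (atlas K) \<one>\<^bsub>K\<^esub>"

definition Ad ::
    "('k, 'e::complex_euclidean_space) lie_group \<Rightarrow> 'k \<Rightarrow> ('k, 'e) tvec \<Rightarrow> ('k, 'e) tvec"
  where "Ad K g X =
    tangent_map (atlas K) (atlas K) (\<lambda>x. g \<otimes>\<^bsub>K\<^esub> x \<otimes>\<^bsub>K\<^esub> inv\<^bsub>K\<^esub> g) \<one>\<^bsub>K\<^esub> X"

text \<open>The bracket is \<open>[X, Y] = ad X Y\<close>, where \<open>ad\<close> is the differential of \<open>Ad\<close> at the identity.\<close>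

definition lie_bracket ::
    "('k, 'e::complex_euclidean_space) lie_group \<Rightarrow>
     ('k, 'e) tvec \<Rightarrow> ('k, 'e) tvec \<Rightarrow> ('k, 'e) tvec"
  where "lie_bracket K X Y = vec_deriv (atlas K) (\<lambda>g. Ad K g Y) \<one>\<^bsub>K\<^esub> X"

definition lie_ideal ::
    "('k, 'e::complex_euclidean_space) lie_group \<Rightarrow> ('k, 'e) tvec set \<Rightarrow> bool"
  where "lie_ideal K I \<longleftrightarrow>
    I \<subseteq> lie_algebra K \<and> 0 \<in> I \<and> (\<forall>X\<in>I. \<forall>Y\<in>I. X + Y \<in> I) \<and>
    (\<forall>a. \<forall>X\<in>I. scale_tvec a X \<in> I) \<and>
    (\<forall>X\<in>lie_algebra K. \<forall>Y\<in>I. lie_bracket K X Y \<in> I)"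

definition has_simple_lie_algebra :: "('k, 'e::complex_euclidean_space) lie_group \<Rightarrow> bool"
  where "has_simple_lie_algebra K \<longleftrightarrow>
    (\<exists>X\<in>lie_algebra K. \<exists>Y\<in>lie_algebra K. lie_bracket K X Y \<noteq> 0) \<and>
    (\<forall>I. lie_ideal K I \<longrightarrow> I = {0} \<or> I = lie_algebra K)"


section \<open>Holomorphic 1-forms with values in the Lie algebra\<close>

text \<open>Forms are normalised to vanish on arguments that are not tangent vectors, so that equality of
  forms is equality of functions.\<close>

type_synonym ('a, 'e, 'k, 'f) lie_form = "'a \<Rightarrow> ('a, 'e) tvec \<Rightarrow> ('k, 'f) tvec"

definition hol_forms ::
    "('k::t2_space, 'f::complex_euclidean_space) lie_group \<Rightarrow>
     ('a::t2_space, 'e::complex_euclidean_space) chart set \<Rightarrow> ('a, 'e, 'k, 'f) lie_form set"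
  where "hol_forms K A = {\<omega>.
    (\<forall>p v. \<not> (p \<in> manifold_carrier A \<and> v \<in> tangent_space A p) \<longrightarrow> \<omega> p v = 0) \<and>
    (\<forall>p\<in>manifold_carrier A. \<forall>u\<in>tangent_space A p. \<forall>v\<in>tangent_space A p. \<forall>a.
       \<omega> p u \<in> lie_algebra K \<and> \<omega> p (u + v) = \<omega> p u + \<omega> p v \<and>
       \<omega> p (scale_tvec a u) = scale_tvec a (\<omega> p u)) \<and>
    (\<forall>c\<in>A. \<forall>w. \<forall>d\<in>charts_at (atlas K) \<one>\<^bsub>K\<^esub>. \<forall>x\<in>snd c ` fst c.
       holomorphic_at (\<lambda>z. \<omega> (chart_inv c z) (coord_vec A c (chart_inv c z) w) d) x)}"

definition pullback_form ::
    "('a, 'e::complex_euclidean_space) chart set \<Rightarrow>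
     ('b, 'g::complex_euclidean_space) chart set \<Rightarrow>
     ('a \<Rightarrow> 'b) \<Rightarrow> ('b, 'g, 'k, 'f::complex_euclidean_space) lie_form \<Rightarrow> ('a, 'e, 'k, 'f) lie_form"
  where "pullback_form A B F \<omega> = (\<lambda>p v.
    if p \<in> manifold_carrier A \<and> v \<in> tangent_space A p
    then \<omega> (F p) (tangent_map A B F p v) else 0)"

text \<open>Exterior derivative: \<open>d\<omega>(u, v) = u(\<omega>(V)) - v(\<omega>(U))\<close>, where \<open>U\<close>, \<open>V\<close> are the extensions of
  \<open>u\<close>, \<open>v\<close> with constant coefficients in a chart (so \<open>[U, V] = 0\<close>).\<close>

definition ext_deriv ::
    "('a, 'e::complex_euclidean_space) chart set \<Rightarrow>
     ('a, 'e, 'k, 'f::complex_euclidean_space) lie_form \<Rightarrow>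
     'a \<Rightarrow> ('a, 'e) tvec \<Rightarrow> ('a, 'e) tvec \<Rightarrow> ('k, 'f) tvec"
  where "ext_deriv A \<omega> p u v = (let c = some_chart A p in
    vec_deriv A (\<lambda>q. \<omega> q (coord_vec A c q (v c))) p u
    - vec_deriv A (\<lambda>q. \<omega> q (coord_vec A c q (u c))) p v)"


section \<open>The group \<open>\<O>(\<Sigma>, K)\<close> and its coadjoint action\<close>

text \<open>In this section and the next one, \<open>S\<close> is the atlas of a Riemann surface. Maps defined on the
  surface only are represented by functions in \<^const>\<open>extensional\<close>.\<close>

definition riemann_surface :: "('s::t2_space, complex) chart set \<Rightarrow> bool"
  where "riemann_surface S \<longleftrightarrow>
    complex_atlas S \<and> manifold_carrier S \<noteq> {} \<and> connected (manifold_carrier S)"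

definition current_group ::
    "('k::t2_space, 'e::complex_euclidean_space) lie_group \<Rightarrow>
     ('s::t2_space, complex) chart set \<Rightarrow> ('s \<Rightarrow> 'k) monoid"
  where "current_group K S = \<lparr>
    carrier = {f \<in> extensional (manifold_carrier S). holomorphic_map S (atlas K) f},
    monoid.mult = (\<lambda>f g. \<lambda>s\<in>manifold_carrier S. f s \<otimes>\<^bsub>K\<^esub> g s),
    one = (\<lambda>s\<in>manifold_carrier S. \<one>\<^bsub>K\<^esub>)\<rparr>"

text \<open>\<open>\<delta>(f) = f\<^sup>-\<^sup>1 df\<close>: the differential of \<open>f\<close> followed by left translation to the identity.\<close>

definition log_deriv ::
    "('k, 'e::complex_euclidean_space) lie_group \<Rightarrow> ('s, complex) chart set \<Rightarrow>
     ('s \<Rightarrow> 'k) \<Rightarrow> ('s, complex, 'k, 'e) lie_form"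
  where "log_deriv K S f = (\<lambda>p v.
    if p \<in> manifold_carrier S \<and> v \<in> tangent_space S p
    then tangent_map (atlas K) (atlas K) (\<lambda>x. inv\<^bsub>K\<^esub> (f p) \<otimes>\<^bsub>K\<^esub> x) (f p)
           (tangent_map S (atlas K) f p v)
    else 0)"

text \<open>The operator \<open>\<lambda>\<partial> + \<xi>\<close> is represented by the pair \<open>(\<lambda>, \<xi>)\<close>.\<close>

definition smooth_dual ::
    "('k::t2_space, 'e::complex_euclidean_space) lie_group \<Rightarrow>
     ('s::t2_space, complex) chart set \<Rightarrow> (complex \<times> ('s, complex, 'k, 'e) lie_form) set"
  where "smooth_dual K S = UNIV \<times> hol_forms K S"

definition hyperplane ::
    "('k::t2_space, 'e::complex_euclidean_space) lie_group \<Rightarrow>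
     ('s::t2_space, complex) chart set \<Rightarrow> complex \<Rightarrow>
     (complex \<times> ('s, complex, 'k, 'e) lie_form) set"
  where "hyperplane K S l = {x \<in> smooth_dual K S. fst x = l}"

text \<open>This is a right action of the current group; \<^const>\<open>orbit\<close> and \<^const>\<open>orbits\<close> only use the set
  of translates of a point. The term \<open>\<delta>(f)\<close> enters without a factor \<open>\<lambda>\<close>, so that the action on the
  \<open>\<xi>\<close>-component is the same on all hyperplanes, including \<open>\<lambda> = 0\<close>.\<close>

definition coadjoint ::
    "('k, 'e::complex_euclidean_space) lie_group \<Rightarrow> ('s, complex) chart set \<Rightarrow> ('s \<Rightarrow> 'k) \<Rightarrow>
     complex \<times> ('s, complex, 'k, 'e) lie_form \<Rightarrow> complex \<times> ('s, complex, 'k, 'e) lie_form"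
  where "coadjoint K S f = (\<lambda>(l, \<xi>).
    (l, \<lambda>p v.
      if p \<in> manifold_carrier S \<and> v \<in> tangent_space S p
      then log_deriv K S f p v + Ad K (inv\<^bsub>K\<^esub> (f p)) (\<xi> p v) else 0))"


section \<open>Connections on the trivial principal bundle \<open>K \<times> \<Sigma>\<close>\<close>

definition trivial_bundle ::
    "('k, 'e) lie_group \<Rightarrow> ('s, complex) chart set \<Rightarrow> ('k \<times> 's, 'e \<times> complex) chart set"
  where "trivial_bundle K S = prod_atlas (atlas K) S"

definition right_act :: "('k, 'e) lie_group \<Rightarrow> 'k \<times> 's \<Rightarrow> 'k \<Rightarrow> 'k \<times> 's"
  where "right_act K p g = (fst p \<otimes>\<^bsub>K\<^esub> g, snd p)"

text \<open>The value at \<open>p\<close> of the fundamental vector field of \<open>X\<close>.\<close>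

definition fundamental_vec ::
    "('k, 'e::complex_euclidean_space) lie_group \<Rightarrow> ('s, complex) chart set \<Rightarrow>
     'k \<times> 's \<Rightarrow> ('k, 'e) tvec \<Rightarrow> ('k \<times> 's, 'e \<times> complex) tvec"
  where "fundamental_vec K S p X =
    tangent_map (atlas K) (trivial_bundle K S) (right_act K p) \<one>\<^bsub>K\<^esub> X"

definition connections ::
    "('k::t2_space, 'e::complex_euclidean_space) lie_group \<Rightarrow>
     ('s::t2_space, complex) chart set \<Rightarrow> ('k \<times> 's, 'e \<times> complex, 'k, 'e) lie_form set"
  where "connections K S = {\<omega> \<in> hol_forms K (trivial_bundle K S).
    (\<forall>p\<in>manifold_carrier (trivial_bundle K S). \<forall>X\<in>lie_algebra K.
       \<omega> p (fundamental_vec K S p X) = X) \<and>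
    (\<forall>g\<in>carrier K. \<forall>p\<in>manifold_carrier (trivial_bundle K S).
     \<forall>v\<in>tangent_space (trivial_bundle K S) p.
       \<omega> (right_act K p g)
         (tangent_map (trivial_bundle K S) (trivial_bundle K S) (\<lambda>q. right_act K q g) p v)
       = Ad K (inv\<^bsub>K\<^esub> g) (\<omega> p v))}"

definition horizontal_part ::
    "('k, 'e::complex_euclidean_space) lie_group \<Rightarrow> ('s, complex) chart set \<Rightarrow>
     ('k \<times> 's, 'e \<times> complex, 'k, 'e) lie_form \<Rightarrow>
     'k \<times> 's \<Rightarrow> ('k \<times> 's, 'e \<times> complex) tvec \<Rightarrow> ('k \<times> 's, 'e \<times> complex) tvec"
  where "horizontal_part K S \<omega> p u = u - fundamental_vec K S p (\<omega> p u)"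

text \<open>The curvature form is the exterior covariant derivative of the connection form, i.e. its
  exterior derivative evaluated on horizontal parts.\<close>

definition curvature ::
    "('k, 'e::complex_euclidean_space) lie_group \<Rightarrow> ('s, complex) chart set \<Rightarrow>
     ('k \<times> 's, 'e \<times> complex, 'k, 'e) lie_form \<Rightarrow> 'k \<times> 's \<Rightarrow>
     ('k \<times> 's, 'e \<times> complex) tvec \<Rightarrow> ('k \<times> 's, 'e \<times> complex) tvec \<Rightarrow> ('k, 'e) tvec"
  where "curvature K S \<omega> p u v =
    ext_deriv (trivial_bundle K S) \<omega> p (horizontal_part K S \<omega> p u) (horizontal_part K S \<omega> p v)"

definition flat_connections ::
    "('k::t2_space, 'e::complex_euclidean_space) lie_group \<Rightarrow>
     ('s::t2_space, complex) chart set \<Rightarrow> ('k \<times> 's, 'e \<times> complex, 'k, 'e) lie_form set"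
  where "flat_connections K S = {\<omega> \<in> connections K S.
    \<forall>p\<in>manifold_carrier (trivial_bundle K S).
    \<forall>u\<in>tangent_space (trivial_bundle K S) p. \<forall>v\<in>tangent_space (trivial_bundle K S) p.
      curvature K S \<omega> p u v = 0}"

text \<open>Holomorphic bundle automorphisms covering the identity.\<close>

definition gauge_transformation ::
    "('k::t2_space, 'e::complex_euclidean_space) lie_group \<Rightarrow>
     ('s::t2_space, complex) chart set \<Rightarrow> ('k \<times> 's \<Rightarrow> 'k \<times> 's) \<Rightarrow> bool"
  where "gauge_transformation K S F \<longleftrightarrow>
    (let P = manifold_carrier (trivial_bundle K S) in
      bij_betw F P P \<and> holomorphic_map (trivial_bundle K S) (trivial_bundle K S) F \<and>
      holomorphic_map (trivial_bundle K S) (trivial_bundle K S) (inv_into P F) \<and>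
      (\<forall>p\<in>P. snd (F p) = snd p \<and> (\<forall>g\<in>carrier K. F (right_act K p g) = right_act K (F p) g)))"

definition gauge_equiv ::
    "('k::t2_space, 'e::complex_euclidean_space) lie_group \<Rightarrow>
     ('s::t2_space, complex) chart set \<Rightarrow> (('k \<times> 's, 'e \<times> complex, 'k, 'e) lie_form) rel"
  where "gauge_equiv K S = {(\<omega>, \<omega>').
    \<omega> \<in> flat_connections K S \<and> \<omega>' \<in> flat_connections K S \<and>
    (\<exists>F. gauge_transformation K S F \<and>
       \<omega> = pullback_form (trivial_bundle K S) (trivial_bundle K S) F \<omega>')}"

text \<open>The restriction of a connection form along the canonical section \<open>s \<mapsto> (1, s)\<close>.\<close>

definition base_form ::
    "('k, 'e::complex_euclidean_space) lie_group \<Rightarrow> ('s, complex) chart set \<Rightarrow>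
     ('k \<times> 's, 'e \<times> complex, 'k, 'e) lie_form \<Rightarrow> ('s, complex, 'k, 'e) lie_form"
  where "base_form K S \<omega> = pullback_form S (trivial_bundle K S) (\<lambda>s. (\<one>\<^bsub>K\<^esub>, s)) \<omega>"

end

theory Submission
  imports Defs "HOL-Complex_Analysis.Cauchy_Integral_Formula"
begin

text \<open>A connection form on \<open>K \<times> \<Sigma>\<close> is determined by its restriction \<open>\<xi>\<close> to the section
  \<open>s \<mapsto> (1, s)\<close>: reproduction of fundamental vectors and equivariance force
  \<open>\<omega>\<^bsub>(g, s)\<^esub> = g\<^sup>-\<^sup>1 dg + Ad(g)\<^sup>-\<^sup>1 \<xi>\<^sub>s\<close>. Conversely this formula defines a connection for every
  holomorphic form \<open>\<xi>\<close>; its holomorphy requires that the derivative of a holomorphic function of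
  several variables is again holomorphic, which follows from Cauchy's integral formula by
  differentiation under the integral. Horizontal spaces are complex lines, so that the curvature, being
  complex bilinear and alternating on them, vanishes, and every connection is flat. A gauge
  transformation is of the form \<open>(g, s) \<mapsto> (f(s) g, s)\<close>, and pulling back along it replaces \<open>\<xi>\<close> by
  \<open>f\<^sup>-\<^sup>1 df + Ad(f)\<^sup>-\<^sup>1 \<xi>\<close>, which is the coadjoint action. Hence the coadjoint orbit of \<open>\<xi>\<close> consists
  of the restrictions of the connections gauge equivalent to \<open>\<omega>\<close>.\<close>

section \<open>Holomorphic functions of several variables\<close>

text \<open>Differentiability in \<open>holomorphic_at\<close> is pointwise, and tangent maps are
  computed in an arbitrarily chosen chart. Coordinates are therefore confined as far as possible to
  one chain rule, after which identities between tangent maps reduce by functoriality to identities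
  between the maps themselves. Continuity of derivatives is nowhere assumed: Cauchy's formula has to
  supply it before the integral may be differentiated. A second obstacle would be the holomorphy of
  a form pulled back along a gauge transformation. It is bypassed: a form that is additive,
  equivariant and reproduces fundamental vectors is determined by its base form, so a pullback is
  only shown to have these algebraic properties and is then compared with a form already known to be
  a connection. Orbits are likewise treated as sets of pullbacks, so that their equality is decided
  by composing and inverting gauge transformations. Since \<lambda> is merely carried along, one
  argument serves every hyperplane.\<close>

definition clinear_map :: "('a::complex_euclidean_space \<Rightarrow> 'b::complex_euclidean_space) \<Rightarrow> bool"
  where "clinear_map D \<longleftrightarrow> linear D \<and> (\<forall>c v. D (c *\<^sub>C v) = c *\<^sub>C D v)"

lemma scaleC_zero_left [simp]: "0 *\<^sub>C x = (0::'a::complex_euclidean_space)"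
  using scaleC_of_real[of 0 x] by simp

lemma scaleC_zero_right [simp]: "c *\<^sub>C (0::'a::complex_euclidean_space) = 0"
  by (metis add_cancel_right_right scaleC_add_right)

lemma scaleC_one [simp]: "1 *\<^sub>C x = (x::'a::complex_euclidean_space)"
  using scaleC_of_real[of 1 x] by simp

lemma scaleC_minus_one: "(-1) *\<^sub>C x = - (x::'a::complex_euclidean_space)"
  using scaleC_of_real[of "-1" x] by simp

lemma scaleC_scaleR: "c *\<^sub>C (r *\<^sub>R x) = r *\<^sub>R (c *\<^sub>C (x::'a::complex_euclidean_space))"
  by (metis mult.commute scaleC_of_real scaleC_scaleC)

text \<open>The class does not relate the norm to multiplication by \<i>; continuity of
  \<open>scaleC\<close> comes from finite dimension, where every bilinear map is bounded.\<close>

lemma bounded_bilinear_scaleC: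
  "bounded_bilinear (\<lambda>c (x::'a::complex_euclidean_space). c *\<^sub>C x)"
proof -
  have "bilinear (\<lambda>c (x::'a). c *\<^sub>C x)"
    unfolding bilinear_def
    by (auto intro!: linearI simp: scaleC_add_left scaleC_add_right scaleC_scaleR
        scaleR_conv_of_real scaleC_scaleC[symmetric] scaleC_of_real)
  then show ?thesis
    by (simp add: bilinear_conv_bounded_bilinear)
qed

lemmas continuous_on_scaleC [continuous_intros] =
  bounded_bilinear.continuous_on[OF bounded_bilinear_scaleC]

lemma bounded_linear_scaleC_right:
  "bounded_linear (\<lambda>x::'a::complex_euclidean_space. c *\<^sub>C x)"
  by (rule bounded_bilinear.bounded_linear_right[OF bounded_bilinear_scaleC])

lemma clinear_map_add: "clinear_map D \<Longrightarrow> D (x + y) = D x + D y"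
  by (simp add: clinear_map_def linear_add)

lemma clinear_map_scaleC: "clinear_map D \<Longrightarrow> D (c *\<^sub>C x) = c *\<^sub>C D x"
  by (simp add: clinear_map_def)

lemma clinear_map_0: "clinear_map D \<Longrightarrow> D 0 = 0"
  by (simp add: clinear_map_def linear_0)

section \<open>Complex differentiability at a point\<close>

lemma holomorphic_at_iff:
  "holomorphic_at f x \<longleftrightarrow> (\<exists>D. (f has_derivative D) (at x) \<and> clinear_map D)"
  unfolding holomorphic_at_def clinear_map_def
  using has_derivative_linear by blast

lemma holomorphic_atI: "(f has_derivative D) (at x) \<Longrightarrow> clinear_map D \<Longrightarrow> holomorphic_at f x"
  by (auto simp: holomorphic_at_iff)

lemma holomorphic_at_has_derivative:
  "holomorphic_at f x \<Longrightarrow> (f has_derivative frechet_derivative f (at x)) (at x)"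
  by (metis holomorphic_at_def frechet_derivative_at)

lemma holomorphic_at_clinear:
  "holomorphic_at f x \<Longrightarrow> clinear_map (frechet_derivative f (at x))"
  by (metis holomorphic_at_iff frechet_derivative_at)

lemma holomorphic_at_continuous: "holomorphic_at f x \<Longrightarrow> isCont f x"
  by (metis holomorphic_at_def has_derivative_continuous)

lemma frechet_derivative_eqI: "(f has_derivative D) (at x) \<Longrightarrow> frechet_derivative f (at x) = D"
  by (metis frechet_derivative_at)

text \<open>Coordinate representations of equal maps agree only near the point in question, since
  \<open>chart_inv\<close> is unspecified away from the image of the chart. Derivatives therefore
  have to be transferred along eventual equality.\<close>

lemma has_derivative_eventually_cong:
  assumes "eventually (\<lambda>y. f y = g y) (nhds x)"
  shows "(f has_derivative D) (at x) \<longleftrightarrow> (g has_derivative D) (at x)"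
proof -
  have "f x = g x"
    using assms by (rule eventually_nhds_x_imp_x)
  moreover have "eventually (\<lambda>y. f y = g y) (at x)" "eventually (\<lambda>y. g y = f y) (at x)"
    using assms by (simp_all add: eventually_nhds_conv_at eq_commute)
  ultimately show ?thesis
    using has_derivative_transform_eventually[of f D x UNIV g]
      has_derivative_transform_eventually[of g D x UNIV f] by auto
qed

lemmas has_derivative_eventually_transfer =
  has_derivative_eventually_cong[THEN iffD1, rotated]

lemma frechet_derivative_eventually_cong:
  assumes "eventually (\<lambda>y. f y = g y) (nhds x)"
  shows "frechet_derivative f (at x) = frechet_derivative g (at x)"
  unfolding frechet_derivative_def using has_derivative_eventually_cong[OF assms] by simp

lemma holomorphic_at_eventually_cong:
  assumes "eventually (\<lambda>y. f y = g y) (nhds x)"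
  shows "holomorphic_at f x \<longleftrightarrow> holomorphic_at g x"
  unfolding holomorphic_at_def using has_derivative_eventually_cong[OF assms] by simp

lemmas holomorphic_at_eventually_transfer =
  holomorphic_at_eventually_cong[THEN iffD1, rotated]

lemma holomorphic_at_compose:
  assumes "holomorphic_at f x" "holomorphic_at g (f x)"
  shows "holomorphic_at (g \<circ> f) x"
    and "frechet_derivative (g \<circ> f) (at x) v
      = frechet_derivative g (at (f x)) (frechet_derivative f (at x) v)"
proof -
  have d: "((g \<circ> f) has_derivative
      (frechet_derivative g (at (f x)) \<circ> frechet_derivative f (at x))) (at x)"
    using assms[THEN holomorphic_at_has_derivative] by (rule diff_chain_at)
  then show "frechet_derivative (g \<circ> f) (at x) v
      = frechet_derivative g (at (f x)) (frechet_derivative f (at x) v)"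
    by (simp add: frechet_derivative_eqI)
  show "holomorphic_at (g \<circ> f) x"
    using d assms[THEN holomorphic_at_clinear]
    by (intro holomorphic_atI[OF d]) (auto simp: clinear_map_def intro: linear_compose)
qed

lemma holomorphic_at_compose2:
  "holomorphic_at f x \<Longrightarrow> holomorphic_at g (f x) \<Longrightarrow> holomorphic_at (\<lambda>x. g (f x)) x"
  using holomorphic_at_compose(1)[of f x g] by (simp add: o_def)

lemma holomorphic_at_const: "holomorphic_at (\<lambda>_. c) x"
  by (rule holomorphic_atI[where D="\<lambda>_. 0"]) (auto simp: clinear_map_def intro!: linear_zero)

lemma clinear_map_imp_holomorphic_at: "clinear_map f \<Longrightarrow> holomorphic_at f x"
  by (intro holomorphic_atI[of f f] linear_imp_has_derivative) (auto simp: clinear_map_def)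

lemma holomorphic_at_ident: "holomorphic_at (\<lambda>x. x) x"
  by (rule clinear_map_imp_holomorphic_at) (auto simp: clinear_map_def linear_iff)

lemma holomorphic_at_fst: "holomorphic_at fst x"
  by (rule clinear_map_imp_holomorphic_at) (auto simp: clinear_map_def linear_iff scaleC_prod_def)

lemma holomorphic_at_snd: "holomorphic_at snd x"
  by (rule clinear_map_imp_holomorphic_at) (auto simp: clinear_map_def linear_iff scaleC_prod_def)

lemma holomorphic_at_Pair:
  assumes "holomorphic_at f x" "holomorphic_at g x"
  shows "holomorphic_at (\<lambda>x. (f x, g x)) x"
    and "frechet_derivative (\<lambda>x. (f x, g x)) (at x) v
      = (frechet_derivative f (at x) v, frechet_derivative g (at x) v)"
proof -
  have d: "((\<lambda>x. (f x, g x)) has_derivative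
      (\<lambda>v. (frechet_derivative f (at x) v, frechet_derivative g (at x) v))) (at x)"
    using assms[THEN holomorphic_at_has_derivative] by (rule has_derivative_Pair)
  then show "frechet_derivative (\<lambda>x. (f x, g x)) (at x) v
      = (frechet_derivative f (at x) v, frechet_derivative g (at x) v)"
    by (simp add: frechet_derivative_eqI)
  show "holomorphic_at (\<lambda>x. (f x, g x)) x"
    using d assms[THEN holomorphic_at_clinear]
    by (intro holomorphic_atI[OF d]) (auto simp: clinear_map_def scaleC_prod_def linear_iff)
qed

lemma holomorphic_at_add:
  assumes "holomorphic_at f x" "holomorphic_at g x"
  shows "holomorphic_at (\<lambda>x. f x + g x) x"
proof (rule holomorphic_atI)
  show "((\<lambda>x. f x + g x) has_derivative
      (\<lambda>v. frechet_derivative f (at x) v + frechet_derivative g (at x) v)) (at x)"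
    using assms[THEN holomorphic_at_has_derivative] by (rule has_derivative_add)
  show "clinear_map (\<lambda>v. frechet_derivative f (at x) v + frechet_derivative g (at x) v)"
    using assms[THEN holomorphic_at_clinear]
    by (auto simp: clinear_map_def scaleC_add_right intro: linear_compose_add)
qed

lemma holomorphic_at_scaleC_derivative:
  assumes "holomorphic_at f x"
  shows "frechet_derivative (\<lambda>x. c *\<^sub>C f x) (at x) v = c *\<^sub>C frechet_derivative f (at x) v"
  by (subst frechet_derivative_eqI[OF bounded_linear.has_derivative[OF
      bounded_linear_scaleC_right holomorphic_at_has_derivative[OF assms]]]) simp

text \<open>The inner product is only real bilinear and need not be compatible with the complex
  structure; \<open>cfunctional b\<close> is the complex linear functional with real part \<open>x \<mapsto> x \<bullet> b\<close>.\<close>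

definition cfunctional :: "'a::complex_euclidean_space \<Rightarrow> 'a \<Rightarrow> complex"
  where "cfunctional b x = Complex (x \<bullet> b) (- ((\<i> *\<^sub>C x) \<bullet> b))"

lemma scaleC_Re_Im: "c *\<^sub>C x = Re c *\<^sub>R x + Im c *\<^sub>R (\<i> *\<^sub>C (x::'a::complex_euclidean_space))"
  by (subst complex_eq[of c])
    (simp add: scaleC_add_left scaleC_of_real scaleC_scaleC[symmetric] scaleC_scaleR mult.commute)

text \<open>Complex linearity of L forces Im L(x) = - Re L(\<i> x), which dictates the second
  component of \<open>cfunctional\<close>. Conversely homogeneity follows by splitting the scalar
  into real and imaginary part.\<close>

lemma clinear_map_cfunctional: "clinear_map (cfunctional b)"
proof -
  have "linear (cfunctional b)"
    by (rule linearI)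
      (auto simp: cfunctional_def complex_eq_iff scaleC_add_right scaleC_scaleR inner_add_left)
  moreover have "cfunctional b (c *\<^sub>C v) = c * cfunctional b v" for c v
    unfolding scaleC_Re_Im[of c v]
    by (simp add: cfunctional_def complex_eq_iff scaleC_add_right scaleC_scaleR inner_add_left
        scaleC_scaleC scaleC_minus_one algebra_simps)
  ultimately show ?thesis
    by (simp add: clinear_map_def scaleC_complex_def)
qed

lemma Re_cfunctional [simp]: "Re (cfunctional b x) = x \<bullet> b"
  by (simp add: cfunctional_def)

text \<open>Cauchy's formula on the complex line z + u w writes the derivative as an integral of
  values of F over a circle. Used once, it turns continuity of F into continuity of the derivative;
  that continuity then permits differentiation under the integral sign.\<close>

lemma holomorphic_at_derivative_direction_complex:
  fixes F :: "'a::complex_euclidean_space \<Rightarrow> complex"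
  assumes U: "open U" and hol: "\<And>x. x \<in> U \<Longrightarrow> holomorphic_at F x" and z0: "z0 \<in> U"
  shows "holomorphic_at (\<lambda>z. frechet_derivative F (at z) w) z0"
proof -
  define D where "D z = frechet_derivative F (at z)" for z
  have D: "(F has_derivative D z) (at z)" and clin: "clinear_map (D z)" if "z \<in> U" for z
    using hol[OF that] holomorphic_at_has_derivative holomorphic_at_clinear unfolding D_def by auto
  have contF: "continuous_on U F"
    using hol by (intro continuous_at_imp_continuous_on ballI holomorphic_at_continuous)
  \<comment> \<open>The circle of radius r, parametrised over the unit interval. Its velocity is 2
    pi \<i> times itself, so the kernel 1/u^2 of the first derivative becomes 1/\<kappa> and the
    factor 2 pi \<i> of Cauchy's formula cancels.\<close>
  define \<kappa> where "\<kappa> r t = r * exp (2 * of_real pi * \<i> * of_real t)" for r :: complex and t :: real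
  have cont\<kappa>: "continuous_on A (\<kappa> r)" for A r
    unfolding \<kappa>_def by (intro continuous_intros)
  \<comment> \<open>One radius must serve all z near x, so that the integral formula holds on a
    whole ball and can be differentiated in z.\<close>
  have nbhd: "\<exists>r>0. \<exists>\<rho>>0. \<forall>z\<in>ball x \<rho>. \<forall>u\<in>cball 0 r. z + u *\<^sub>C w \<in> U" if "x \<in> U" for x w
  proof -
    let ?m = "\<lambda>q :: 'a \<times> complex. fst q + snd q *\<^sub>C w"
    have "open (?m -` U)"
      by (rule open_vimage[OF U]) (intro continuous_intros)
    moreover have "(x, 0) \<in> ?m -` U"
      using that by simp
    ultimately obtain A B where AB: "open A" "open B" "x \<in> A" "0 \<in> B" "A \<times> B \<subseteq> ?m -` U"
      by (elim open_prod_elim) auto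
    obtain \<rho> where \<rho>: "\<rho> > 0" "ball x \<rho> \<subseteq> A"
      using AB(1,3) openE by blast
    obtain r where r: "r > 0" "cball 0 r \<subseteq> B"
      using AB(2,4) open_contains_cball_eq by blast
    have "z + u *\<^sub>C w \<in> U" if "z \<in> ball x \<rho>" "u \<in> cball 0 r" for z u
    proof -
      have "(z, u) \<in> ?m -` U"
        using that \<rho>(2) r(2) AB(5) by blast
      then show ?thesis
        by simp
    qed
    with \<rho>(1) r(1) show ?thesis
      by blast
  qed
  have \<kappa>0: "\<kappa> r t \<noteq> 0" if "r > 0" for r :: real and t
    using that by (simp add: \<kappa>_def)
  have Cauchy: "D z w = integral {0..1} (\<lambda>t. F (z + \<kappa> r t *\<^sub>C w) / \<kappa> r t)"
    if r: "r > 0" and z: "\<And>u. u \<in> cball 0 r \<Longrightarrow> z + u *\<^sub>C w \<in> U" for r z w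
  proof -
    let ?g = "\<lambda>u. F (z + u *\<^sub>C w)"
    have g: "(?g has_field_derivative D (z + u *\<^sub>C w) w) (at u)" if "u \<in> cball 0 r" for u
    proof -
      have "((\<lambda>u. u *\<^sub>C w) has_derivative (\<lambda>h. h *\<^sub>C w)) (at u)"
        by (intro bounded_linear.has_derivative[OF _ has_derivative_ident]
            bounded_bilinear.bounded_linear_left[OF bounded_bilinear_scaleC])
      then have "((\<lambda>u. z + u *\<^sub>C w) has_derivative (\<lambda>h. h *\<^sub>C w)) (at u)"
        using has_derivative_add[OF has_derivative_const] by fastforce
      then have "(?g has_derivative (\<lambda>h. D (z + u *\<^sub>C w) (h *\<^sub>C w))) (at u)"
        using D[OF z[OF that]] by (rule has_derivative_compose)
      then show ?thesis
        by (simp add: has_field_derivative_def clinear_map_scaleC[OF clin[OF z[OF that]]]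
            scaleC_complex_def mult_commute_abs)
    qed
    have cont: "continuous_on (cball 0 r) ?g"
      using DERIV_isCont[OF g] by (intro continuous_at_imp_continuous_on) blast
    have holo: "?g holomorphic_on ball 0 r"
      unfolding holomorphic_on_def field_differentiable_def
    proof (intro ballI exI)
      show "(?g has_field_derivative D (z + u *\<^sub>C w) w) (at u within ball 0 r)" if "u \<in> ball 0 r" for u
        by (rule has_field_derivative_at_within[OF g]) (use that in simp)
    qed
    have "deriv ?g 0 = D z w"
      using g[of 0] r by (simp add: DERIV_imp_deriv)
    then have "contour_integral (circlepath 0 r) (\<lambda>u. ?g u / u\<^sup>2) = 2 * pi * \<i> * D z w"
      using Cauchy_contour_integral_circlepath_2[OF cont holo, of 0] r by simp
    moreover have "contour_integral (circlepath 0 r) (\<lambda>u. ?g u / u\<^sup>2)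
        = integral {0..1} (\<lambda>t. 2 * pi * \<i> * (?g (\<kappa> r t) / \<kappa> r t))"
    proof -
      have "?g (circlepath 0 r t) / (circlepath 0 r t)\<^sup>2 * vector_derivative (circlepath 0 r) (at t)
          = 2 * pi * \<i> * (?g (\<kappa> r t) / \<kappa> r t)" for t
      proof -
        have "circlepath 0 r t = \<kappa> r t" "vector_derivative (circlepath 0 r) (at t) = 2 * pi * \<i> * \<kappa> r t"
          by (simp_all only: vector_derivative_circlepath) (simp_all add: circlepath \<kappa>_def)
        then show ?thesis
          using \<kappa>0[OF r] by (simp add: power2_eq_square)
      qed
      then show ?thesis
        unfolding contour_integral_integral by simp
    qed
    ultimately have "2 * pi * \<i> * D z w = 2 * pi * \<i> * integral {0..1} (\<lambda>t. ?g (\<kappa> r t) / \<kappa> r t)"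
      by (simp only: integral_mult_right)
    then show ?thesis
      by simp
  qed
  have \<kappa>r: "\<kappa> r t \<in> cball 0 r" if "r > 0" for r :: real and t
    using that by (simp add: \<kappa>_def norm_mult)
  have cont_int: "continuous_on (ball x \<rho> \<times> cbox 0 1) (\<lambda>(z, t). G (z + \<kappa> r t *\<^sub>C w) / \<kappa> r t)"
    if G: "continuous_on U G" and r: "r > 0" and sub: "\<forall>z\<in>ball x \<rho>. \<forall>u\<in>cball 0 r. z + u *\<^sub>C w \<in> U"
    for G :: "'a \<Rightarrow> complex" and x r \<rho> w
  proof -
    have "continuous_on (ball x \<rho> \<times> cbox 0 1) (\<lambda>q. fst q + \<kappa> r (snd q) *\<^sub>C w)"
      "continuous_on (ball x \<rho> \<times> cbox 0 1) (\<lambda>q. \<kappa> r (snd q))"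
      unfolding \<kappa>_def by (intro continuous_intros)+
    then show ?thesis
      unfolding split_def using sub \<kappa>r[OF r] \<kappa>0[OF r]
      by (intro continuous_on_divide continuous_on_compose2[OF G]) auto
  qed
  \<comment> \<open>Of F only continuity is used under the integral here; the formula passes it on
    to the derivative.\<close>
  have contD: "continuous_on U (\<lambda>z. D z w)" for w
  proof (rule continuous_at_imp_continuous_on, rule ballI)
    fix x assume "x \<in> U"
    then obtain r \<rho> where r: "r > 0" and \<rho>: "\<rho> > 0"
      and sub: "\<forall>z\<in>ball x \<rho>. \<forall>u\<in>cball 0 r. z + u *\<^sub>C w \<in> U"
      using nbhd by blast
    have "continuous_on (ball x \<rho>) (\<lambda>z. integral (cbox 0 1) (\<lambda>t. F (z + \<kappa> r t *\<^sub>C w) / \<kappa> r t))"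
      by (rule integral_continuous_on_param[OF cont_int[OF contF r sub]])
    then have "continuous_on (ball x \<rho>) (\<lambda>z. D z w)"
      by (rule continuous_on_eq) (use Cauchy[OF r] sub in auto)
    then show "isCont (\<lambda>z. D z w) x"
      using \<rho> by (simp add: continuous_on_eq_continuous_at)
  qed
  obtain r \<rho> where r: "r > 0" and \<rho>: "\<rho> > 0"
    and sub: "\<forall>z\<in>ball z0 \<rho>. \<forall>u\<in>cball 0 r. z + u *\<^sub>C w \<in> U"
    using nbhd[OF z0] by blast
  \<comment> \<open>The derivative of the integrand as a bounded linear map:
    \<open>leibniz_rule\<close> wants it jointly continuous in operator norm. In finite dimension
    continuity in each fixed direction suffices, and that is \<open>contD\<close>.\<close>
  define B where "B z t = Blinfun (\<lambda>h. D (z + \<kappa> r t *\<^sub>C w) h / \<kappa> r t)" for z t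
  have inU: "z + \<kappa> r t *\<^sub>C w \<in> U" if "z \<in> ball z0 \<rho>" for z t
    using that sub \<kappa>r[OF r] by blast
  have B: "blinfun_apply (B z t) = (\<lambda>h. D (z + \<kappa> r t *\<^sub>C w) h / \<kappa> r t)" if "z \<in> ball z0 \<rho>" for z t
    unfolding B_def
    by (rule bounded_linear_Blinfun_apply)
      (rule bounded_linear_compose[OF bounded_linear_divide
          has_derivative_bounded_linear[OF D[OF inU[OF that]]]])
  have contB: "continuous_on (ball z0 \<rho> \<times> cbox 0 1) (\<lambda>(z, t). B z t)"
  proof (rule continuous_on_blinfun_componentwise)
    fix i :: 'a
    show "continuous_on (ball z0 \<rho> \<times> cbox 0 1) (\<lambda>q. blinfun_apply (case q of (z, t) \<Rightarrow> B z t) i)"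
      by (rule continuous_on_eq[OF cont_int[OF contD r sub]]) (auto simp: B)
  qed
  have pair: "continuous_on (cbox 0 1) (\<lambda>t::real. (z, t))" for z :: 'a
    by (intro continuous_intros)
  have z0\<rho>: "z0 \<in> ball z0 \<rho>"
    using \<rho> by simp
  have intB: "B z0 integrable_on cbox 0 1"
  proof (rule integrable_continuous)
    show "continuous_on (cbox 0 1) (B z0)"
      using continuous_on_compose2[OF contB pair[of z0]] \<rho> by (auto simp: image_subset_iff)
  qed
  have "((\<lambda>z. integral (cbox 0 1) (\<lambda>t. F (z + \<kappa> r t *\<^sub>C w) / \<kappa> r t)) has_derivative
      integral (cbox 0 1) (B z0)) (at z0 within ball z0 \<rho>)"
  proof (rule leibniz_rule[OF _ _ contB])
    fix z t assume z: "z \<in> ball z0 \<rho>" and "t \<in> cbox (0::real) 1"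
    have "((\<lambda>z. F (z + \<kappa> r t *\<^sub>C w)) has_derivative D (z + \<kappa> r t *\<^sub>C w)) (at z)"
    proof (rule has_derivative_compose[where g=F])
      show "(F has_derivative D (z + \<kappa> r t *\<^sub>C w)) (at (z + \<kappa> r t *\<^sub>C w))"
        by (rule D[OF inU[OF z]])
      show "((\<lambda>z. z + \<kappa> r t *\<^sub>C w) has_derivative (\<lambda>h. h)) (at z)"
        using has_derivative_add[OF has_derivative_ident has_derivative_const] by fastforce
    qed
    then have "((\<lambda>z. F (z + \<kappa> r t *\<^sub>C w) / \<kappa> r t) has_derivative blinfun_apply (B z t)) (at z)"
      unfolding B[OF z] by (rule bounded_linear.has_derivative[OF bounded_linear_divide])
    then show "((\<lambda>z. F (z + \<kappa> r t *\<^sub>C w) / \<kappa> r t) has_derivative blinfun_apply (B z t))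
        (at z within ball z0 \<rho>)"
      by (rule has_derivative_at_withinI)
  next
    fix z assume z: "z \<in> ball z0 \<rho>"
    show "(\<lambda>t. F (z + \<kappa> r t *\<^sub>C w) / \<kappa> r t) integrable_on cbox 0 1"
    proof (rule integrable_continuous)
      show "continuous_on (cbox 0 1) (\<lambda>t. F (z + \<kappa> r t *\<^sub>C w) / \<kappa> r t)"
        using continuous_on_compose2[OF cont_int[OF contF r sub] pair[of z]] z
        by (auto simp: image_subset_iff)
    qed
  qed (rule z0\<rho>, rule convex_ball)
  then have "((\<lambda>z. integral (cbox 0 1) (\<lambda>t. F (z + \<kappa> r t *\<^sub>C w) / \<kappa> r t)) has_derivative
      integral (cbox 0 1) (B z0)) (at z0)"
    unfolding at_within_open[OF z0\<rho> open_ball] .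
  moreover have "eventually (\<lambda>z. integral (cbox 0 1) (\<lambda>t. F (z + \<kappa> r t *\<^sub>C w) / \<kappa> r t) = D z w) (nhds z0)"
    by (rule eventually_nhds_in_open[OF open_ball z0\<rho>, THEN eventually_mono])
      (use Cauchy[OF r] sub in auto)
  ultimately have "((\<lambda>z. D z w) has_derivative integral (cbox 0 1) (B z0)) (at z0)"
    by (rule has_derivative_eventually_transfer)
  \<comment> \<open>The new derivative is an integral of complex linear maps, and a complex scalar
    can be pulled out of the integral.\<close>
  moreover have "clinear_map (blinfun_apply (integral (cbox 0 1) (B z0)))"
  proof -
    have "blinfun_apply (integral (cbox 0 1) (B z0)) (c *\<^sub>C v)
        = c * blinfun_apply (integral (cbox 0 1) (B z0)) v" for c v
      unfolding blinfun_apply_integral[OF intB] B[OF z0\<rho>]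
        clinear_map_scaleC[OF clin[OF inU[OF z0\<rho>]]] scaleC_complex_def
      by (simp only: integral_mult_right flip: times_divide_eq_right)
    then show ?thesis
      by (simp add: clinear_map_def scaleC_complex_def blinfun.bounded_linear_right
          bounded_linear.linear)
  qed
  ultimately show ?thesis
    unfolding D_def by (rule holomorphic_atI)
qed

text \<open>The coordinates of f are the real parts of the given functions, which yields a real
  derivative E. Complex homogeneity of E is then tested on real parts of the functionals, since
  these already separate vectors.\<close>

lemma holomorphic_atI_cfunctional:
  fixes f :: "'a::complex_euclidean_space \<Rightarrow> 'b::complex_euclidean_space"
  assumes "\<And>b. b \<in> Basis \<Longrightarrow> holomorphic_at (\<lambda>x. cfunctional b (f x)) x"
  shows "holomorphic_at f x"
proof -
  define D where "D b = frechet_derivative (\<lambda>x. cfunctional b (f x)) (at x)" for b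
  have D: "((\<lambda>x. cfunctional b (f x)) has_derivative D b) (at x)" "clinear_map (D b)"
    if "b \<in> Basis" for b
    unfolding D_def
    using assms[OF that] holomorphic_at_has_derivative holomorphic_at_clinear by auto
  define E where "E v = (\<Sum>b\<in>Basis. Re (D b v) *\<^sub>R b)" for v
  have Eb: "E v \<bullet> b = Re (D b v)" if "b \<in> Basis" for v b
    using that by (simp add: E_def inner_sum_left inner_Basis if_distrib cong: if_cong)
  have E: "(f has_derivative E) (at x)"
  proof (subst has_derivative_componentwise_within, rule ballI)
    fix b :: 'b assume b: "b \<in> Basis"
    have "((\<lambda>x. Re (cfunctional b (f x))) has_derivative (\<lambda>v. Re (D b v))) (at x)"
      by (rule bounded_linear.has_derivative[OF bounded_linear_Re D(1)[OF b]])
    then show "((\<lambda>x. f x \<bullet> b) has_derivative (\<lambda>v. E v \<bullet> b)) (at x)"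
      by (simp add: Eb[OF b])
  qed
  \<comment> \<open>So far only the real parts agree; uniqueness of the derivative gives the whole
    complex value.\<close>
  have "cfunctional b (E v) = D b v" if "b \<in> Basis" for b v
  proof -
    have "((\<lambda>x. cfunctional b (f x)) has_derivative (\<lambda>v. cfunctional b (E v))) (at x)"
      using clinear_map_cfunctional[of b]
      by (intro bounded_linear.has_derivative[OF _ E])
        (simp add: clinear_map_def linear_conv_bounded_linear)
    then have "(\<lambda>v. cfunctional b (E v)) = D b"
      by (rule has_derivative_unique[OF _ D(1)[OF that]])
    then show ?thesis
      by (rule fun_cong)
  qed
  then have "cfunctional b (E (c *\<^sub>C v)) = cfunctional b (c *\<^sub>C E v)" if "b \<in> Basis" for b c v
    using that clinear_map_scaleC[OF D(2)[OF that]] clinear_map_scaleC[OF clinear_map_cfunctional[of b]]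
    by simp
  then have "Re (cfunctional b (E (c *\<^sub>C v))) = Re (cfunctional b (c *\<^sub>C E v))" if "b \<in> Basis" for b c v
    using that by simp
  then have "E (c *\<^sub>C v) = c *\<^sub>C E v" for c v
    unfolding Re_cfunctional by (rule euclidean_eqI)
  with E show ?thesis
    unfolding holomorphic_at_def by blast
qed

text \<open>Differentiation commutes with each \<open>cfunctional b\<close>, which reduces vector
  values to the scalar case.\<close>

lemma holomorphic_at_derivative_direction:
  fixes f :: "'a::complex_euclidean_space \<Rightarrow> 'b::complex_euclidean_space"
  assumes U: "open U" and hol: "\<And>x. x \<in> U \<Longrightarrow> holomorphic_at f x" and z0: "z0 \<in> U"
  shows "holomorphic_at (\<lambda>z. frechet_derivative f (at z) w) z0"
proof (rule holomorphic_atI_cfunctional)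
  fix b :: 'b
  have lin: "frechet_derivative (cfunctional b) (at y) = cfunctional b" for y
    by (intro frechet_derivative_eqI linear_imp_has_derivative)
      (use clinear_map_cfunctional[of b] in \<open>simp add: clinear_map_def\<close>)
  have comp: "holomorphic_at (\<lambda>x. cfunctional b (f x)) z"
    "frechet_derivative (\<lambda>x. cfunctional b (f x)) (at z) w = cfunctional b (frechet_derivative f (at z) w)"
    if "z \<in> U" for z
    using holomorphic_at_compose[OF hol[OF that]
        clinear_map_imp_holomorphic_at[OF clinear_map_cfunctional[of b]]]
    by (simp_all add: o_def lin)
  have "holomorphic_at (\<lambda>z. frechet_derivative (\<lambda>x. cfunctional b (f x)) (at z) w) z0"
    by (rule holomorphic_at_derivative_direction_complex[OF U comp(1) z0])
  moreover have "eventually (\<lambda>z. frechet_derivative (\<lambda>x. cfunctional b (f x)) (at z) w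
      = cfunctional b (frechet_derivative f (at z) w)) (nhds z0)"
    by (rule eventually_nhds_in_open[OF U z0, THEN eventually_mono]) (rule comp(2))
  ultimately show "holomorphic_at (\<lambda>z. cfunctional b (frechet_derivative f (at z) w)) z0"
    by (rule holomorphic_at_eventually_transfer)
qed

text \<open>Linearity in the direction w gives a finite expansion over \<open>Basis\<close>, to
  which the product rule applies. The coefficients \<open>w \<bullet> b\<close> are only real
  linear, so complex linearity of the total derivative is visible only after the sums have been
  reassembled.\<close>

theorem holomorphic_at_derivative:
  fixes f :: "'a::complex_euclidean_space \<Rightarrow> 'b::complex_euclidean_space"
  assumes U: "open U" and hol: "\<And>x. x \<in> U \<Longrightarrow> holomorphic_at f x" and z0: "z0 \<in> U"
  shows "holomorphic_at (\<lambda>(z, w). frechet_derivative f (at z) w) (z0, w0)"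
proof -
  define D where "D z = frechet_derivative f (at z)" for z
  define D2 where "D2 w = frechet_derivative (\<lambda>z. D z w) (at z0)" for w
  have lin: "clinear_map (D z)" if "z \<in> U" for z
    unfolding D_def using hol[OF that] by (rule holomorphic_at_clinear)
  have D2: "((\<lambda>z. D z w) has_derivative D2 w) (at z0)" "clinear_map (D2 w)" for w
  proof -
    have *: "holomorphic_at (\<lambda>z. D z w) z0"
      unfolding D_def by (rule holomorphic_at_derivative_direction[OF U hol z0])
    show "((\<lambda>z. D z w) has_derivative D2 w) (at z0)" "clinear_map (D2 w)"
      unfolding D2_def
      using holomorphic_at_has_derivative[OF *] holomorphic_at_clinear[OF *] .
  qed
  have exp: "D z w = (\<Sum>b\<in>Basis. (w \<bullet> b) *\<^sub>R D z b)" if "z \<in> U" for z w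
  proof -
    have "D z (\<Sum>b\<in>Basis. (w \<bullet> b) *\<^sub>R b) = (\<Sum>b\<in>Basis. (w \<bullet> b) *\<^sub>R D z b)"
      using lin[OF that] by (simp add: clinear_map_def linear_sum linear_scale)
    then show ?thesis
      by (simp add: euclidean_representation)
  qed
  have "((\<lambda>q. \<Sum>b\<in>Basis. (snd q \<bullet> b) *\<^sub>R D (fst q) b) has_derivative
      (\<lambda>h. \<Sum>b\<in>Basis. (w0 \<bullet> b) *\<^sub>R D2 b (fst h) + (snd h \<bullet> b) *\<^sub>R D z0 b)) (at (z0, w0))"
  proof (rule has_derivative_sum)
    fix b :: 'a
    have *: "((\<lambda>q. D (fst q) b) has_derivative (\<lambda>h. D2 b (fst h))) (at (z0, w0))"
    proof (rule has_derivative_compose[OF has_derivative_fst[OF has_derivative_ident]])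
      show "((\<lambda>z. D z b) has_derivative D2 b) (at (fst (z0, w0)))"
        using D2(1) by simp
    qed
    have "((\<lambda>q. snd q \<bullet> b) has_derivative (\<lambda>h. snd h \<bullet> b)) (at (z0, w0))"
      by (intro has_derivative_inner_left has_derivative_snd has_derivative_ident)
    from has_derivative_scaleR[OF this *] show "((\<lambda>q. (snd q \<bullet> b) *\<^sub>R D (fst q) b) has_derivative
      (\<lambda>h. (w0 \<bullet> b) *\<^sub>R D2 b (fst h) + (snd h \<bullet> b) *\<^sub>R D z0 b)) (at (z0, w0))"
      by simp
  qed
  \<comment> \<open>Linearity of \<open>D2\<close> in its direction index is obtained from
    uniqueness of the derivative of \<open>\<lambda>z. D z w0\<close>.\<close>
  moreover have "(\<Sum>b\<in>Basis. (w0 \<bullet> b) *\<^sub>R D2 b k) = D2 w0 k" for k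
  proof -
    have "((\<lambda>z. \<Sum>b\<in>Basis. (w0 \<bullet> b) *\<^sub>R D z b) has_derivative (\<lambda>k. \<Sum>b\<in>Basis. (w0 \<bullet> b) *\<^sub>R D2 b k)) (at z0)"
      by (intro has_derivative_sum has_derivative_scaleR_right D2)
    moreover have "eventually (\<lambda>z. (\<Sum>b\<in>Basis. (w0 \<bullet> b) *\<^sub>R D z b) = D z w0) (nhds z0)"
      by (rule eventually_nhds_in_open[OF U z0, THEN eventually_mono]) (rule exp[symmetric])
    ultimately have "((\<lambda>z. D z w0) has_derivative (\<lambda>k. \<Sum>b\<in>Basis. (w0 \<bullet> b) *\<^sub>R D2 b k)) (at z0)"
      by (rule has_derivative_eventually_transfer)
    then have "(\<lambda>k. \<Sum>b\<in>Basis. (w0 \<bullet> b) *\<^sub>R D2 b k) = D2 w0"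
      by (rule has_derivative_unique[OF _ D2(1)])
    then show ?thesis
      by (rule fun_cong)
  qed
  moreover have "(\<Sum>b\<in>Basis. (h \<bullet> b) *\<^sub>R D z0 b) = D z0 h" for h
    by (rule exp[OF z0, symmetric])
  ultimately have "((\<lambda>q. \<Sum>b\<in>Basis. (snd q \<bullet> b) *\<^sub>R D (fst q) b) has_derivative
      (\<lambda>h. D2 w0 (fst h) + D z0 (snd h))) (at (z0, w0))"
    by (simp add: sum.distrib)
  moreover have "eventually (\<lambda>q. (\<Sum>b\<in>Basis. (snd q \<bullet> b) *\<^sub>R D (fst q) b) = (case q of (z, w) \<Rightarrow> D z w))
      (nhds (z0, w0))"
    by (rule eventually_nhds_in_open[of "U \<times> UNIV", THEN eventually_mono])
      (auto simp: U z0 open_Times intro: exp[symmetric])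
  ultimately have "((\<lambda>(z, w). D z w) has_derivative (\<lambda>h. D2 w0 (fst h) + D z0 (snd h))) (at (z0, w0))"
    by (rule has_derivative_eventually_transfer)
  moreover have "clinear_map (\<lambda>h. D2 w0 (fst h) + D z0 (snd h))"
    using D2(2)[of w0] lin[OF z0]
    by (auto simp: clinear_map_def scaleC_prod_def scaleC_add_right linear_iff algebra_simps)
  ultimately show ?thesis
    unfolding D_def by (rule holomorphic_atI)
qed

section \<open>Calculus on complex manifolds\<close>

lemma atlas_chart:
  assumes "complex_atlas A" "c \<in> A"
  shows atlas_open: "open (fst c)"
    and atlas_open_image: "U \<subseteq> fst c \<Longrightarrow> open U \<Longrightarrow> open (snd c ` U)"
    and atlas_inj: "inj_on (snd c) (fst c)"
    and chart_inv_eq: "x \<in> fst c \<Longrightarrow> chart_inv c (snd c x) = x"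
    and chart_inv_in: "y \<in> snd c ` fst c \<Longrightarrow> chart_inv c y \<in> fst c"
    and chart_inv_right: "y \<in> snd c ` fst c \<Longrightarrow> snd c (chart_inv c y) = y"
    and chart_inv_continuous: "continuous_on (snd c ` fst c) (chart_inv c)"
    and chart_continuous: "continuous_on (fst c) (snd c)"
proof -
  have c: "open (fst c)" "open (snd c ` fst c)"
    and hom: "homeomorphism (fst c) (snd c ` fst c) (snd c) (chart_inv c)"
    using assms by (auto simp: complex_atlas_def)
  show "open (fst c)"
    by (rule c)
  show "open (snd c ` U)" if U: "U \<subseteq> fst c" "open U"
  proof -
    have "openin (top_of_set (fst c)) U"
      using U by (simp add: open_subset)
    then have "openin (top_of_set (snd c ` fst c)) (snd c ` U)"
      using homeomorphism_imp_open_map[OF hom] by blast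
    then show ?thesis
      using openin_open_eq[OF c(2)] by blast
  qed
  show "inj_on (snd c) (fst c)"
    by (rule inj_on_inverseI[of _ "chart_inv c"]) (rule homeomorphism_apply1[OF hom])
  show "x \<in> fst c \<Longrightarrow> chart_inv c (snd c x) = x"
    using hom by (rule homeomorphism_apply1)
  show "y \<in> snd c ` fst c \<Longrightarrow> chart_inv c y \<in> fst c"
    using homeomorphism_image2[OF hom] by blast
  show "y \<in> snd c ` fst c \<Longrightarrow> snd c (chart_inv c y) = y"
    using hom by (rule homeomorphism_apply2)
  show "continuous_on (snd c ` fst c) (chart_inv c)" "continuous_on (fst c) (snd c)"
    using hom by (auto simp: homeomorphism_def)
qed

lemma charts_atD:
  assumes "c \<in> charts_at A p"
  shows "c \<in> A" "p \<in> fst c" "p \<in> manifold_carrier A"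
  using assms by (auto simp: charts_at_def manifold_carrier_def)

lemma charts_atI: "c \<in> A \<Longrightarrow> p \<in> fst c \<Longrightarrow> c \<in> charts_at A p"
  by (simp add: charts_at_def)

lemma charts_at_nonempty: "p \<in> manifold_carrier A \<Longrightarrow> \<exists>c. c \<in> charts_at A p"
  by (auto simp: charts_at_def manifold_carrier_def)

lemma some_chart_in: "p \<in> manifold_carrier A \<Longrightarrow> some_chart A p \<in> charts_at A p"
  unfolding some_chart_def by (rule someI_ex) (rule charts_at_nonempty)

lemma open_manifold_carrier: "complex_atlas A \<Longrightarrow> open (manifold_carrier A)"
  by (auto simp: manifold_carrier_def intro: atlas_open)

text \<open>Near the coordinates of p the inverse chart is genuine and lands in any prescribed
  neighbourhood of p; local comparisons of coordinate representations start from this.\<close>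

lemma chart_eventually:
  assumes A: "complex_atlas A" and c: "c \<in> charts_at A p" and U: "open U" "p \<in> U"
  shows "eventually (\<lambda>y. y \<in> snd c ` fst c \<and> chart_inv c y \<in> fst c \<inter> U) (nhds (snd c p))"
proof -
  note [simp] = charts_atD[OF c]
  have "open (snd c ` (fst c \<inter> U))"
    using atlas_open_image[OF A, of c] atlas_open[OF A, of c] U by auto
  then show ?thesis
    by (rule eventually_nhds_in_open[THEN eventually_mono])
      (use U chart_inv_eq[OF A, of c] in auto)
qed

section \<open>Holomorphic maps and their coordinate Jacobians\<close>

lemma holomorphic_map_ident: "complex_atlas A \<Longrightarrow> holomorphic_map A A (\<lambda>x. x)"
  by (auto simp: holomorphic_map_def complex_atlas_def transition_def o_def)

lemma holomorphic_map_in: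
  "holomorphic_map A B F \<Longrightarrow> p \<in> manifold_carrier A \<Longrightarrow> F p \<in> manifold_carrier B"
  by (auto simp: holomorphic_map_def)

lemma holomorphic_map_at:
  "holomorphic_map A B F \<Longrightarrow> c \<in> charts_at A p \<Longrightarrow> d \<in> charts_at B (F p) \<Longrightarrow>
    holomorphic_at (snd d \<circ> F \<circ> chart_inv c) (snd c p)"
  by (auto simp: holomorphic_map_def charts_at_def)

lemma holomorphic_mapI:
  assumes "\<And>p. p \<in> manifold_carrier A \<Longrightarrow> F p \<in> manifold_carrier B"
    and "continuous_on (manifold_carrier A) F"
    and "\<And>p c d. c \<in> charts_at A p \<Longrightarrow> d \<in> charts_at B (F p) \<Longrightarrow>
      holomorphic_at (snd d \<circ> F \<circ> chart_inv c) (snd c p)"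
  shows "holomorphic_map A B F"
  using assms by (auto simp: holomorphic_map_def charts_at_def)

lemma holomorphic_map_continuous:
  "holomorphic_map A B F \<Longrightarrow> continuous_on (manifold_carrier A) F"
  by (simp add: holomorphic_map_def)

text \<open>The Jacobian of F in the charts c and d. For F the identity it is the Jacobian of the
  coordinate change, so chart independence and functoriality become instances of the same chain
  rule.\<close>

definition local_deriv where
  "local_deriv c d F p = frechet_derivative (snd d \<circ> F \<circ> chart_inv c) (at (snd c p))"

lemma local_deriv_clinear:
  "holomorphic_map A B F \<Longrightarrow> c \<in> charts_at A p \<Longrightarrow> d \<in> charts_at B (F p) \<Longrightarrow>
    clinear_map (local_deriv c d F p)"
  unfolding local_deriv_def by (rule holomorphic_at_clinear[OF holomorphic_map_at])

lemma local_rep_cong: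
  assumes A: "complex_atlas A" and c: "c \<in> charts_at A p"
    and FG: "\<And>x. x \<in> manifold_carrier A \<Longrightarrow> F x = G x"
  shows "eventually (\<lambda>y. (snd d \<circ> F \<circ> chart_inv c) y = (snd d \<circ> G \<circ> chart_inv c) y) (nhds (snd c p))"
  using chart_eventually[OF A c open_manifold_carrier[OF A]] charts_atD[OF c]
  by (auto elim!: eventually_mono simp: FG)

lemma local_deriv_cong:
  assumes "complex_atlas A" "c \<in> charts_at A p" "\<And>x. x \<in> manifold_carrier A \<Longrightarrow> F x = G x"
  shows "local_deriv c d F p = local_deriv c d G p"
  unfolding local_deriv_def using local_rep_cong[OF assms] by (rule frechet_derivative_eventually_cong)

lemma holomorphic_map_cong:
  assumes A: "complex_atlas A" and FG: "\<And>x. x \<in> manifold_carrier A \<Longrightarrow> F x = G x"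
    and F: "holomorphic_map A B F"
  shows "holomorphic_map A B G"
proof (rule holomorphic_mapI)
  show "continuous_on (manifold_carrier A) G"
    using holomorphic_map_continuous[OF F] by (rule continuous_on_eq) (rule FG)
  fix p c d assume c: "c \<in> charts_at A p" and d: "d \<in> charts_at B (G p)"
  have "d \<in> charts_at B (F p)"
    using d FG[OF charts_atD(3)[OF c]] by simp
  then have "holomorphic_at (snd d \<circ> F \<circ> chart_inv c) (snd c p)"
    by (rule holomorphic_map_at[OF F c])
  then show "holomorphic_at (snd d \<circ> G \<circ> chart_inv c) (snd c p)"
    by (rule holomorphic_at_eventually_transfer) (rule local_rep_cong[OF A c FG])
qed (use holomorphic_map_in[OF F] FG in auto)

text \<open>Continuity of F keeps F(x) inside the domain of d for x near p, and there the
  intermediate chart cancels.\<close>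

lemma local_rep_compose:
  assumes A: "complex_atlas A" and B: "complex_atlas B"
    and F: "continuous_on (manifold_carrier A) F"
    and c: "c \<in> charts_at A p" and d: "d \<in> charts_at B (F p)"
  shows "eventually (\<lambda>y. (snd e \<circ> G \<circ> chart_inv d \<circ> (snd d \<circ> F \<circ> chart_inv c)) y
      = (snd e \<circ> (\<lambda>x. G (F x)) \<circ> chart_inv c) y) (nhds (snd c p))"
proof -
  have "open (manifold_carrier A \<inter> F -` fst d)"
    using F open_manifold_carrier[OF A] atlas_open[OF B charts_atD(1)[OF d]]
    by (simp add: continuous_on_open_vimage Int_commute)
  then have "eventually (\<lambda>y. y \<in> snd c ` fst c \<and> chart_inv c y \<in> fst c \<inter> (manifold_carrier A \<inter> F -` fst d))
      (nhds (snd c p))"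
    using charts_atD[OF c] charts_atD[OF d] by (intro chart_eventually[OF A c]) auto
  then show ?thesis
    by eventually_elim (simp add: chart_inv_eq[OF B charts_atD(1)[OF d]])
qed

lemma
  assumes A: "complex_atlas A" and B: "complex_atlas B"
    and F: "holomorphic_map A B F" and G: "holomorphic_map B C G"
    and c: "c \<in> charts_at A p" and d: "d \<in> charts_at B (F p)" and e: "e \<in> charts_at C (G (F p))"
  shows local_deriv_compose:
      "local_deriv c e (\<lambda>x. G (F x)) p v = local_deriv d e G (F p) (local_deriv c d F p v)"
    and local_rep_compose_holomorphic: "holomorphic_at (snd e \<circ> (\<lambda>x. G (F x)) \<circ> chart_inv c) (snd c p)"
proof -
  have Fp: "(snd d \<circ> F \<circ> chart_inv c) (snd c p) = snd d (F p)"
    using c by (simp add: chart_inv_eq[OF A] charts_at_def)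
  have hol: "holomorphic_at (snd d \<circ> F \<circ> chart_inv c) (snd c p)"
    "holomorphic_at (snd e \<circ> G \<circ> chart_inv d) ((snd d \<circ> F \<circ> chart_inv c) (snd c p))"
    unfolding Fp by (intro holomorphic_map_at[OF F c d] holomorphic_map_at[OF G d e])+
  note ev = local_rep_compose[OF A B holomorphic_map_continuous[OF F] c d, of e G]
  show "holomorphic_at (snd e \<circ> (\<lambda>x. G (F x)) \<circ> chart_inv c) (snd c p)"
    using holomorphic_at_compose(1)[OF hol] ev by (rule holomorphic_at_eventually_transfer)
  show "local_deriv c e (\<lambda>x. G (F x)) p v = local_deriv d e G (F p) (local_deriv c d F p v)"
    unfolding local_deriv_def frechet_derivative_eventually_cong[OF ev, symmetric]
      holomorphic_at_compose(2)[OF hol] Fp ..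
qed

lemma holomorphic_map_compose:
  assumes A: "complex_atlas A" and B: "complex_atlas B"
    and F: "holomorphic_map A B F" and G: "holomorphic_map B C G"
  shows "holomorphic_map A C (\<lambda>x. G (F x))"
proof (rule holomorphic_mapI)
  show "continuous_on (manifold_carrier A) (\<lambda>x. G (F x))"
    using holomorphic_map_continuous[OF G] holomorphic_map_continuous[OF F]
    by (rule continuous_on_compose2) (auto dest: holomorphic_map_in[OF F])
  fix p c e assume c: "c \<in> charts_at A p" and e: "e \<in> charts_at C (G (F p))"
  obtain d where d: "d \<in> charts_at B (F p)"
    using charts_at_nonempty[OF holomorphic_map_in[OF F charts_atD(3)[OF c]]] by blast
  show "holomorphic_at (snd e \<circ> (\<lambda>x. G (F x)) \<circ> chart_inv c) (snd c p)"
    by (rule local_rep_compose_holomorphic[OF A B F G c d e])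
qed (intro holomorphic_map_in[OF G] holomorphic_map_in[OF F])

lemma holomorphic_map_const:
  "x \<in> manifold_carrier B \<Longrightarrow> holomorphic_map A B (\<lambda>_. x)"
  by (rule holomorphic_mapI) (auto simp: o_def intro: holomorphic_at_const)

lemma local_deriv_const: "local_deriv c d (\<lambda>_. x) p v = 0"
  by (simp add: local_deriv_def o_def frechet_derivative_eqI[OF has_derivative_const])

lemma local_deriv_ident:
  assumes A: "complex_atlas A" and c: "c \<in> charts_at A p"
  shows "local_deriv c c (\<lambda>x. x) p v = v"
proof -
  have ev: "eventually (\<lambda>y. (snd c \<circ> (\<lambda>x. x) \<circ> chart_inv c) y = y) (nhds (snd c p))"
    using chart_eventually[OF A c open_UNIV]
    by (auto elim!: eventually_mono simp: chart_inv_right[OF A charts_atD(1)[OF c]])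
  show ?thesis
    unfolding local_deriv_def frechet_derivative_eventually_cong[OF ev]
      frechet_derivative_eqI[OF has_derivative_ident] ..
qed

subsection \<open>Tangent vectors and tangent maps\<close>

lemma tangent_spaceI:
  assumes "\<And>c. c \<notin> charts_at A p \<Longrightarrow> v c = 0"
    and "\<And>c d. c \<in> charts_at A p \<Longrightarrow> d \<in> charts_at A p \<Longrightarrow> v d = local_deriv c d (\<lambda>x. x) p (v c)"
  shows "v \<in> tangent_space A p"
  unfolding tangent_space_def
proof (intro CollectI conjI allI ballI impI)
  fix c d assume "c \<in> charts_at A p" "d \<in> charts_at A p"
  from assms(2)[OF this] show "v d = frechet_derivative (transition c d) (at (snd c p)) (v c)"
    by (simp only: transition_def local_deriv_def o_def)
qed (rule assms(1))

lemma tangent_vec_outside: "v \<in> tangent_space A p \<Longrightarrow> c \<notin> charts_at A p \<Longrightarrow> v c = 0"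
  unfolding tangent_space_def by blast

lemma tangent_vec_chart:
  assumes "v \<in> tangent_space A p" "c \<in> charts_at A p" "d \<in> charts_at A p"
  shows "local_deriv c d (\<lambda>x. x) p (v c) = v d"
proof -
  have "v d = frechet_derivative (transition c d) (at (snd c p)) (v c)"
    using assms unfolding tangent_space_def by blast
  then show ?thesis
    by (simp only: transition_def local_deriv_def o_def)
qed

lemma coord_vec_eq:
  "coord_vec A c p w = (\<lambda>d. if d \<in> charts_at A p then local_deriv c d (\<lambda>x. x) p w else 0)"
  by (rule ext) (simp add: coord_vec_def transition_def local_deriv_def o_def)

lemma tangent_map_eq:
  "tangent_map A B F p v = (\<lambda>d. if d \<in> charts_at B (F p)
    then local_deriv (some_chart A p) d F p (v (some_chart A p)) else 0)"
  by (rule ext) (simp add: tangent_map_def local_deriv_def Let_def)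

lemma coord_vec_same: "complex_atlas A \<Longrightarrow> c \<in> charts_at A p \<Longrightarrow> coord_vec A c p w c = w"
  by (simp add: coord_vec_eq local_deriv_ident)

lemma coord_vec_in:
  assumes A: "complex_atlas A" and c: "c \<in> charts_at A p"
  shows "coord_vec A c p w \<in> tangent_space A p"
proof (rule tangent_spaceI)
  fix d e assume d: "d \<in> charts_at A p" and e: "e \<in> charts_at A p"
  show "coord_vec A c p w e = local_deriv d e (\<lambda>x. x) p (coord_vec A c p w d)"
    unfolding coord_vec_eq if_P[OF d] if_P[OF e]
    by (rule local_deriv_compose[OF A A holomorphic_map_ident[OF A] holomorphic_map_ident[OF A] c d e])
qed (simp add: coord_vec_eq)

lemma tangent_vec_eq_coord_vec:
  assumes v: "v \<in> tangent_space A p" and c: "c \<in> charts_at A p"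
  shows "coord_vec A c p (v c) = v"
proof
  fix d
  show "coord_vec A c p (v c) d = v d"
    using tangent_vec_chart[OF v c, of d] tangent_vec_outside[OF v, of d] by (simp add: coord_vec_eq)
qed

lemma tangent_vec_eqI:
  assumes v: "v \<in> tangent_space A p" and w: "w \<in> tangent_space A p"
    and c: "c \<in> charts_at A p" and eq: "v c = w c"
  shows "v = w"
proof -
  have "coord_vec A c p (v c) = coord_vec A c p (w c)"
    by (simp only: eq)
  then show ?thesis
    by (simp only: tangent_vec_eq_coord_vec[OF v c] tangent_vec_eq_coord_vec[OF w c])
qed

text \<open>\<open>tangent_map\<close> is computed in \<open>some_chart\<close>; the chain rule with
  the identity as first map shows that every other chart at p gives the same result.\<close>

lemma tangent_map_apply:
  assumes A: "complex_atlas A" and F: "holomorphic_map A B F" and v: "v \<in> tangent_space A p"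
    and c: "c \<in> charts_at A p" and d: "d \<in> charts_at B (F p)"
  shows "tangent_map A B F p v d = local_deriv c d F p (v c)"
proof -
  have s: "some_chart A p \<in> charts_at A p"
    using some_chart_in charts_atD(3)[OF c] .
  have "local_deriv (some_chart A p) c (\<lambda>x. x) p (v (some_chart A p)) = v c"
    by (rule tangent_vec_chart[OF v s c])
  then show ?thesis
    using local_deriv_compose[OF A A holomorphic_map_ident[OF A] F s c] d
    by (simp add: tangent_map_eq)
qed

lemma tangent_map_coord_vec:
  assumes A: "complex_atlas A" and B: "complex_atlas B" and F: "holomorphic_map A B F"
    and c: "c \<in> charts_at A p" and d: "d \<in> charts_at B (F p)"
  shows "tangent_map A B F p (coord_vec A c p w) = coord_vec B d (F p) (local_deriv c d F p w)"
proof
  fix e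
  show "tangent_map A B F p (coord_vec A c p w) e = coord_vec B d (F p) (local_deriv c d F p w) e"
  proof (cases "e \<in> charts_at B (F p)")
    case e: True
    then show ?thesis
      using tangent_map_apply[OF A F coord_vec_in[OF A c] c e]
        local_deriv_compose[OF A B F holomorphic_map_ident[OF B] c d e]
      by (simp add: coord_vec_same[OF A c]) (simp add: coord_vec_eq)
  qed (simp add: tangent_map_eq coord_vec_eq)
qed

lemma tangent_map_in:
  assumes A: "complex_atlas A" and B: "complex_atlas B" and F: "holomorphic_map A B F"
    and v: "v \<in> tangent_space A p" and p: "p \<in> manifold_carrier A"
  shows "tangent_map A B F p v \<in> tangent_space B (F p)"
proof -
  obtain c d where c: "c \<in> charts_at A p" and d: "d \<in> charts_at B (F p)"
    using charts_at_nonempty[OF p] charts_at_nonempty[OF holomorphic_map_in[OF F p]] by blast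
  have "tangent_map A B F p v = coord_vec B d (F p) (local_deriv c d F p (v c))"
    using tangent_map_coord_vec[OF A B F c d, of "v c"] by (simp add: tangent_vec_eq_coord_vec[OF v c])
  then show ?thesis
    by (simp add: coord_vec_in[OF B d])
qed

text \<open>Functoriality. Together with \<open>tangent_map_cong\<close> it reduces identities
  between differentials to identities between maps, without further reference to charts.\<close>

lemma tangent_map_compose:
  assumes A: "complex_atlas A" and B: "complex_atlas B"
    and F: "holomorphic_map A B F" and G: "holomorphic_map B C G"
    and v: "v \<in> tangent_space A p" and p: "p \<in> manifold_carrier A"
  shows "tangent_map B C G (F p) (tangent_map A B F p v) = tangent_map A C (\<lambda>x. G (F x)) p v"
proof
  fix e
  obtain c d where c: "c \<in> charts_at A p" and d: "d \<in> charts_at B (F p)"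
    using charts_at_nonempty[OF p] charts_at_nonempty[OF holomorphic_map_in[OF F p]] by blast
  show "tangent_map B C G (F p) (tangent_map A B F p v) e = tangent_map A C (\<lambda>x. G (F x)) p v e"
  proof (cases "e \<in> charts_at C (G (F p))")
    case e: True
    then show ?thesis
      using tangent_map_apply[OF B G tangent_map_in[OF A B F v p] d e]
        tangent_map_apply[OF A F v c d]
        tangent_map_apply[OF A holomorphic_map_compose[OF A B F G] v c e]
        local_deriv_compose[OF A B F G c d e]
      by simp
  qed (simp add: tangent_map_eq)
qed

text \<open>Group laws such as g (g^-1 x) = x hold only for x in the carrier. Agreement there is
  enough because the carrier is open, so the coordinate representations agree near the
  point.\<close>

lemma tangent_map_cong:
  assumes A: "complex_atlas A" and p: "p \<in> manifold_carrier A"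
    and FG: "\<And>x. x \<in> manifold_carrier A \<Longrightarrow> F x = G x"
  shows "tangent_map A B F p v = tangent_map A B G p v"
  by (simp add: tangent_map_eq FG[OF p] local_deriv_cong[OF A some_chart_in[OF p], of F G, OF FG]
      cong: if_cong)

lemma tangent_map_ident:
  assumes A: "complex_atlas A" and v: "v \<in> tangent_space A p"
  shows "tangent_map A A (\<lambda>x. x) p v = v"
proof
  fix d
  show "tangent_map A A (\<lambda>x. x) p v d = v d"
    using tangent_map_apply[OF A holomorphic_map_ident[OF A] v, of d d] tangent_vec_outside[OF v, of d]
    by (cases "d \<in> charts_at A p") (simp_all add: local_deriv_ident[OF A] tangent_map_eq)
qed

lemma tangent_map_const: "tangent_map A B (\<lambda>_. x) p v = 0"
  by (auto simp: tangent_map_eq local_deriv_const)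

lemma tangent_space_add:
  assumes A: "complex_atlas A" and u: "u \<in> tangent_space A p" and v: "v \<in> tangent_space A p"
  shows "u + v \<in> tangent_space A p"
  using tangent_vec_chart[OF u] tangent_vec_outside[OF u] tangent_vec_chart[OF v]
    tangent_vec_outside[OF v]
  by (intro tangent_spaceI) (simp_all add: clinear_map_add[OF local_deriv_clinear[OF holomorphic_map_ident[OF A]]])

lemma tangent_space_scale:
  assumes A: "complex_atlas A" and u: "u \<in> tangent_space A p"
  shows "scale_tvec a u \<in> tangent_space A p"
  using tangent_vec_chart[OF u] tangent_vec_outside[OF u]
  by (intro tangent_spaceI)
    (simp_all add: scale_tvec_def clinear_map_scaleC[OF local_deriv_clinear[OF holomorphic_map_ident[OF A]]])

lemma tangent_space_0:
  assumes A: "complex_atlas A"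
  shows "0 \<in> tangent_space A p"
  by (intro tangent_spaceI)
    (simp_all add: clinear_map_0[OF local_deriv_clinear[OF holomorphic_map_ident[OF A]]])

lemma scale_tvec_minus_one: "scale_tvec (-1) v = - v"
  by (auto simp: scale_tvec_def scaleC_minus_one fun_eq_iff)

lemma scale_tvec_zero [simp]: "scale_tvec a 0 = 0"
  by (auto simp: scale_tvec_def fun_eq_iff)

lemma tangent_space_diff:
  assumes A: "complex_atlas A" and u: "u \<in> tangent_space A p" and v: "v \<in> tangent_space A p"
  shows "u - v \<in> tangent_space A p"
  using tangent_space_add[OF A u tangent_space_scale[OF A v, of "-1"]]
  by (simp add: scale_tvec_minus_one)

lemma
  assumes F: "holomorphic_map A B F" and p: "p \<in> manifold_carrier A"
  shows tangent_map_add: "tangent_map A B F p (u + v) = tangent_map A B F p u + tangent_map A B F p v"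
    and tangent_map_scale: "tangent_map A B F p (scale_tvec a u) = scale_tvec a (tangent_map A B F p u)"
    and tangent_map_0: "tangent_map A B F p 0 = 0"
  using clinear_map_add[OF local_deriv_clinear[OF F some_chart_in[OF p]]]
    clinear_map_scaleC[OF local_deriv_clinear[OF F some_chart_in[OF p]]]
    clinear_map_0[OF local_deriv_clinear[OF F some_chart_in[OF p]]]
  by (auto simp: tangent_map_eq fun_eq_iff scale_tvec_def)

subsection \<open>Products\<close>

definition prod_chart :: "('a, 'e) chart \<Rightarrow> ('b, 'f) chart \<Rightarrow> ('a \<times> 'b, 'e \<times> 'f) chart"
  where "prod_chart c d = (fst c \<times> fst d, map_prod (snd c) (snd d))"

lemma fst_prod_chart: "fst (prod_chart c d) = fst c \<times> fst d"
  and snd_prod_chart: "snd (prod_chart c d) = (\<lambda>x. (snd c (fst x), snd d (snd x)))"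
  by (auto simp: prod_chart_def)

lemma prod_atlas_eq: "prod_atlas A B = (\<lambda>(c, d). prod_chart c d) ` (A \<times> B)"
  by (simp add: prod_atlas_def prod_chart_def)

lemma prod_chart_in: "c \<in> A \<Longrightarrow> d \<in> B \<Longrightarrow> prod_chart c d \<in> prod_atlas A B"
  by (auto simp: prod_atlas_eq)

lemma prod_atlasE:
  assumes "e \<in> prod_atlas A B"
  obtains c d where "c \<in> A" "d \<in> B" "e = prod_chart c d"
  using assms by (auto simp: prod_atlas_eq)

lemma manifold_carrier_prod [simp]:
  "manifold_carrier (prod_atlas A B) = manifold_carrier A \<times> manifold_carrier B"
  by (fastforce simp: manifold_carrier_def prod_atlas_def)

lemma prod_chart_at:
  "c \<in> charts_at A p \<Longrightarrow> d \<in> charts_at B q \<Longrightarrow> prod_chart c d \<in> charts_at (prod_atlas A B) (p, q)"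
  by (auto simp: charts_at_def fst_prod_chart prod_chart_in)

lemma charts_at_prodE:
  assumes "e \<in> charts_at (prod_atlas A B) x"
  obtains c d where "c \<in> charts_at A (fst x)" "d \<in> charts_at B (snd x)" "e = prod_chart c d"
  using assms by (auto simp: charts_at_def fst_prod_chart elim!: prod_atlasE)

lemma chart_inv_prod:
  assumes A: "complex_atlas A" and B: "complex_atlas B" and c: "c \<in> A" and d: "d \<in> B"
    and y: "y \<in> (snd c ` fst c) \<times> (snd d ` fst d)"
  shows "chart_inv (prod_chart c d) y = (chart_inv c (fst y), chart_inv d (snd y))"
proof -
  have inj: "inj_on (snd (prod_chart c d)) (fst (prod_chart c d))"
    using atlas_inj[OF A c] atlas_inj[OF B d]
    by (auto simp: inj_on_def fst_prod_chart snd_prod_chart)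
  have "snd (prod_chart c d) (chart_inv c (fst y), chart_inv d (snd y)) = y"
    using y by (auto simp: snd_prod_chart chart_inv_right[OF A c] chart_inv_right[OF B d])
  moreover have "(chart_inv c (fst y), chart_inv d (snd y)) \<in> fst (prod_chart c d)"
    using y by (auto simp: fst_prod_chart chart_inv_in[OF A c] chart_inv_in[OF B d])
  ultimately show ?thesis
    unfolding chart_inv_def[of "prod_chart c d"] using inv_into_f_f[OF inj] by metis
qed

lemma prod_chart_image: "snd (prod_chart c d) ` fst (prod_chart c d) = (snd c ` fst c) \<times> (snd d ` fst d)"
  by (force simp: fst_prod_chart snd_prod_chart)

lemma prod_chart_eventually:
  assumes A: "complex_atlas A" and B: "complex_atlas B"
    and c: "c \<in> charts_at A p" and d: "d \<in> charts_at B q"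
  shows "eventually (\<lambda>y. y \<in> (snd c ` fst c) \<times> (snd d ` fst d) \<and>
    chart_inv (prod_chart c d) y = (chart_inv c (fst y), chart_inv d (snd y)))
    (nhds (snd (prod_chart c d) (p, q)))"
proof -
  note cd = charts_atD[OF c] charts_atD[OF d]
  have "open ((snd c ` fst c) \<times> (snd d ` fst d))"
    using atlas_open_image[OF A cd(1) order_refl atlas_open[OF A cd(1)]]
      atlas_open_image[OF B cd(4) order_refl atlas_open[OF B cd(4)]] by (rule open_Times)
  then show ?thesis
    by (rule eventually_nhds_in_open[THEN eventually_mono])
      (use cd in \<open>auto simp: snd_prod_chart chart_inv_prod[OF A B cd(1,4)]\<close>)
qed

lemma complex_atlas_prod:
  assumes A: "complex_atlas A" and B: "complex_atlas B"
  shows "complex_atlas (prod_atlas A B)"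
  unfolding complex_atlas_def
proof (intro conjI ballI)
  fix e assume "e \<in> prod_atlas A B"
  then obtain c d where c: "c \<in> A" and d: "d \<in> B" and e: "e = prod_chart c d"
    by (rule prod_atlasE)
  show "open (fst e)"
    by (simp add: e fst_prod_chart open_Times atlas_open[OF A c] atlas_open[OF B d])
  show "open (snd e ` fst e)"
    by (simp add: e prod_chart_image open_Times atlas_open[OF A c] atlas_open[OF B d]
        atlas_open_image[OF A c] atlas_open_image[OF B d])
  have "continuous_on (snd e ` fst e) (\<lambda>y. (chart_inv c (fst y), chart_inv d (snd y)))"
    unfolding e prod_chart_image
    by (intro continuous_on_Pair continuous_on_compose2[OF chart_inv_continuous[OF A c]]
        continuous_on_compose2[OF chart_inv_continuous[OF B d]] continuous_on_fst continuous_on_snd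
        continuous_on_id) auto
  then have cont_inv: "continuous_on (snd e ` fst e) (chart_inv e)"
    by (rule continuous_on_eq) (auto simp: e prod_chart_image chart_inv_prod[OF A B c d])
  have cont: "continuous_on (fst e) (snd e)"
    unfolding e fst_prod_chart snd_prod_chart
    by (intro continuous_on_Pair continuous_on_compose2[OF chart_continuous[OF A c]]
        continuous_on_compose2[OF chart_continuous[OF B d]] continuous_on_fst continuous_on_snd
        continuous_on_id) auto
  have inv: "chart_inv e (snd e x) = x" if "x \<in> fst e" for x
    using that by (auto simp: e fst_prod_chart snd_prod_chart chart_inv_prod[OF A B c d]
        chart_inv_eq[OF A c] chart_inv_eq[OF B d])
  show "homeomorphism (fst e) (snd e ` fst e) (snd e) (chart_inv e)"
    using inv by (intro homeomorphismI cont cont_inv) auto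
next
  fix e e' x assume "e \<in> prod_atlas A B" "e' \<in> prod_atlas A B" "x \<in> snd e ` (fst e \<inter> fst e')"
  then obtain p q c d c' d' where c: "c \<in> charts_at A p" "d \<in> charts_at B q" and e: "e = prod_chart c d"
    and c': "c' \<in> charts_at A p" "d' \<in> charts_at B q" and e': "e' = prod_chart c' d'"
    and x: "x = snd e (p, q)"
    by (auto elim!: prod_atlasE simp: fst_prod_chart charts_at_def)
  have "holomorphic_at (\<lambda>y. (transition c c' (fst y), transition d d' (snd y))) x"
    using c c' A B unfolding complex_atlas_def charts_at_def
    by (intro holomorphic_at_Pair(1) holomorphic_at_compose2[OF holomorphic_at_fst]
        holomorphic_at_compose2[OF holomorphic_at_snd]) (auto simp: x e snd_prod_chart)
  then show "holomorphic_at (transition e e') x"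
    by (rule holomorphic_at_eventually_transfer)
      (use prod_chart_eventually[OF A B c] in \<open>auto elim!: eventually_mono simp: x e e' transition_def
        snd_prod_chart\<close>)
qed

lemma
  assumes A: "complex_atlas A" and B: "complex_atlas B"
  shows holomorphic_map_fst: "holomorphic_map (prod_atlas A B) A fst"
    and holomorphic_map_snd: "holomorphic_map (prod_atlas A B) B snd"
    and local_deriv_fst: "c \<in> charts_at A p \<Longrightarrow> d \<in> charts_at B q \<Longrightarrow>
      local_deriv (prod_chart c d) c fst (p, q) w = fst w"
    and local_deriv_snd: "c \<in> charts_at A p \<Longrightarrow> d \<in> charts_at B q \<Longrightarrow>
      local_deriv (prod_chart c d) d snd (p, q) w = snd w"
proof -
  have ev: "eventually (\<lambda>y. (transition c c' \<circ> fst) y = (snd c' \<circ> fst \<circ> chart_inv (prod_chart c d)) y)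
      (nhds (snd (prod_chart c d) (p, q)))"
    "eventually (\<lambda>y. (transition d d' \<circ> snd) y = (snd d' \<circ> snd \<circ> chart_inv (prod_chart c d)) y)
      (nhds (snd (prod_chart c d) (p, q)))"
    if "c \<in> charts_at A p" "d \<in> charts_at B q" for c d c' d' p q
    using prod_chart_eventually[OF A B that] by (auto elim!: eventually_mono simp: transition_def)
  have hol: "holomorphic_at fst (snd (prod_chart c d) (p, q))"
      "holomorphic_at snd (snd (prod_chart c d) (p, q))"
    and hol1: "c' \<in> charts_at A p \<Longrightarrow> holomorphic_at (transition c c') (fst (snd (prod_chart c d) (p, q)))"
    and hol2: "d' \<in> charts_at B q \<Longrightarrow> holomorphic_at (transition d d') (snd (snd (prod_chart c d) (p, q)))"
    if "c \<in> charts_at A p" "d \<in> charts_at B q" for c d c' d' p q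
    using that A B by (auto simp: complex_atlas_def charts_at_def snd_prod_chart
        intro: holomorphic_at_fst holomorphic_at_snd)
  show "holomorphic_map (prod_atlas A B) A fst"
  proof (rule holomorphic_mapI)
    fix x e c' assume "e \<in> charts_at (prod_atlas A B) x" and c': "c' \<in> charts_at A (fst x)"
    then obtain c d where c: "c \<in> charts_at A (fst x)" and d: "d \<in> charts_at B (snd x)"
      and e: "e = prod_chart c d"
      by (elim charts_at_prodE)
    show "holomorphic_at (snd c' \<circ> fst \<circ> chart_inv e) (snd e x)"
      using holomorphic_at_compose(1)[OF hol(1)[OF c d] hol1[OF c d c']] ev(1)[OF c d]
      unfolding e prod.collapse by (rule holomorphic_at_eventually_transfer)
  qed (auto intro: continuous_on_fst continuous_on_id)
  show "holomorphic_map (prod_atlas A B) B snd"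
  proof (rule holomorphic_mapI)
    fix x e d' assume "e \<in> charts_at (prod_atlas A B) x" and d': "d' \<in> charts_at B (snd x)"
    then obtain c d where c: "c \<in> charts_at A (fst x)" and d: "d \<in> charts_at B (snd x)"
      and e: "e = prod_chart c d"
      by (elim charts_at_prodE)
    show "holomorphic_at (snd d' \<circ> snd \<circ> chart_inv e) (snd e x)"
      using holomorphic_at_compose(1)[OF hol(2)[OF c d] hol2[OF c d d']] ev(2)[OF c d]
      unfolding e prod.collapse by (rule holomorphic_at_eventually_transfer)
  qed (auto intro: continuous_on_snd continuous_on_id)
  have D: "frechet_derivative fst (at z) = fst" "frechet_derivative snd (at z) = snd"
    for z :: "'b \<times> 'd"
    by (intro frechet_derivative_eqI derivative_intros has_derivative_fst has_derivative_snd
      has_derivative_ident)+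
  have I: "frechet_derivative (transition c c) (at (snd c p)) = local_deriv c c (\<lambda>x. x) p" for c p
    by (simp add: local_deriv_def transition_def o_def)
  assume c: "c \<in> charts_at A p" and d: "d \<in> charts_at B q"
  show "local_deriv (prod_chart c d) c fst (p, q) w = fst w"
    unfolding local_deriv_def frechet_derivative_eventually_cong[OF ev(1)[OF c d], symmetric]
      holomorphic_at_compose(2)[OF hol(1)[OF c d] hol1[OF c d c]]
    using local_deriv_ident[OF A c] by (simp add: snd_prod_chart I D)
  show "local_deriv (prod_chart c d) d snd (p, q) w = snd w"
    unfolding local_deriv_def frechet_derivative_eventually_cong[OF ev(2)[OF c d], symmetric]
      holomorphic_at_compose(2)[OF hol(2)[OF c d] hol2[OF c d d]]
    using local_deriv_ident[OF B d] by (simp add: snd_prod_chart I D)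
qed

lemma holomorphic_map_Pair:
  assumes F: "holomorphic_map A B F" and G: "holomorphic_map A C G"
  shows "holomorphic_map A (prod_atlas B C) (\<lambda>x. (F x, G x))"
proof (rule holomorphic_mapI)
  show "continuous_on (manifold_carrier A) (\<lambda>x. (F x, G x))"
    using F G by (auto intro: continuous_on_Pair holomorphic_map_continuous)
  fix p c e assume c: "c \<in> charts_at A p" and "e \<in> charts_at (prod_atlas B C) (F p, G p)"
  then obtain d d' where d: "d \<in> charts_at B (F p)" "d' \<in> charts_at C (G p)"
    and e: "e = prod_chart d d'"
    by (auto elim!: charts_at_prodE)
  have eq: "snd e \<circ> (\<lambda>x. (F x, G x)) \<circ> chart_inv c
      = (\<lambda>y. ((snd d \<circ> F \<circ> chart_inv c) y, (snd d' \<circ> G \<circ> chart_inv c) y))"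
    by (auto simp: e snd_prod_chart)
  show "holomorphic_at (snd e \<circ> (\<lambda>x. (F x, G x)) \<circ> chart_inv c) (snd c p)"
    unfolding eq by (rule holomorphic_at_Pair(1)[OF holomorphic_map_at[OF F c d(1)]
      holomorphic_map_at[OF G c d(2)]])
qed (use holomorphic_map_in[OF F] holomorphic_map_in[OF G] in auto)

text \<open>In a product chart the differentials of the two projections are \<open>fst\<close> and
  \<open>snd\<close> on coordinates, so they jointly recover the coordinate vector.\<close>

lemma prod_tangent_eqI:
  assumes A: "complex_atlas A" and B: "complex_atlas B"
    and v: "v \<in> tangent_space (prod_atlas A B) x" and w: "w \<in> tangent_space (prod_atlas A B) x"
    and x: "x \<in> manifold_carrier (prod_atlas A B)"
    and eq: "tangent_map (prod_atlas A B) A fst x v = tangent_map (prod_atlas A B) A fst x w"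
      "tangent_map (prod_atlas A B) B snd x v = tangent_map (prod_atlas A B) B snd x w"
  shows "v = w"
proof -
  obtain c d where cd: "c \<in> charts_at A (fst x)" "d \<in> charts_at B (snd x)"
    using x charts_at_nonempty by (metis manifold_carrier_prod mem_Times_iff)
  have e: "prod_chart c d \<in> charts_at (prod_atlas A B) x"
    using prod_chart_at[OF cd] by simp
  have "fst (u (prod_chart c d)) = tangent_map (prod_atlas A B) A fst x u c"
    "snd (u (prod_chart c d)) = tangent_map (prod_atlas A B) B snd x u d"
    if u: "u \<in> tangent_space (prod_atlas A B) x" for u
    using tangent_map_apply[OF complex_atlas_prod[OF A B] holomorphic_map_fst[OF A B] u e cd(1)]
      tangent_map_apply[OF complex_atlas_prod[OF A B] holomorphic_map_snd[OF A B] u e cd(2)]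
      local_deriv_fst[OF A B cd] local_deriv_snd[OF A B cd] by simp_all
  then show ?thesis
    using tangent_vec_eqI[OF v w e] v w eq by (simp add: prod_eq_iff)
qed

text \<open>The direct sum splitting of the tangent space of a product. It is verified on both
  projections: a projection after a slice inclusion is either the identity or constant.\<close>

lemma prod_tangent_decomp:
  assumes A: "complex_atlas A" and B: "complex_atlas B"
    and x: "p \<in> manifold_carrier A" "q \<in> manifold_carrier B"
    and v: "v \<in> tangent_space (prod_atlas A B) (p, q)"
  shows "v = tangent_map A (prod_atlas A B) (\<lambda>x. (x, q)) p (tangent_map (prod_atlas A B) A fst (p, q) v)
    + tangent_map B (prod_atlas A B) (\<lambda>y. (p, y)) q (tangent_map (prod_atlas A B) B snd (p, q) v)"
    (is "_ = tangent_map _ _ ?i _ ?a + tangent_map _ _ ?j _ ?b")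
proof (rule prod_tangent_eqI[OF A B v])
  note AB = complex_atlas_prod[OF A B]
  note fs = holomorphic_map_fst[OF A B] holomorphic_map_snd[OF A B]
  have pq: "(p, q) \<in> manifold_carrier (prod_atlas A B)"
    using x by simp
  then show "(p, q) \<in> manifold_carrier (prod_atlas A B)" .
  have i: "holomorphic_map A (prod_atlas A B) ?i"
    by (intro holomorphic_map_Pair holomorphic_map_ident A holomorphic_map_const x)
  have j: "holomorphic_map B (prod_atlas A B) ?j"
    by (intro holomorphic_map_Pair holomorphic_map_ident B holomorphic_map_const x)
  have a: "?a \<in> tangent_space A p" and b: "?b \<in> tangent_space B q"
    using tangent_map_in[OF AB A fs(1) v pq] tangent_map_in[OF AB B fs(2) v pq] by simp_all
  show "tangent_map A (prod_atlas A B) ?i p ?a + tangent_map B (prod_atlas A B) ?j q ?b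
      \<in> tangent_space (prod_atlas A B) (p, q)"
    by (intro tangent_space_add tangent_map_in AB A B i j a b x)
  note T = tangent_map_compose[OF A AB i fs(1) a x(1)] tangent_map_compose[OF B AB j fs(1) b x(2)]
    tangent_map_compose[OF A AB i fs(2) a x(1)] tangent_map_compose[OF B AB j fs(2) b x(2)]
  show "?a = tangent_map (prod_atlas A B) A fst (p, q)
      (tangent_map A (prod_atlas A B) ?i p ?a + tangent_map B (prod_atlas A B) ?j q ?b)"
    using T(1,2) by (simp add: tangent_map_add[OF fs(1) pq] tangent_map_const tangent_map_ident[OF A a])
  show "?b = tangent_map (prod_atlas A B) B snd (p, q)
      (tangent_map A (prod_atlas A B) ?i p ?a + tangent_map B (prod_atlas A B) ?j q ?b)"
    using T(3,4) by (simp add: tangent_map_add[OF fs(2) pq] tangent_map_const tangent_map_ident[OF B b])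
qed

subsection \<open>Open submanifolds\<close>

lemma complex_atlas_open_submanifold:
  assumes A: "complex_atlas A" and U: "\<And>c. c \<in> A \<Longrightarrow> open (fst c \<inter> U)"
  shows "complex_atlas (open_submanifold A U)"
proof -
  \<comment> \<open>Shrinking a chart domain changes \<open>inv_into\<close> as a function; on the
    image of the smaller domain the two inverses agree by injectivity.\<close>
  have inv: "chart_inv (fst c \<inter> U, snd c) y = chart_inv c y"
    if c: "c \<in> A" and y: "y \<in> snd c ` (fst c \<inter> U)" for c y
  proof -
    obtain x where x: "x \<in> fst c" "x \<in> U" "y = snd c x"
      using y by auto
    have "inj_on (snd c) (fst c \<inter> U)"
      using atlas_inj[OF A c] by (rule inj_on_subset) auto
    then have "inv_into (fst c \<inter> U) (snd c) y = x"
      using x by (simp add: inv_into_f_f)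
    then show ?thesis
      using chart_inv_eq[OF A c x(1)] x by (simp add: chart_inv_def)
  qed
  have "homeomorphism (fst c \<inter> U) (snd c ` (fst c \<inter> U)) (snd c) (chart_inv (fst c \<inter> U, snd c))"
    if c: "c \<in> A" for c
  proof (rule homeomorphismI)
    show "continuous_on (fst c \<inter> U) (snd c)"
      using chart_continuous[OF A c] by (rule continuous_on_subset) auto
    have "continuous_on (snd c ` (fst c \<inter> U)) (chart_inv c)"
      using chart_inv_continuous[OF A c] by (rule continuous_on_subset) auto
    then show "continuous_on (snd c ` (fst c \<inter> U)) (chart_inv (fst c \<inter> U, snd c))"
      by (rule continuous_on_eq) (simp add: inv[OF c])
  qed (auto simp: inv[OF c] chart_inv_eq[OF A c])
  moreover have "holomorphic_at (transition (fst c \<inter> U, snd c) (fst d \<inter> U, snd d)) x"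
    if c: "c \<in> A" and d: "d \<in> A" and x: "x \<in> snd c ` (fst c \<inter> U \<inter> (fst d \<inter> U))" for c d x
  proof (rule holomorphic_at_eventually_transfer)
    show "holomorphic_at (transition c d) x"
      using A c d x unfolding complex_atlas_def by blast
    have "open (snd c ` (fst c \<inter> U))"
      using atlas_open_image[OF A c] U[OF c] by simp
    then show "eventually (\<lambda>y. transition c d y = transition (fst c \<inter> U, snd c) (fst d \<inter> U, snd d) y) (nhds x)"
      by (rule eventually_nhds_in_open[THEN eventually_mono])
        (use x in \<open>auto simp: transition_def inv[OF c]\<close>)
  qed
  ultimately show ?thesis
    unfolding complex_atlas_def open_submanifold_def
    using U atlas_open_image[OF A] by auto
qed

subsection \<open>Parametrised derivatives\<close>

lemma local_deriv_Pair:
  assumes "holomorphic_map A B F" "holomorphic_map A C G"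
    and "c \<in> charts_at A p" "d \<in> charts_at B (F p)" "e \<in> charts_at C (G p)"
  shows "local_deriv c (prod_chart d e) (\<lambda>x. (F x, G x)) p v = (local_deriv c d F p v, local_deriv c e G p v)"
proof -
  have eq: "snd (prod_chart d e) \<circ> (\<lambda>x. (F x, G x)) \<circ> chart_inv c
      = (\<lambda>y. ((snd d \<circ> F \<circ> chart_inv c) y, (snd e \<circ> G \<circ> chart_inv c) y))"
    by (auto simp: snd_prod_chart)
  show ?thesis
    unfolding local_deriv_def eq
    by (rule holomorphic_at_Pair(2)[OF holomorphic_map_at[OF assms(1,3,4)]
      holomorphic_map_at[OF assms(2,3,5)]])
qed

text \<open>A partial derivative in the second variable is the full derivative of the coordinate
  representation in a direction (0, w), so its joint holomorphy in parameter, base point and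
  direction is \<open>holomorphic_at_derivative\<close>. It will be applied to translation and
  conjugation in K, with the group element as parameter.\<close>

lemma holomorphic_at_local_deriv_param:
  assumes A: "complex_atlas A" and B: "complex_atlas B" and C: "complex_atlas C"
    and m: "holomorphic_map (prod_atlas A B) C m"
    and c: "c \<in> charts_at A p" and d: "d \<in> charts_at B q" and e: "e \<in> charts_at C (m (p, q))"
  shows "holomorphic_at (\<lambda>((x, y), w). local_deriv d e (\<lambda>y. m (chart_inv c x, y)) (chart_inv d y) w)
    ((snd c p, snd d q), w0)"
proof -
  note AB = complex_atlas_prod[OF A B]
  define h where "h = prod_chart c d"
  have h: "h \<in> charts_at (prod_atlas A B) (p, q)"
    unfolding h_def by (rule prod_chart_at[OF c d])
  \<comment> \<open>The part of the product chart that m maps into the chart e; only there does the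
    coordinate representation of m have meaning.\<close>
  define W where "W = fst h \<inter> (manifold_carrier (prod_atlas A B) \<inter> m -` fst e)"
  have "open (manifold_carrier (prod_atlas A B) \<inter> m -` fst e)"
    using holomorphic_map_continuous[OF m] open_manifold_carrier[OF AB] atlas_open[OF C
      charts_atD(1)[OF e]]
    by (simp add: continuous_on_open_vimage Int_commute)
  then have openW: "open W"
    unfolding W_def by (rule open_Int[OF atlas_open[OF AB charts_atD(1)[OF h]]])
  have sub: "W \<subseteq> fst h" and pq: "(p, q) \<in> W"
    using charts_atD[OF h] charts_atD[OF e] by (auto simp: W_def)
  define M where "M = snd e \<circ> m \<circ> chart_inv h"
  have V: "open (snd h ` W)"
    by (rule atlas_open_image[OF AB charts_atD(1)[OF h] sub openW])
  have M: "holomorphic_at M z" if "z \<in> snd h ` W" for z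
  proof -
    from that obtain x where x: "x \<in> W" and z: "z = snd h x" ..
    show ?thesis
      unfolding M_def z
      by (rule holomorphic_map_at[OF m charts_atI[OF charts_atD(1)[OF h]]
        charts_atI[OF charts_atD(1)[OF e]]])
        (use x in \<open>auto simp: W_def\<close>)
  qed
  have z0: "(snd c p, snd d q) = snd h (p, q)"
    by (simp add: h_def snd_prod_chart)
  have "holomorphic_at (\<lambda>(z, w). frechet_derivative M (at z) w) ((snd c p, snd d q), (0, w0))"
    unfolding z0 by (rule holomorphic_at_derivative[OF V M]) (use pq in auto)
  moreover have "holomorphic_at (\<lambda>t :: ('b \<times> 'd) \<times> 'd. (fst t, (0, snd t))) ((snd c p, snd d q), w0)"
    by (intro holomorphic_at_Pair(1) holomorphic_at_fst holomorphic_at_snd holomorphic_at_const)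
  ultimately have hol: "holomorphic_at (\<lambda>t. frechet_derivative M (at (fst t)) (0, snd t)) ((snd c p, snd d q), w0)"
    using holomorphic_at_compose2[of "\<lambda>t. (fst t, (0, snd t))" "((snd c p, snd d q), w0)"
        "\<lambda>(z, w). frechet_derivative M (at z) w"] by simp
  have eq: "frechet_derivative M (at z) (0, w)
      = local_deriv d e (\<lambda>y. m (chart_inv c (fst z), y)) (chart_inv d (snd z)) w"
    if "z \<in> snd h ` W" for z w
  proof -
    from that obtain p' q' where x: "(p', q') \<in> W" and z: "z = snd h (p', q')" by auto
    have pq': "p' \<in> fst c" "q' \<in> fst d" "m (p', q') \<in> fst e"
      using x by (auto simp: W_def h_def fst_prod_chart)
    have c': "c \<in> charts_at A p'" and d': "d \<in> charts_at B q'" and e': "e \<in> charts_at C (m (p', q'))"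
      using pq' charts_atD(1)[OF c] charts_atD(1)[OF d] charts_atD(1)[OF e] by (auto intro: charts_atI)
    have inv: "chart_inv c (fst z) = p'" "chart_inv d (snd z) = q'"
      using chart_inv_eq[OF A charts_atD(1)[OF c] pq'(1)] chart_inv_eq[OF B charts_atD(1)[OF d] pq'(2)]
      by (simp_all add: z h_def snd_prod_chart)
    have const: "holomorphic_map B A (\<lambda>_. p')"
      by (rule holomorphic_map_const[OF charts_atD(3)[OF c']])
    note j = holomorphic_map_Pair[OF const holomorphic_map_ident[OF B]]
    \<comment> \<open>Chain rule along the slice inclusion, whose Jacobian is w \<mapsto> (0,
      w).\<close>
    have "local_deriv d e (\<lambda>y. m (p', y)) q' w = local_deriv h e m (p', q') (local_deriv d h (\<lambda>y. (p', y)) q' w)"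
      by (rule local_deriv_compose[OF B AB j m d' _ e']) (simp add: h_def prod_chart_at[OF c' d'])
    also have "local_deriv d h (\<lambda>y. (p', y)) q' w = (0, w)"
      unfolding h_def local_deriv_Pair[OF const holomorphic_map_ident[OF B] d' c' d']
      by (simp add: local_deriv_const local_deriv_ident[OF B d'])
    finally show ?thesis
      by (simp add: inv) (simp add: local_deriv_def M_def z)
  qed
  have "eventually (\<lambda>t. t \<in> snd h ` W \<times> UNIV) (nhds ((snd c p, snd d q), w0))"
    using V pq by (intro eventually_nhds_in_open open_Times open_UNIV) (auto simp: z0)
  then have ev: "eventually (\<lambda>t. frechet_derivative M (at (fst t)) (0, snd t)
      = (\<lambda>((x, y), w). local_deriv d e (\<lambda>y. m (chart_inv c x, y)) (chart_inv d y) w) t)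
      (nhds ((snd c p, snd d q), w0))"
  proof (rule eventually_mono)
    fix t assume "t \<in> snd h ` W \<times> (UNIV :: 'd set)"
    then have "fst t \<in> snd h ` W"
      by auto
    from eq[OF this, of "snd t"] show "frechet_derivative M (at (fst t)) (0, snd t)
        = (\<lambda>((x, y), w). local_deriv d e (\<lambda>y. m (chart_inv c x, y)) (chart_inv d y) w) t"
      by (simp only: split_beta)
  qed
  show ?thesis
    by (rule holomorphic_at_eventually_transfer[OF hol ev])
qed

section \<open>Translations and the adjoint action\<close>

locale current_setup =
  fixes K :: "('k::t2_space, 'e::complex_euclidean_space) lie_group"
    and S :: "('s::t2_space, complex) chart set"
  assumes lie_group: "complex_lie_group K" and atlas_S: "complex_atlas S"
begin

abbreviation "A \<equiv> atlas K"
abbreviation "P \<equiv> trivial_bundle K S"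
abbreviation "M \<equiv> manifold_carrier S"
abbreviation Kmult (infixl \<open>\<cdot>\<close> 70) where "x \<cdot> y \<equiv> x \<otimes>\<^bsub>K\<^esub> y"
abbreviation Kinv (\<open>\<iota>\<close>) where "\<iota> x \<equiv> inv\<^bsub>K\<^esub> x"
abbreviation Kone (\<open>\<e>\<close>) where "\<e> \<equiv> \<one>\<^bsub>K\<^esub>"

sublocale G: group K
  using lie_group by (simp add: complex_lie_group_def)

lemma atlas_K: "complex_atlas A" and carrier_eq: "manifold_carrier A = carrier K"
  using lie_group by (auto simp: complex_lie_group_def)

lemma P_eq: "P = prod_atlas A S"
  by (simp add: trivial_bundle_def)

lemma atlas_bundle: "complex_atlas P"
  unfolding P_eq by (rule complex_atlas_prod[OF atlas_K atlas_S])

lemma carrier_P [simp]: "manifold_carrier P = carrier K \<times> M"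
  by (simp add: P_eq carrier_eq)

lemma lie_algebra_eq: "lie_algebra K = tangent_space A \<e>"
  by (simp add: lie_algebra_def)

lemma holomorphic_mult:
  assumes B: "complex_atlas B" and F: "holomorphic_map B A F" and G: "holomorphic_map B A G"
  shows "holomorphic_map B A (\<lambda>x. F x \<cdot> G x)"
proof -
  have "holomorphic_map (prod_atlas A A) A (\<lambda>(x, y). x \<cdot> y)"
    using lie_group by (simp add: complex_lie_group_def)
  from holomorphic_map_compose[OF B complex_atlas_prod[OF atlas_K atlas_K] holomorphic_map_Pair[OF F G]
    this]
  show ?thesis by simp
qed

lemma holomorphic_inv:
  assumes B: "complex_atlas B" and F: "holomorphic_map B A F"
  shows "holomorphic_map B A (\<lambda>x. \<iota> (F x))"
proof -
  have "holomorphic_map A A (\<lambda>x. \<iota> x)"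
    using lie_group by (simp add: complex_lie_group_def)
  from holomorphic_map_compose[OF B atlas_K F this] show ?thesis .
qed

lemma holomorphic_const: "g \<in> carrier K \<Longrightarrow> holomorphic_map B A (\<lambda>_. g)"
  by (rule holomorphic_map_const) (simp add: carrier_eq)

lemmas holomorphic_id = holomorphic_map_ident[OF atlas_K]

lemma holomorphic_left: "g \<in> carrier K \<Longrightarrow> holomorphic_map A A (\<lambda>x. g \<cdot> x)"
  by (intro holomorphic_mult[OF atlas_K] holomorphic_const holomorphic_id)

lemma holomorphic_conj: "g \<in> carrier K \<Longrightarrow> holomorphic_map A A (\<lambda>x. g \<cdot> x \<cdot> \<iota> g)"
  by (intro holomorphic_mult[OF atlas_K] holomorphic_left holomorphic_const G.inv_closed)

lemma holomorphic_fst: "holomorphic_map P A fst" and holomorphic_snd: "holomorphic_map P S snd"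
  unfolding P_eq by (rule holomorphic_map_fst[OF atlas_K atlas_S], rule holomorphic_map_snd[OF atlas_K
    atlas_S])

lemma holomorphic_Pair:
  "holomorphic_map B A F \<Longrightarrow> holomorphic_map B S G \<Longrightarrow> holomorphic_map B P (\<lambda>x. (F x, G x))"
  unfolding P_eq by (rule holomorphic_map_Pair)

lemma holomorphic_slice: "g \<in> carrier K \<Longrightarrow> holomorphic_map S P (\<lambda>s. (g, s))"
  by (intro holomorphic_Pair holomorphic_const holomorphic_map_ident atlas_S)

lemma holomorphic_fibre: "s \<in> M \<Longrightarrow> holomorphic_map B A F \<Longrightarrow> holomorphic_map B P (\<lambda>x. (F x, s))"
  by (intro holomorphic_Pair holomorphic_map_const)

lemma holomorphic_right_act:
  assumes g: "g \<in> carrier K" shows "holomorphic_map P P (\<lambda>q. right_act K q g)"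
  unfolding right_act_def
  by (intro holomorphic_Pair holomorphic_mult[OF atlas_bundle] holomorphic_fst holomorphic_snd
    holomorphic_const g)

lemma Ad_in: "g \<in> carrier K \<Longrightarrow> X \<in> lie_algebra K \<Longrightarrow> Ad K g X \<in> lie_algebra K"
  unfolding Ad_def lie_algebra_eq
  using tangent_map_in[OF atlas_K atlas_K holomorphic_conj[of g], of X \<e>] by (simp add: carrier_eq)

lemma Ad_one: "X \<in> lie_algebra K \<Longrightarrow> Ad K \<e> X = X"
  unfolding Ad_def lie_algebra_eq
  using tangent_map_cong[OF atlas_K, of \<e> "\<lambda>x. \<e> \<cdot> x \<cdot> \<iota> \<e>"
    "\<lambda>x. x" A X] tangent_map_ident[OF atlas_K, of X \<e>]
  by (simp add: carrier_eq)

lemma left_translate_in: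
  assumes g: "g \<in> carrier K" and Y: "Y \<in> tangent_space A g"
  shows "tangent_map A A (\<lambda>x. \<iota> g \<cdot> x) g Y \<in> lie_algebra K"
  unfolding lie_algebra_eq
  using tangent_map_in[OF atlas_K atlas_K holomorphic_left[of "\<iota> g"] Y] g by (simp add: carrier_eq)

lemma Ad_mult:
  assumes g: "g \<in> carrier K" and h: "h \<in> carrier K" and X: "X \<in> lie_algebra K"
  shows "Ad K (g \<cdot> h) X = Ad K g (Ad K h X)"
proof -
  have "Ad K g (Ad K h X) = tangent_map A A (\<lambda>x. g \<cdot> (h \<cdot> x \<cdot> \<iota> h) \<cdot> \<iota> g) \<e> X"
    unfolding Ad_def
    using tangent_map_compose[OF atlas_K atlas_K holomorphic_conj[OF h] holomorphic_conj[OF g], of X \<e>]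
      X h
    by (simp add: lie_algebra_eq carrier_eq)
  also have "\<dots> = Ad K (g \<cdot> h) X"
    unfolding Ad_def
    by (rule tangent_map_cong[OF atlas_K]) (simp_all add: g h carrier_eq G.m_assoc G.inv_mult_group)
  finally show ?thesis by simp
qed

lemma
  assumes g: "g \<in> carrier K"
  shows Ad_add: "Ad K g (X + Y) = Ad K g X + Ad K g Y"
    and Ad_scale: "Ad K g (scale_tvec a X) = scale_tvec a (Ad K g X)"
    and Ad_0: "Ad K g 0 = 0"
  unfolding Ad_def
  by (rule tangent_map_add[OF holomorphic_conj[OF g]] tangent_map_scale[OF holomorphic_conj[OF g]]
      tangent_map_0[OF holomorphic_conj[OF g]], simp add: carrier_eq)+

text \<open>Right equivariance of the Maurer-Cartan form, obtained by differentiating (gh)^-1 (x h)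
  = h^-1 (g^-1 x) h at x = g.\<close>

lemma Ad_left_translate:
  assumes g: "g \<in> carrier K" and h: "h \<in> carrier K" and Y: "Y \<in> tangent_space A g"
  shows "tangent_map A A (\<lambda>x. \<iota> (g \<cdot> h) \<cdot> x) (g \<cdot> h) (tangent_map A A (\<lambda>x. x \<cdot> h) g Y)
    = Ad K (\<iota> h) (tangent_map A A (\<lambda>x. \<iota> g \<cdot> x) g Y)"
proof -
  have R: "holomorphic_map A A (\<lambda>x. x \<cdot> h)"
    by (intro holomorphic_mult[OF atlas_K] holomorphic_const holomorphic_id h)
  have gc: "g \<in> manifold_carrier A"
    by (simp add: carrier_eq g)
  have "tangent_map A A (\<lambda>x. \<iota> (g \<cdot> h) \<cdot> x) (g \<cdot> h) (tangent_map A A (\<lambda>x. x \<cdot> h) g Y)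
      = tangent_map A A (\<lambda>x. \<iota> (g \<cdot> h) \<cdot> (x \<cdot> h)) g Y"
    by (rule tangent_map_compose[OF atlas_K atlas_K R holomorphic_left Y gc]) (simp add: g h)
  also have "\<dots> = tangent_map A A (\<lambda>x. \<iota> h \<cdot> (\<iota> g \<cdot> x) \<cdot> \<iota> (\<iota> h)) g Y"
    by (rule tangent_map_cong[OF atlas_K gc]) (simp add: g h carrier_eq G.m_assoc G.inv_mult_group)
  also have "\<dots> = tangent_map A A (\<lambda>x. \<iota> h \<cdot> x \<cdot> \<iota> (\<iota> h)) (\<iota> g \<cdot> g) (tangent_map A A (\<lambda>x. \<iota> g \<cdot> x) g Y)"
    by (rule tangent_map_compose[OF atlas_K atlas_K holomorphic_left holomorphic_conj Y gc, symmetric])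
      (simp_all add: g h)
  finally show ?thesis
    using g by (simp add: Ad_def)
qed

section \<open>Connection forms\<close>

text \<open>Everything a connection form satisfies except holomorphy and complex homogeneity. These
  properties already determine the form from its restriction to the canonical section.\<close>

definition equivariant_form :: "('k \<times> 's, 'e \<times> complex, 'k, 'e) lie_form \<Rightarrow> bool"
  where "equivariant_form \<omega> \<longleftrightarrow>
    (\<forall>p v. \<not> (p \<in> manifold_carrier P \<and> v \<in> tangent_space P p) \<longrightarrow> \<omega> p v = 0) \<and>
    (\<forall>p\<in>manifold_carrier P. \<forall>u\<in>tangent_space P p. \<forall>v\<in>tangent_space P p.
       \<omega> p u \<in> lie_algebra K \<and> \<omega> p (u + v) = \<omega> p u + \<omega> p v) \<and>
    (\<forall>p\<in>manifold_carrier P. \<forall>X\<in>lie_algebra K. \<omega> p (fundamental_vec K S p X) = X) \<and>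
    (\<forall>g\<in>carrier K. \<forall>p\<in>manifold_carrier P. \<forall>v\<in>tangent_space P p.
       \<omega> (right_act K p g) (tangent_map P P (\<lambda>q. right_act K q g) p v) = Ad K (\<iota> g) (\<omega> p v))"

lemma hol_formsD:
  assumes "\<xi> \<in> hol_forms K B"
  shows "\<not> (p \<in> manifold_carrier B \<and> v \<in> tangent_space B p) \<Longrightarrow> \<xi> p v = 0"
    and "p \<in> manifold_carrier B \<Longrightarrow> u \<in> tangent_space B p \<Longrightarrow> \<xi> p u \<in> lie_algebra K"
    and "p \<in> manifold_carrier B \<Longrightarrow> u \<in> tangent_space B p \<Longrightarrow> v \<in> tangent_space B p \<Longrightarrow>
      \<xi> p (u + v) = \<xi> p u + \<xi> p v"
    and "p \<in> manifold_carrier B \<Longrightarrow> u \<in> tangent_space B p \<Longrightarrow> \<xi> p (scale_tvec a u) = scale_tvec a (\<xi> p u)"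
    and "c \<in> B \<Longrightarrow> d \<in> charts_at A \<e> \<Longrightarrow> x \<in> snd c ` fst c \<Longrightarrow>
      holomorphic_at (\<lambda>z. \<xi> (chart_inv c z) (coord_vec B c (chart_inv c z) w) d) x"
  using assms unfolding hol_forms_def by blast+

lemma hol_formsI:
  assumes "\<And>p v. \<not> (p \<in> manifold_carrier B \<and> v \<in> tangent_space B p) \<Longrightarrow> \<xi> p v = 0"
    and "\<And>p u. p \<in> manifold_carrier B \<Longrightarrow> u \<in> tangent_space B p \<Longrightarrow> \<xi> p u \<in> lie_algebra K"
    and "\<And>p u v. p \<in> manifold_carrier B \<Longrightarrow> u \<in> tangent_space B p \<Longrightarrow> v \<in> tangent_space B p \<Longrightarrow>
      \<xi> p (u + v) = \<xi> p u + \<xi> p v"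
    and "\<And>p u a. p \<in> manifold_carrier B \<Longrightarrow> u \<in> tangent_space B p \<Longrightarrow>
      \<xi> p (scale_tvec a u) = scale_tvec a (\<xi> p u)"
    and "\<And>c d x w. c \<in> B \<Longrightarrow> d \<in> charts_at A \<e> \<Longrightarrow> x \<in> snd c ` fst c \<Longrightarrow>
      holomorphic_at (\<lambda>z. \<xi> (chart_inv c z) (coord_vec B c (chart_inv c z) w) d) x"
  shows "\<xi> \<in> hol_forms K B"
  unfolding hol_forms_def using assms by (intro CollectI conjI allI ballI impI)

lemma equivariant_formD:
  assumes "equivariant_form \<omega>"
  shows "\<not> (p \<in> manifold_carrier P \<and> v \<in> tangent_space P p) \<Longrightarrow> \<omega> p v = 0"
    and "p \<in> manifold_carrier P \<Longrightarrow> u \<in> tangent_space P p \<Longrightarrow> \<omega> p u \<in> lie_algebra K"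
    and "p \<in> manifold_carrier P \<Longrightarrow> u \<in> tangent_space P p \<Longrightarrow> v \<in> tangent_space P p \<Longrightarrow>
      \<omega> p (u + v) = \<omega> p u + \<omega> p v"
    and "p \<in> manifold_carrier P \<Longrightarrow> X \<in> lie_algebra K \<Longrightarrow> \<omega> p (fundamental_vec K S p X) = X"
    and "g \<in> carrier K \<Longrightarrow> p \<in> manifold_carrier P \<Longrightarrow> v \<in> tangent_space P p \<Longrightarrow>
       \<omega> (right_act K p g) (tangent_map P P (\<lambda>q. right_act K q g) p v) = Ad K (\<iota> g) (\<omega> p v)"
  using assms unfolding equivariant_form_def by blast+

lemma connections_iff:
  "\<omega> \<in> connections K S \<longleftrightarrow> \<omega> \<in> hol_forms K P \<and> equivariant_form \<omega>"
  unfolding connections_def equivariant_form_def hol_forms_def by blast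

section \<open>Determination of a connection form by its restriction\<close>

lemma fundamental_vec_eq:
  "fundamental_vec K S (g, s) X = tangent_map A P (\<lambda>x. (g \<cdot> x, s)) \<e> X"
  by (simp add: fundamental_vec_def right_act_def[abs_def])

lemma fundamental_vec_in:
  assumes g: "g \<in> carrier K" and s: "s \<in> M" and X: "X \<in> lie_algebra K"
  shows "fundamental_vec K S (g, s) X \<in> tangent_space P (g, s)"
  using tangent_map_in[OF atlas_K atlas_bundle holomorphic_fibre[OF s holomorphic_left[OF g]], of X \<e>] X
    g
  by (simp add: fundamental_vec_eq lie_algebra_eq carrier_eq)

text \<open>Every vertical vector Y at g is fundamental, belonging to the Lie algebra element g^-1
  Y. Hence reproduction of fundamental vectors fixes a connection form on all vertical
  vectors.\<close>

lemma fundamental_vec_left_translate: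
  assumes g: "g \<in> carrier K" and s: "s \<in> M" and Y: "Y \<in> tangent_space A g"
  shows "fundamental_vec K S (g, s) (tangent_map A A (\<lambda>x. \<iota> g \<cdot> x) g Y)
    = tangent_map A P (\<lambda>x. (x, s)) g Y"
proof -
  have gc: "g \<in> manifold_carrier A"
    by (simp add: carrier_eq g)
  have "fundamental_vec K S (g, s) (tangent_map A A (\<lambda>x. \<iota> g \<cdot> x) g Y)
      = tangent_map A P (\<lambda>x. (g \<cdot> x, s)) (\<iota> g \<cdot> g) (tangent_map A A (\<lambda>x. \<iota> g \<cdot> x) g Y)"
    using g by (simp add: fundamental_vec_eq)
  also have "\<dots> = tangent_map A P (\<lambda>x. (g \<cdot> (\<iota> g \<cdot> x), s)) g Y"
    by (rule tangent_map_compose[OF atlas_K atlas_K holomorphic_left holomorphic_fibre[OF s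
      holomorphic_left] Y gc])
      (simp_all add: g)
  also have "\<dots> = tangent_map A P (\<lambda>x. (x, s)) g Y"
    by (rule tangent_map_cong[OF atlas_K gc]) (simp add: g carrier_eq G.m_assoc[symmetric])
  finally show ?thesis .
qed

lemma tangent_projections:
  assumes "g \<in> carrier K" "s \<in> M" "v \<in> tangent_space P (g, s)"
  shows "tangent_map P A fst (g, s) v \<in> tangent_space A g"
    and "tangent_map P S snd (g, s) v \<in> tangent_space S s"
  using tangent_map_in[OF atlas_bundle atlas_K holomorphic_fst assms(3)] tangent_map_in[OF atlas_bundle
    atlas_S holomorphic_snd assms(3)] assms
  by simp_all

lemma base_form_eq:
  assumes "s \<in> M" "u \<in> tangent_space S s"
  shows "base_form K S \<omega> s u = \<omega> (\<e>, s) (tangent_map S P (\<lambda>s. (\<e>, s)) s u)"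
  using assms by (simp add: base_form_def pullback_form_def)

lemma base_form_outside: "\<not> (s \<in> M \<and> u \<in> tangent_space S s) \<Longrightarrow> base_form K S \<omega> s u = 0"
  by (auto simp: base_form_def pullback_form_def)

lemma slice_in:
  assumes "s \<in> M" "u \<in> tangent_space S s" "g \<in> carrier K"
  shows "tangent_map S P (\<lambda>s. (g, s)) s u \<in> tangent_space P (g, s)"
  using tangent_map_in[OF atlas_S atlas_bundle holomorphic_slice[OF assms(3)] assms(2,1)] .

text \<open>A tangent vector splits into a fundamental vector and a right translate of a vector tangent
  to the canonical section; this is the origin of the two summands in the coadjoint action.\<close>

lemma equivariant_form_decomp:
  assumes \<omega>: "equivariant_form \<omega>" and g: "g \<in> carrier K" and s: "s \<in> M"
    and v: "v \<in> tangent_space P (g, s)"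
  shows "\<omega> (g, s) v = tangent_map A A (\<lambda>x. \<iota> g \<cdot> x) g (tangent_map P A fst (g, s) v)
    + Ad K (\<iota> g) (base_form K S \<omega> s (tangent_map P S snd (g, s) v))"
proof -
  note D = equivariant_formD[OF \<omega>]
  define Y u where "Y = tangent_map P A fst (g, s) v" and "u = tangent_map P S snd (g, s) v"
  have Y: "Y \<in> tangent_space A g" and u: "u \<in> tangent_space S s"
    unfolding Y_def u_def using tangent_projections[OF g s v] by simp_all
  have gc: "g \<in> manifold_carrier A" and gs: "(g, s) \<in> manifold_carrier P"
    and es: "(\<e>, s) \<in> manifold_carrier P"
    using g s by (simp_all add: carrier_eq)
  have split: "v = tangent_map A P (\<lambda>x. (x, s)) g Y + tangent_map S P (\<lambda>y. (g, y)) s u"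
    unfolding Y_def u_def using prod_tangent_decomp[OF atlas_K atlas_S gc s] v unfolding P_eq by blast
  have Y': "tangent_map A P (\<lambda>x. (x, s)) g Y \<in> tangent_space P (g, s)"
    using tangent_map_in[OF atlas_K atlas_bundle holomorphic_fibre[OF s holomorphic_id] Y gc] .
  have "\<omega> (g, s) (tangent_map A P (\<lambda>x. (x, s)) g Y) = tangent_map A A (\<lambda>x. \<iota> g \<cdot> x) g Y"
    unfolding fundamental_vec_left_translate[OF g s Y, symmetric]
    by (rule D(4)[OF gs left_translate_in[OF g Y]])
  moreover have "\<omega> (g, s) (tangent_map S P (\<lambda>y. (g, y)) s u) = Ad K (\<iota> g) (base_form K S \<omega> s u)"
  proof -
    have "tangent_map P P (\<lambda>q. right_act K q g) (\<e>, s) (tangent_map S P (\<lambda>s. (\<e>, s)) s u)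
        = tangent_map S P (\<lambda>y. right_act K (\<e>, y) g) s u"
      by (rule tangent_map_compose[OF atlas_S atlas_bundle holomorphic_slice holomorphic_right_act[OF g]
        u s]) simp
    also have "\<dots> = tangent_map S P (\<lambda>y. (g, y)) s u"
      using g by (simp add: right_act_def)
    finally have "tangent_map S P (\<lambda>y. (g, y)) s u
        = tangent_map P P (\<lambda>q. right_act K q g) (\<e>, s) (tangent_map S P (\<lambda>s. (\<e>, s)) s u)" by simp
    moreover have "(g, s) = right_act K (\<e>, s) g"
      using g by (simp add: right_act_def)
    ultimately show ?thesis
      using D(5)[OF g es slice_in[OF s u G.one_closed]] by (simp add: base_form_eq[OF s u])
  qed
  ultimately show ?thesis
    using D(3)[OF gs Y' slice_in[OF s u g]] split unfolding Y_def[symmetric] u_def[symmetric] by simp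
qed

text \<open>The decomposition leaves only the base form free; off the bundle and off its tangent
  spaces both forms vanish by normalisation.\<close>

lemma equivariant_form_eqI:
  assumes \<omega>: "equivariant_form \<omega>" and \<omega>': "equivariant_form \<omega>'"
    and eq: "base_form K S \<omega> = base_form K S \<omega>'"
  shows "\<omega> = \<omega>'"
proof (intro ext)
  fix p v c
  show "\<omega> p v c = \<omega>' p v c"
  proof (cases "p \<in> manifold_carrier P \<and> v \<in> tangent_space P p")
    case True
    obtain g s where "p = (g, s)" "g \<in> carrier K" "s \<in> M"
      using True by auto
    then show ?thesis
      using True equivariant_form_decomp[OF \<omega>, of g s v] equivariant_form_decomp[OF \<omega>', of g s v] eq
      by simp
  next
    case False
    then show ?thesis
      using equivariant_formD(1)[OF \<omega>] equivariant_formD(1)[OF \<omega>'] by metis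
  qed
qed

text \<open>In charts, restricting to the section freezes the K-coordinate at the identity and
  allows only directions (0, w). Holomorphy is thus that of the given form composed with z \<mapsto>
  (\<open>snd e \<e>\<close>, z).\<close>

lemma base_form_in_hol_forms:
  assumes \<omega>: "\<omega> \<in> connections K S"
  shows "base_form K S \<omega> \<in> hol_forms K S"
proof -
  have hol: "\<omega> \<in> hol_forms K P" and eqv: "equivariant_form \<omega>"
    using \<omega> by (auto simp: connections_iff)
  note slice = holomorphic_slice[OF G.one_closed]
  have lin: "base_form K S \<omega> s u \<in> lie_algebra K"
    "base_form K S \<omega> s (u + v) = base_form K S \<omega> s u + base_form K S \<omega> s v"
    "base_form K S \<omega> s (scale_tvec a u) = scale_tvec a (base_form K S \<omega> s u)"
    if s: "s \<in> M" and u: "u \<in> tangent_space S s" and v: "v \<in> tangent_space S s" for s u v a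
  proof -
    have es: "(\<e>, s) \<in> manifold_carrier P"
      using s by simp
    note T = slice_in[OF s _ G.one_closed]
    show "base_form K S \<omega> s u \<in> lie_algebra K"
      unfolding base_form_eq[OF s u] by (rule equivariant_formD(2)[OF eqv es T[OF u]])
    show "base_form K S \<omega> s (u + v) = base_form K S \<omega> s u + base_form K S \<omega> s v"
      unfolding base_form_eq[OF s u] base_form_eq[OF s v] base_form_eq[OF s tangent_space_add[OF atlas_S
        u v]]
        tangent_map_add[OF slice s]
      by (rule equivariant_formD(3)[OF eqv es T[OF u] T[OF v]])
    show "base_form K S \<omega> s (scale_tvec a u) = scale_tvec a (base_form K S \<omega> s u)"
      unfolding base_form_eq[OF s u] base_form_eq[OF s tangent_space_scale[OF atlas_S u]]
        tangent_map_scale[OF slice s]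
      by (rule hol_formsD(4)[OF hol es T[OF u]])
  qed
  have hol': "holomorphic_at (\<lambda>z. base_form K S \<omega> (chart_inv c z) (coord_vec S c (chart_inv c z) w) e) x"
    if c: "c \<in> S" and e: "e \<in> charts_at A \<e>" and x: "x \<in> snd c ` fst c" for c w e x
  proof -
    \<comment> \<open>The chart e has two roles: it reads off an entry of the Lie algebra value, and
      as a chart around the identity it also provides the K-coordinate.\<close>
    define h where "h = prod_chart e c"
    have h: "h \<in> P"
      unfolding h_def P_eq by (rule prod_chart_in[OF charts_atD(1)[OF e] c])
    have img: "(snd e \<e>, z) \<in> snd h ` fst h" if "z \<in> snd c ` fst c" for z
      unfolding h_def prod_chart_image using charts_atD(2)[OF e] that by auto
    have "holomorphic_at (\<lambda>y. \<omega> (chart_inv h y) (coord_vec P h (chart_inv h y) (0, w)) e) (snd e \<e>, x)"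
      by (rule hol_formsD(5)[OF hol h e img[OF x]])
    from holomorphic_at_compose2[OF holomorphic_at_Pair(1)[OF holomorphic_at_const holomorphic_at_ident]
      this]
    have "holomorphic_at (\<lambda>z. \<omega> (chart_inv h (snd e \<e>, z)) (coord_vec P h (chart_inv h (snd e \<e>, z)) (0, w)) e) x" .
    moreover have "\<omega> (chart_inv h (snd e \<e>, z)) (coord_vec P h (chart_inv h (snd e \<e>, z)) (0, w))
        = base_form K S \<omega> (chart_inv c z) (coord_vec S c (chart_inv c z) w)"
      if z: "z \<in> snd c ` fst c" for z
    proof -
      define s where "s = chart_inv c z"
      have s: "s \<in> fst c" and cs: "c \<in> charts_at S s"
        unfolding s_def using chart_inv_in[OF atlas_S c z] c by (auto intro: charts_atI)
      have sM: "s \<in> M"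
        by (rule charts_atD(3)[OF cs])
      have inv: "chart_inv h (snd e \<e>, z) = (\<e>, s)"
        unfolding h_def s_def using charts_atD(2)[OF e] z
        by (subst chart_inv_prod[OF atlas_K atlas_S charts_atD(1)[OF e] c])
          (auto simp: chart_inv_eq[OF atlas_K charts_atD(1)[OF e]])
      have hs: "h \<in> charts_at P (\<e>, s)"
        unfolding h_def P_eq by (rule prod_chart_at[OF e cs])
      have "local_deriv c h (\<lambda>s. (\<e>, s)) s w = (0, w)"
        unfolding h_def
        by (subst local_deriv_Pair[OF holomorphic_const[OF G.one_closed]
          holomorphic_map_ident[OF atlas_S] cs e cs])
          (simp add: local_deriv_const local_deriv_ident[OF atlas_S cs])
      then show ?thesis
        using tangent_map_coord_vec[OF atlas_S atlas_bundle slice cs hs, of w]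
        unfolding inv s_def[symmetric] base_form_eq[OF sM coord_vec_in[OF atlas_S cs]] by simp
    qed
    then have "eventually (\<lambda>z. \<omega> (chart_inv h (snd e \<e>, z)) (coord_vec P h (chart_inv h (snd e \<e>, z)) (0, w)) e
        = base_form K S \<omega> (chart_inv c z) (coord_vec S c (chart_inv c z) w) e) (nhds x)"
      by (intro eventually_nhds_in_open[of "snd c ` fst c", THEN eventually_mono]
          atlas_open_image[OF atlas_S c order_refl atlas_open[OF atlas_S c]] x) simp
    ultimately show ?thesis
      by (rule holomorphic_at_eventually_transfer)
  qed
  show ?thesis
    by (rule hol_formsI) (rule base_form_outside lin(1) lin(2) lin(3) hol'; assumption)+
qed

subsection \<open>The connection with a given restriction to the canonical section\<close>

definition extended_form :: "('s, complex, 'k, 'e) lie_form \<Rightarrow> ('k \<times> 's, 'e \<times> complex, 'k, 'e) lie_form"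
  where "extended_form \<xi> p v = (if p \<in> manifold_carrier P \<and> v \<in> tangent_space P p
    then tangent_map A A (\<lambda>x. \<iota> (fst p) \<cdot> x) (fst p) (tangent_map P A fst p v)
      + Ad K (\<iota> (fst p)) (\<xi> (snd p) (tangent_map P S snd p v))
    else 0)"

lemma extended_form_eq:
  assumes "g \<in> carrier K" "s \<in> M" "v \<in> tangent_space P (g, s)"
  shows "extended_form \<xi> (g, s) v = tangent_map A A (\<lambda>x. \<iota> g \<cdot> x) g (tangent_map P A fst (g, s) v)
      + Ad K (\<iota> g) (\<xi> s (tangent_map P S snd (g, s) v))"
  using assms by (simp add: extended_form_def)

lemma scale_tvec_0_left: "scale_tvec 0 u = 0"
  by (rule ext) (simp add: scale_tvec_def)

lemma hol_form_zero:
  assumes "\<xi> \<in> hol_forms K B" "complex_atlas B"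
  shows "\<xi> p 0 = 0"
proof (cases "p \<in> manifold_carrier B")
  case True
  then show ?thesis
    using hol_formsD(4)[OF assms(1) True tangent_space_0[OF assms(2)], of 0]
    by (simp add: scale_tvec_0_left)
qed (simp add: hol_formsD(1)[OF assms(1)])

lemma scale_tvec_add: "scale_tvec a (u + v) = scale_tvec a u + scale_tvec a v"
  by (rule ext) (simp add: scale_tvec_def scaleC_add_right)

text \<open>This makes \<open>base_form\<close> surjective from connections onto holomorphic forms.
  The algebraic axioms follow from functoriality of tangent maps; only holomorphy in the bundle
  variables needs analysis.\<close>

lemma extended_form_connection:
  assumes \<xi>: "\<xi> \<in> hol_forms K S"
  shows "extended_form \<xi> \<in> connections K S" "base_form K S (extended_form \<xi>) = \<xi>"
proof -
  note D = hol_formsD[OF \<xi>]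
  have pr: "tangent_map P A fst p v \<in> tangent_space A (fst p)"
    "tangent_map P S snd p v \<in> tangent_space S (snd p)"
    if "p \<in> manifold_carrier P" "v \<in> tangent_space P p" for p v
    using tangent_projections[of "fst p" "snd p" v] that by auto
  have lin: "extended_form \<xi> p u \<in> lie_algebra K"
    "extended_form \<xi> p (u + v) = extended_form \<xi> p u + extended_form \<xi> p v"
    "extended_form \<xi> p (scale_tvec a u) = scale_tvec a (extended_form \<xi> p u)"
    if p: "p \<in> manifold_carrier P" and u: "u \<in> tangent_space P p" and v: "v \<in> tangent_space P p"
      for p u v a
  proof -
    obtain g s where p_eq: "p = (g, s)" and g: "g \<in> carrier K" and s: "s \<in> M"
      using p by auto
    have gc: "g \<in> manifold_carrier A"
      using g by (simp add: carrier_eq)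
    note u' = u[unfolded p_eq] and v' = v[unfolded p_eq] and p' = p[unfolded p_eq]
    note pu = tangent_projections[OF g s u'] and pv = tangent_projections[OF g s v']
    have ig: "\<iota> g \<in> carrier K"
      using g by simp
    note L = holomorphic_left[OF ig]
    show "extended_form \<xi> p u \<in> lie_algebra K"
      unfolding p_eq extended_form_eq[OF g s u']
      using tangent_space_add[OF atlas_K, of _ \<e>] left_translate_in[OF g pu(1)] Ad_in[OF ig D(2)[OF s
        pu(2)]]
      by (simp add: lie_algebra_eq)
    show "extended_form \<xi> p (u + v) = extended_form \<xi> p u + extended_form \<xi> p v"
      unfolding p_eq extended_form_eq[OF g s u'] extended_form_eq[OF g s v']
        extended_form_eq[OF g s tangent_space_add[OF atlas_bundle u' v']]
        tangent_map_add[OF holomorphic_fst p'] tangent_map_add[OF holomorphic_snd p']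
        tangent_map_add[OF L gc] D(3)[OF s pu(2) pv(2)] Ad_add[OF ig]
      by (simp only: add.assoc add.left_commute)
    show "extended_form \<xi> p (scale_tvec a u) = scale_tvec a (extended_form \<xi> p u)"
      unfolding p_eq extended_form_eq[OF g s u']
        extended_form_eq[OF g s tangent_space_scale[OF atlas_bundle u']]
        tangent_map_scale[OF holomorphic_fst p'] tangent_map_scale[OF holomorphic_snd p']
        tangent_map_scale[OF L gc] D(4)[OF s pu(2)] Ad_scale[OF ig] scale_tvec_add ..
  qed
  \<comment> \<open>A fundamental vector is X translated by g in the fibre, which the first summand
    translates back; its component along the surface is the differential of a constant.\<close>
  have fund: "extended_form \<xi> p (fundamental_vec K S p X) = X"
    if p: "p \<in> manifold_carrier P" and X: "X \<in> lie_algebra K" for p X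
  proof -
    obtain g s where p_eq: "p = (g, s)" and g: "g \<in> carrier K" and s: "s \<in> M"
      using p by auto
    have ec: "\<e> \<in> manifold_carrier A" and ig: "\<iota> g \<in> carrier K"
      using g by (simp_all add: carrier_eq)
    note F = holomorphic_fibre[OF s holomorphic_left[OF g]]
    have X': "X \<in> tangent_space A \<e>"
      using X by (simp add: lie_algebra_eq)
    have "tangent_map P A fst (g, s) (fundamental_vec K S (g, s) X) = tangent_map A A (\<lambda>x. g \<cdot> x) \<e> X"
      unfolding fundamental_vec_eq using tangent_map_compose[OF atlas_K atlas_bundle F holomorphic_fst
        X' ec] g by simp
    then have "tangent_map A A (\<lambda>x. \<iota> g \<cdot> x) g (tangent_map P A fst (g, s) (fundamental_vec K S (g, s) X))
        = tangent_map A A (\<lambda>x. \<iota> g \<cdot> (g \<cdot> x)) \<e> X"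
      using tangent_map_compose[OF atlas_K atlas_K holomorphic_left[OF g] holomorphic_left[OF ig] X' ec]
        g by simp
    also have "\<dots> = tangent_map A A (\<lambda>x. x) \<e> X"
      by (rule tangent_map_cong[OF atlas_K ec]) (simp add: g carrier_eq G.m_assoc[symmetric])
    also have "\<dots> = X"
      by (rule tangent_map_ident[OF atlas_K X'])
    finally have 1: "tangent_map A A (\<lambda>x. \<iota> g \<cdot> x) g (tangent_map P A fst (g, s) (fundamental_vec K S (g, s) X)) = X" .
    have 2: "tangent_map P S snd (g, s) (fundamental_vec K S (g, s) X) = 0"
      unfolding fundamental_vec_eq using tangent_map_compose[OF atlas_K atlas_bundle F holomorphic_snd
        X' ec] g
      by (simp add: tangent_map_const)
    show ?thesis
      unfolding p_eq extended_form_eq[OF g s fundamental_vec_in[OF g s X]] 1 2 hol_form_zero[OF \<xi>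
        atlas_S] Ad_0[OF ig]
      by simp
  qed
  \<comment> \<open>Right translation by h does not change the surface component and turns the
    Maurer-Cartan summand by Ad(h^-1); in the other summand Ad((gh)^-1) = Ad(h^-1) Ad(g^-1).\<close>
  have equiv: "extended_form \<xi> (right_act K p h) (tangent_map P P (\<lambda>q. right_act K q h) p v)
      = Ad K (\<iota> h) (extended_form \<xi> p v)"
    if h: "h \<in> carrier K" and p: "p \<in> manifold_carrier P" and v: "v \<in> tangent_space P p" for h p v
  proof -
    obtain g s where p_eq: "p = (g, s)" and g: "g \<in> carrier K" and s: "s \<in> M"
      using p by auto
    note p' = p[unfolded p_eq] and v' = v[unfolded p_eq]
    note pv = tangent_projections[OF g s v']
    have gh: "g \<cdot> h \<in> carrier K" and ih: "\<iota> h \<in> carrier K" and ig: "\<iota> g \<in> carrier K"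
      using g h by simp_all
    have ra: "right_act K (g, s) h = (g \<cdot> h, s)"
      by (simp add: right_act_def)
    define v2 where "v2 = tangent_map P P (\<lambda>q. right_act K q h) (g, s) v"
    have v2: "v2 \<in> tangent_space P (g \<cdot> h, s)"
      using tangent_map_in[OF atlas_bundle atlas_bundle holomorphic_right_act[OF h] v' p']
      by (simp add: v2_def ra)
    have R: "holomorphic_map A A (\<lambda>x. x \<cdot> h)"
      by (intro holomorphic_mult[OF atlas_K] holomorphic_const holomorphic_id h)
    have "tangent_map P A fst (g \<cdot> h, s) v2 = tangent_map P A (\<lambda>q. fst q \<cdot> h) (g, s) v"
      using tangent_map_compose[OF atlas_bundle atlas_bundle holomorphic_right_act[OF h] holomorphic_fst
        v' p']
      by (simp add: v2_def ra) (simp add: right_act_def)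
    then have 1: "tangent_map P A fst (g \<cdot> h, s) v2 = tangent_map A A (\<lambda>x. x \<cdot> h) g (tangent_map P A fst (g, s) v)"
      using tangent_map_compose[OF atlas_bundle atlas_K holomorphic_fst R v' p'] by simp
    have 2: "tangent_map P S snd (g \<cdot> h, s) v2 = tangent_map P S snd (g, s) v"
      using tangent_map_compose[OF atlas_bundle atlas_bundle holomorphic_right_act[OF h] holomorphic_snd
        v' p']
      by (simp add: v2_def ra) (simp add: right_act_def)
    note X = D(2)[OF s pv(2)]
    show ?thesis
      unfolding p_eq ra v2_def[symmetric] extended_form_eq[OF gh s v2] 1 2 Ad_left_translate[OF g h
        pv(1)]
        extended_form_eq[OF g s v'] Ad_add[OF ih]
      by (simp only: G.inv_mult_group[OF g h] Ad_mult[OF ih ig X])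
  qed
  have hol: "holomorphic_at (\<lambda>z. extended_form \<xi> (chart_inv h z) (coord_vec P h (chart_inv h z) w) e) x0"
    if h: "h \<in> P" and e: "e \<in> charts_at A \<e>" and x0: "x0 \<in> snd h ` fst h" for h w e x0
  proof -
    obtain c d where c: "c \<in> A" and d: "d \<in> S" and h_eq: "h = prod_chart c d"
      using h unfolding P_eq by (rule prod_atlasE)
    obtain w1 w2 where w: "w = (w1, w2)" by (cases w)
    define x y where "x = fst x0" and "y = snd x0"
    have x: "x \<in> snd c ` fst c" and y: "y \<in> snd d ` fst d"
      using x0 by (auto simp: h_eq prod_chart_image x_def y_def)
    \<comment> \<open>The coordinate formula: both summands become Jacobians of maps of K that
      depend on g as a parameter.\<close>
    have eq: "extended_form \<xi> (chart_inv h z) (coord_vec P h (chart_inv h z) w) e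
        = local_deriv c e (\<lambda>x. \<iota> (chart_inv c (fst z)) \<cdot> x) (chart_inv c (fst z)) w1
          + local_deriv e e (\<lambda>x. \<iota> (chart_inv c (fst z)) \<cdot> x \<cdot> chart_inv c (fst z)) \<e>
            (\<xi> (chart_inv d (snd z)) (coord_vec S d (chart_inv d (snd z)) w2) e)"
      if z: "z \<in> snd h ` fst h" for z
    proof -
      have z': "fst z \<in> snd c ` fst c" "snd z \<in> snd d ` fst d"
        using z by (auto simp: h_eq prod_chart_image)
      define g s where "g = chart_inv c (fst z)" and "s = chart_inv d (snd z)"
      have cg: "c \<in> charts_at A g" and ds: "d \<in> charts_at S s"
        unfolding g_def s_def using chart_inv_in[OF atlas_K c z'(1)] chart_inv_in[OF atlas_S d z'(2)] c
          d
        by (auto intro: charts_atI)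
      have g: "g \<in> carrier K" and s: "s \<in> M"
        using charts_atD(3)[OF cg] charts_atD(3)[OF ds] by (simp_all add: carrier_eq)
      have gs: "chart_inv h z = (g, s)"
        unfolding h_eq g_def s_def using z by (intro chart_inv_prod[OF atlas_K atlas_S c d]) (auto
          simp: h_eq prod_chart_image)
      have hp: "h \<in> charts_at P (g, s)"
        unfolding h_eq P_eq by (rule prod_chart_at[OF cg ds])
      have v: "coord_vec P h (g, s) w \<in> tangent_space P (g, s)"
        by (rule coord_vec_in[OF atlas_bundle hp])
      have "local_deriv h c fst (g, s) w = w1" "local_deriv h d snd (g, s) w = w2"
        unfolding h_eq using local_deriv_fst[OF atlas_K atlas_S cg ds, of w] local_deriv_snd[OF atlas_K
          atlas_S cg ds, of w]
        by (simp_all add: w)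
      then have T: "tangent_map P A fst (g, s) (coord_vec P h (g, s) w) = coord_vec A c g w1"
        "tangent_map P S snd (g, s) (coord_vec P h (g, s) w) = coord_vec S d s w2"
        using tangent_map_coord_vec[OF atlas_bundle atlas_K holomorphic_fst hp, of c w] cg
          tangent_map_coord_vec[OF atlas_bundle atlas_S holomorphic_snd hp, of d w] ds by simp_all
      have ig: "\<iota> g \<in> carrier K"
        using g by simp
      have "e \<in> charts_at A (\<iota> g \<cdot> g)"
        using e g by simp
      then have 1: "tangent_map A A (\<lambda>x. \<iota> g \<cdot> x) g (coord_vec A c g w1) e
          = local_deriv c e (\<lambda>x. \<iota> g \<cdot> x) g w1"
        using tangent_map_apply[OF atlas_K holomorphic_left[OF ig] coord_vec_in[OF atlas_K cg] cg, of e
          w1]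
        by (simp add: coord_vec_same[OF atlas_K cg])
      \<comment> \<open>Conjugation fixes the identity, so the same chart e serves at source and
        target.\<close>
      have "e \<in> charts_at A (\<iota> g \<cdot> \<e> \<cdot> \<iota> (\<iota> g))"
        using e g by simp
      then have 2: "Ad K (\<iota> g) X e = local_deriv e e (\<lambda>x. \<iota> g \<cdot> x \<cdot> g) \<e> (X e)"
        if "X \<in> lie_algebra K" for X
        using tangent_map_apply[OF atlas_K holomorphic_conj[OF ig] _ e, of X e] that g
        by (simp add: Ad_def lie_algebra_eq)
      show ?thesis
        unfolding gs extended_form_eq[OF g s v] T g_def[symmetric] s_def[symmetric]
        by (simp add: 1 2[OF D(2)[OF s coord_vec_in[OF atlas_S ds]]])
    qed
    \<comment> \<open>Left translation and conjugation as maps of two variables, the first being the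
      parameter g in which holomorphy is wanted.\<close>
    define m1 where "m1 = (\<lambda>q. \<iota> (fst q) \<cdot> snd q)"
    define m2 where "m2 = (\<lambda>q. \<iota> (fst q) \<cdot> snd q \<cdot> fst q)"
    note AA = complex_atlas_prod[OF atlas_K atlas_K]
    note fs = holomorphic_map_fst[OF atlas_K atlas_K] holomorphic_map_snd[OF atlas_K atlas_K]
    have m1: "holomorphic_map (prod_atlas A A) A m1"
      unfolding m1_def by (intro holomorphic_mult[OF AA] holomorphic_inv[OF AA] fs)
    have m2: "holomorphic_map (prod_atlas A A) A m2"
      unfolding m2_def by (intro holomorphic_mult[OF AA] holomorphic_inv[OF AA] fs)
    define g where "g = chart_inv c x"
    have xg: "x = snd c g"
      unfolding g_def using chart_inv_right[OF atlas_K c x] by simp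
    have cg: "c \<in> charts_at A g"
      unfolding g_def using chart_inv_in[OF atlas_K c x] c by (auto intro: charts_atI)
    have g: "g \<in> carrier K"
      using charts_atD(3)[OF cg] by (simp add: carrier_eq)
    have e1: "e \<in> charts_at A (m1 (g, g))" and e2: "e \<in> charts_at A (m2 (g, \<e>))"
      using e g by (simp_all add: m1_def m2_def)
    \<comment> \<open>The coordinate of g occurs twice because translation by g^-1 is differentiated
      at g itself: it is both parameter and base point.\<close>
    have "holomorphic_at (\<lambda>z :: 'e \<times> complex. ((fst z, fst z), w1)) x0"
      by (intro holomorphic_at_Pair(1) holomorphic_at_fst holomorphic_at_const)
    from holomorphic_at_compose2[OF this, of
        "\<lambda>((x, y), w). local_deriv c e (\<lambda>y. m1 (chart_inv c x, y)) (chart_inv c y) w"]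
    have h1: "holomorphic_at (\<lambda>z :: 'e \<times> complex.
        local_deriv c e (\<lambda>x. \<iota> (chart_inv c (fst z)) \<cdot> x) (chart_inv c (fst z)) w1) x0"
      using holomorphic_at_local_deriv_param[OF atlas_K atlas_K atlas_K m1 cg cg e1, of w1]
      by (simp add: x_def[symmetric] xg[symmetric]) (simp add: m1_def)
    have "holomorphic_at (\<lambda>z. \<xi> (chart_inv d z) (coord_vec S d (chart_inv d z) w2) e) y"
      by (rule D(5)[OF d e y])
    then have "holomorphic_at (\<lambda>z :: 'e \<times> complex. \<xi> (chart_inv d (snd z)) (coord_vec S d (chart_inv d (snd z)) w2) e) x0"
      using holomorphic_at_compose2[OF holomorphic_at_snd[of x0]] by (simp add: y_def)
    \<comment> \<open>Here the base point stays at the identity, while the direction, the coordinate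
      of the value of \<xi>, varies holomorphically.\<close>
    then have "holomorphic_at (\<lambda>z :: 'e \<times> complex. ((fst z, snd e \<e>),
        \<xi> (chart_inv d (snd z)) (coord_vec S d (chart_inv d (snd z)) w2) e)) x0"
      by (intro holomorphic_at_Pair(1) holomorphic_at_fst holomorphic_at_const)
    from holomorphic_at_compose2[OF this, of
        "\<lambda>((x, y), w). local_deriv e e (\<lambda>y. m2 (chart_inv c x, y)) (chart_inv e y) w"]
    have h2: "holomorphic_at (\<lambda>z :: 'e \<times> complex.
        local_deriv e e (\<lambda>x. \<iota> (chart_inv c (fst z)) \<cdot> x \<cdot> chart_inv c (fst z)) \<e>
          (\<xi> (chart_inv d (snd z)) (coord_vec S d (chart_inv d (snd z)) w2) e)) x0"
      using holomorphic_at_local_deriv_param[OF atlas_K atlas_K atlas_K m2 cg e e2]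
        chart_inv_eq[OF atlas_K charts_atD(1,2)[OF e]]
      by (simp add: x_def[symmetric] xg[symmetric]) (simp add: m2_def)
    show ?thesis
    proof (rule holomorphic_at_eventually_transfer[OF holomorphic_at_add[OF h1 h2]])
      have "open (snd h ` fst h)"
        by (rule atlas_open_image[OF atlas_bundle h order_refl atlas_open[OF atlas_bundle h]])
      then show "eventually (\<lambda>z. local_deriv c e (\<lambda>x. \<iota> (chart_inv c (fst z)) \<cdot> x) (chart_inv c (fst z)) w1
          + local_deriv e e (\<lambda>x. \<iota> (chart_inv c (fst z)) \<cdot> x \<cdot> chart_inv c (fst z)) \<e>
            (\<xi> (chart_inv d (snd z)) (coord_vec S d (chart_inv d (snd z)) w2) e)
          = extended_form \<xi> (chart_inv h z) (coord_vec P h (chart_inv h z) w) e) (nhds x0)"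
        by (rule eventually_nhds_in_open[OF _ x0, THEN eventually_mono]) (rule eq[symmetric])
    qed
  qed
  have out: "\<not> (p \<in> manifold_carrier P \<and> v \<in> tangent_space P p) \<Longrightarrow> extended_form \<xi> p v = 0" for p v
    by (auto simp: extended_form_def)
  have "equivariant_form (extended_form \<xi>)"
    unfolding equivariant_form_def using out lin fund equiv by blast
  moreover have "extended_form \<xi> \<in> hol_forms K P"
    by (rule hol_formsI) (rule out lin(1) lin(2) lin(3) hol; assumption)+
  ultimately show "extended_form \<xi> \<in> connections K S"
    by (simp add: connections_iff)
  show "base_form K S (extended_form \<xi>) = \<xi>"
  proof (intro ext)
    fix s u e
    show "base_form K S (extended_form \<xi>) s u e = \<xi> s u e"
    proof (cases "s \<in> M \<and> u \<in> tangent_space S s")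
      case True
      then have s: "s \<in> M" and u: "u \<in> tangent_space S s"
        by auto
      note slice = holomorphic_slice[OF G.one_closed]
      have 1: "tangent_map P A fst (\<e>, s) (tangent_map S P (\<lambda>s. (\<e>, s)) s u) = 0"
        using tangent_map_compose[OF atlas_S atlas_bundle slice holomorphic_fst u s]
        by (simp add: tangent_map_const)
      have 2: "tangent_map P S snd (\<e>, s) (tangent_map S P (\<lambda>s. (\<e>, s)) s u) = u"
        using tangent_map_compose[OF atlas_S atlas_bundle slice holomorphic_snd u s]
        by (simp add: tangent_map_ident[OF atlas_S u])
      have 3: "tangent_map A A (\<lambda>x. \<iota> \<e> \<cdot> x) \<e> 0 = 0"
        by (rule tangent_map_0[OF holomorphic_left]) (simp_all add: carrier_eq)
      show ?thesis
        unfolding base_form_eq[OF s u] extended_form_eq[OF G.one_closed s slice_in[OF s u G.one_closed]]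
          1 2 3
        by (simp add: Ad_one D(2)[OF s u])
    next
      case False
      then show ?thesis
        using D(1) base_form_outside by metis
    qed
  qed
qed

section \<open>Flatness is automatic over a curve\<close>

text \<open>With H w the coefficient function of the form in the constant direction w, one scalar
  comes out of H by homogeneity of the form and the other out of the complex linear derivative. Both
  terms of the exterior derivative thus equal ab times the derivative of H v along v.\<close>

lemma ext_deriv_scale:
  assumes B: "complex_atlas B" and \<omega>: "\<omega> \<in> hol_forms K B"
    and p: "p \<in> manifold_carrier B" and v: "v \<in> tangent_space B p"
  shows "ext_deriv B \<omega> p (scale_tvec a v) (scale_tvec b v) = 0"
proof
  fix e
  define c where "c = some_chart B p"
  have c: "c \<in> charts_at B p"
    unfolding c_def by (rule some_chart_in[OF p])
  define H where "H w = (\<lambda>z. \<omega> (chart_inv c z) (coord_vec B c (chart_inv c z) w) e)" for w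
  have ext: "ext_deriv B \<omega> p (scale_tvec a v) (scale_tvec b v) e
    = frechet_derivative (H (b *\<^sub>C v c)) (at (snd c p)) (a *\<^sub>C v c)
      - frechet_derivative (H (a *\<^sub>C v c)) (at (snd c p)) (b *\<^sub>C v c)"
    by (simp add: ext_deriv_def vec_deriv_def Let_def scale_tvec_def c_def[symmetric] H_def)
  show "ext_deriv B \<omega> p (scale_tvec a v) (scale_tvec b v) e = 0 e"
  proof (cases "e \<in> charts_at A \<e>")
    case True
    have H: "holomorphic_at (H w) (snd c p)" for w
      unfolding H_def using charts_atD(1,2)[OF c] by (intro hol_formsD(5)[OF \<omega> _ True]) auto
    have "eventually (\<lambda>z. H (t *\<^sub>C w) z = t *\<^sub>C H w z) (nhds (snd c p))" for t w
    proof (rule eventually_mono[OF chart_eventually[OF B c open_UNIV UNIV_I]])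
      fix z assume "z \<in> snd c ` fst c \<and> chart_inv c z \<in> fst c \<inter> UNIV"
      then have cz: "c \<in> charts_at B (chart_inv c z)"
        using charts_atD(1)[OF c] by (auto intro: charts_atI)
      have "coord_vec B c (chart_inv c z) (t *\<^sub>C w) = scale_tvec t (coord_vec B c (chart_inv c z) w)"
        by (rule tangent_vec_eqI[OF coord_vec_in[OF B cz] tangent_space_scale[OF B coord_vec_in[OF B
          cz]] cz])
          (simp add: scale_tvec_def coord_vec_same[OF B cz])
      then show "H (t *\<^sub>C w) z = t *\<^sub>C H w z"
        using hol_formsD(4)[OF \<omega> charts_atD(3)[OF cz] coord_vec_in[OF B cz], of t w]
        by (simp add: H_def scale_tvec_def)
    qed
    then have "frechet_derivative (H (t *\<^sub>C w)) (at (snd c p)) (t' *\<^sub>C w)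
        = (t * t') *\<^sub>C frechet_derivative (H w) (at (snd c p)) w" for t t' w
      using frechet_derivative_eventually_cong[of "H (t *\<^sub>C w)" "\<lambda>z. t *\<^sub>C H w z" "snd c p"]
        holomorphic_at_scaleC_derivative[OF H[of w], of t "t' *\<^sub>C w"]
        clinear_map_scaleC[OF holomorphic_at_clinear[OF H[of w]], of t' w]
      by (simp add: scaleC_scaleC)
    then show ?thesis
      unfolding ext by (simp add: mult.commute)
  next
    case False
    \<comment> \<open>Values of the form are tangent vectors at the identity, whose entries at
      charts not containing it are zero by definition.\<close>
    have "H w = (\<lambda>_. 0)" for w
    proof
      fix z
      have "\<omega> (chart_inv c z) (coord_vec B c (chart_inv c z) w) \<in> tangent_space A \<e>"
        using hol_formsD(1,2)[OF \<omega>, of "chart_inv c z" "coord_vec B c (chart_inv c z) w"]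
          tangent_space_0[OF atlas_K, of \<e>] unfolding lie_algebra_eq by metis
      then show "H w z = 0"
        unfolding H_def using False by (rule tangent_vec_outside)
    qed
    then show ?thesis
      unfolding ext by (simp add: frechet_derivative_eqI[OF has_derivative_const])
  qed
qed

section \<open>Horizontal tangent vectors\<close>

lemma connection_diff:
  assumes \<omega>: "\<omega> \<in> connections K S" and p: "p \<in> manifold_carrier P"
    and u: "u \<in> tangent_space P p" and v: "v \<in> tangent_space P p"
  shows "\<omega> p (u - v) = \<omega> p u - \<omega> p v"
proof -
  have hol: "\<omega> \<in> hol_forms K P"
    using \<omega> by (simp add: connections_iff)
  have "\<omega> p (u + scale_tvec (-1) v) = \<omega> p u + scale_tvec (-1) (\<omega> p v)"
    using hol_formsD(3)[OF hol p u tangent_space_scale[OF atlas_bundle v]] hol_formsD(4)[OF hol p v]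
    by simp
  then show ?thesis
    by (simp add: scale_tvec_minus_one)
qed

lemma horizontal_part_in:
  assumes \<omega>: "\<omega> \<in> connections K S" and p: "p \<in> manifold_carrier P" and u: "u \<in> tangent_space P p"
  shows "horizontal_part K S \<omega> p u \<in> tangent_space P p" "\<omega> p (horizontal_part K S \<omega> p u) = 0"
proof -
  obtain g s where gs: "p = (g, s)" "g \<in> carrier K" "s \<in> M"
    using p by auto
  have eqv: "equivariant_form \<omega>"
    using \<omega> by (simp add: connections_iff)
  note X = equivariant_formD(2)[OF eqv p u]
  have F: "fundamental_vec K S p (\<omega> p u) \<in> tangent_space P p"
    using fundamental_vec_in[OF gs(2,3), of "\<omega> p u"] X by (simp add: gs(1))
  show "horizontal_part K S \<omega> p u \<in> tangent_space P p"
    unfolding horizontal_part_def by (rule tangent_space_diff[OF atlas_bundle u F])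
  show "\<omega> p (horizontal_part K S \<omega> p u) = 0"
    unfolding horizontal_part_def connection_diff[OF \<omega> p u F] equivariant_formD(4)[OF eqv p X] by simp
qed

text \<open>A vector without surface component is vertical, and on it the form is left translation
  to the identity, which is invertible. So the kernel of the form meets the vertical space only in
  zero.\<close>

lemma horizontal_eq_0:
  assumes \<omega>: "\<omega> \<in> connections K S" and p: "p \<in> manifold_carrier P" and v: "v \<in> tangent_space P p"
    and hor: "\<omega> p v = 0" and snd0: "tangent_map P S snd p v = 0"
  shows "v = 0"
proof -
  obtain g s where p_eq: "p = (g, s)" and g: "g \<in> carrier K" and s: "s \<in> M"
    using p by auto
  note p' = p[unfolded p_eq] and v' = v[unfolded p_eq]
  have ig: "\<iota> g \<in> carrier K" and gc: "g \<in> manifold_carrier A"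
    using g by (simp_all add: carrier_eq)
  define Y where "Y = tangent_map P A fst (g, s) v"
  have Y: "Y \<in> tangent_space A g"
    unfolding Y_def by (rule tangent_projections[OF g s v'])
  have eqv: "equivariant_form \<omega>"
    using \<omega> by (simp add: connections_iff)
  have "tangent_map A A (\<lambda>x. \<iota> g \<cdot> x) g Y = 0"
    using equivariant_form_decomp[OF eqv g s v'] hor snd0
      hol_form_zero[OF base_form_in_hol_forms[OF \<omega>] atlas_S, of s]
    by (simp add: p_eq Y_def Ad_0[OF ig])
  then have "tangent_map A A (\<lambda>x. g \<cdot> (\<iota> g \<cdot> x)) g Y = tangent_map A A (\<lambda>x. g \<cdot> x) (\<iota> g \<cdot> g) 0"
    using tangent_map_compose[OF atlas_K atlas_K holomorphic_left[OF ig] holomorphic_left[OF g] Y gc]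
    by simp
  also have "\<dots> = 0"
    using g by (intro tangent_map_0[OF holomorphic_left]) (simp_all add: carrier_eq)
  also have "tangent_map A A (\<lambda>x. g \<cdot> (\<iota> g \<cdot> x)) g Y = tangent_map A A (\<lambda>x. x) g Y"
    by (rule tangent_map_cong[OF atlas_K gc]) (simp add: g carrier_eq G.m_assoc[symmetric])
  finally have "Y = 0"
    by (simp only: tangent_map_ident[OF atlas_K Y])
  then show ?thesis
    using prod_tangent_eqI[OF atlas_K atlas_S, folded P_eq, OF v tangent_space_0[OF atlas_bundle] p]
      snd0
      tangent_map_0[OF holomorphic_fst p] tangent_map_0[OF holomorphic_snd p]
    by (simp add: Y_def p_eq)
qed

text \<open>The horizontal space at a point projects injectively to the tangent line of the surface.\<close>

lemma horizontal_proportional: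
  assumes \<omega>: "\<omega> \<in> connections K S" and p: "p \<in> manifold_carrier P"
    and u: "u \<in> tangent_space P p" "\<omega> p u = 0" and v: "v \<in> tangent_space P p" "\<omega> p v = 0"
  shows "u = 0 \<or> (\<exists>t. v = scale_tvec t u)"
proof -
  have hol: "\<omega> \<in> hol_forms K P"
    using \<omega> by (simp add: connections_iff)
  obtain g s where p_eq: "p = (g, s)" and g: "g \<in> carrier K" and s: "s \<in> M"
    using p by auto
  obtain d where d: "d \<in> charts_at S s"
    using charts_at_nonempty[OF s] by blast
  define \<alpha> \<beta> where "\<alpha> = tangent_map P S snd p u" and "\<beta> = tangent_map P S snd p v"
  have \<alpha>: "\<alpha> \<in> tangent_space S s" and \<beta>: "\<beta> \<in> tangent_space S s"
    unfolding \<alpha>_def \<beta>_def p_eq using u v p_eq tangent_projections(2)[OF g s] by auto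
  show ?thesis
  proof (cases "\<alpha> d = 0")
    case True
    then have "\<alpha> = 0"
      by (intro tangent_vec_eqI[OF \<alpha> tangent_space_0[OF atlas_S] d]) simp
    then show ?thesis
      using horizontal_eq_0[OF \<omega> p u] by (simp add: \<alpha>_def)
  next
    case False
    \<comment> \<open>The tangent space of the surface is a complex line, so coordinates in a chart
      are complex numbers and their quotient gives the factor of proportionality.\<close>
    define t where "t = \<beta> d / \<alpha> d"
    note tu = tangent_space_scale[OF atlas_bundle u(1), of t]
    have t\<alpha>: "scale_tvec t \<alpha> = \<beta>"
      by (rule tangent_vec_eqI[OF tangent_space_scale[OF atlas_S \<alpha>] \<beta> d])
        (use False in \<open>simp add: t_def scale_tvec_def scaleC_complex_def\<close>)
    have "tangent_map P S snd p (v - scale_tvec t u)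
        = tangent_map P S snd p v + scale_tvec (-1) (tangent_map P S snd p (scale_tvec t u))"
      unfolding tangent_map_scale[OF holomorphic_snd p, symmetric] tangent_map_add[OF holomorphic_snd p,
        symmetric]
      by (simp add: scale_tvec_minus_one)
    also have "\<dots> = 0"
      using t\<alpha> unfolding tangent_map_scale[OF holomorphic_snd p] \<alpha>_def \<beta>_def
      by (simp add: scale_tvec_minus_one)
    finally have 1: "tangent_map P S snd p (v - scale_tvec t u) = 0" .
    have 2: "\<omega> p (v - scale_tvec t u) = 0"
      unfolding connection_diff[OF \<omega> p v(1) tu] hol_formsD(4)[OF hol p u(1)] by (simp add: u v)
    have "v - scale_tvec t u = 0"
      by (rule horizontal_eq_0[OF \<omega> p tangent_space_diff[OF atlas_bundle v(1) tu] 2 1])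
    then show ?thesis
      by auto
  qed
qed

lemma flat_connections_eq: "flat_connections K S = connections K S"
proof -
  have "curvature K S \<omega> p u v = 0"
    if \<omega>: "\<omega> \<in> connections K S" and p: "p \<in> manifold_carrier P"
      and u: "u \<in> tangent_space P p" and v: "v \<in> tangent_space P p" for \<omega> p u v
  proof -
    have hol: "\<omega> \<in> hol_forms K P"
      using \<omega> by (simp add: connections_iff)
    define a b where "a = horizontal_part K S \<omega> p u" and "b = horizontal_part K S \<omega> p v"
    have a: "a \<in> tangent_space P p" "\<omega> p a = 0" and b: "b \<in> tangent_space P p" "\<omega> p b = 0"
      unfolding a_def b_def using horizontal_part_in[OF \<omega> p] u v by auto
    note E = ext_deriv_scale[OF atlas_bundle hol p]
    have one: "scale_tvec 1 w = w" for w :: "('k \<times> 's, 'e \<times> complex) tvec"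
      by (rule ext) (simp add: scale_tvec_def)
    \<comment> \<open>If a = 0, then a = 0 b and b = 1 b; otherwise a = 1 a and b = t a. In both
      cases the arguments are multiples of a single vector.\<close>
    from horizontal_proportional[OF \<omega> p a b] have "ext_deriv P \<omega> p a b = 0"
      using E[OF b(1), of 0 1] E[OF a(1), of 1] by (auto simp: scale_tvec_0_left one)
    then show ?thesis
      by (simp add: curvature_def a_def b_def)
  qed
  then show ?thesis
    unfolding flat_connections_def by blast
qed

section \<open>Gauge transformations\<close>

lemma gaugeD:
  assumes "gauge_transformation K S F"
  shows "bij_betw F (manifold_carrier P) (manifold_carrier P)"
    and "holomorphic_map P P F"
    and "holomorphic_map P P (inv_into (manifold_carrier P) F)"
    and "p \<in> manifold_carrier P \<Longrightarrow> snd (F p) = snd p"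
    and "p \<in> manifold_carrier P \<Longrightarrow> g \<in> carrier K \<Longrightarrow> F (right_act K p g) = right_act K (F p) g"
  using assms unfolding gauge_transformation_def Let_def by blast+

lemma gauge_ident: "gauge_transformation K S (\<lambda>x. x)"
  unfolding gauge_transformation_def Let_def
proof (intro conjI ballI)
  show "bij_betw (\<lambda>x. x) (manifold_carrier P) (manifold_carrier P)"
    by (simp add: bij_betw_def)
  show "holomorphic_map P P (\<lambda>x. x)"
    by (rule holomorphic_map_ident[OF atlas_bundle])
  then show "holomorphic_map P P (inv_into (manifold_carrier P) (\<lambda>x. x))"
    by (rule holomorphic_map_cong[OF atlas_bundle, rotated]) (simp add: inv_into_f_f[of "\<lambda>x. x"])
qed auto

lemma right_act_in: "p \<in> manifold_carrier P \<Longrightarrow> g \<in> carrier K \<Longrightarrow> right_act K p g \<in> manifold_carrier P"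
  by (auto simp: right_act_def)

lemma gauge_inverse:
  assumes F: "gauge_transformation K S F"
  shows "gauge_transformation K S (inv_into (manifold_carrier P) F)"
proof -
  note D = gaugeD[OF F]
  let ?C = "manifold_carrier P"
  let ?I = "inv_into ?C F"
  have inj: "inj_on F ?C" and img: "F ` ?C = ?C"
    using D(1) by (auto simp: bij_betw_def)
  have I: "?I p \<in> ?C" "F (?I p) = p" if "p \<in> ?C" for p
    using that img by (metis inv_into_into) (metis f_inv_into_f img that)
  \<comment> \<open>The double inverse agrees with F only on the carrier, which is as much as
    \<open>holomorphic_map_cong\<close> asks for.\<close>
  have II: "inv_into ?C ?I p = F p" if p: "p \<in> ?C" for p
  proof -
    have "inj_on ?I ?C"
      using inj_on_inv_into[of ?C F ?C] img by simp
    moreover have "F p \<in> ?C" "?I (F p) = p"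
      using img p inv_into_f_f[OF inj p] by auto
    ultimately show ?thesis
      using inv_into_f_f by metis
  qed
  show ?thesis
    unfolding gauge_transformation_def Let_def
  proof (intro conjI ballI)
    show "bij_betw ?I ?C ?C"
      by (rule bij_betw_inv_into[OF D(1)])
    show "holomorphic_map P P ?I"
      by (rule D(3))
    show "holomorphic_map P P (inv_into ?C ?I)"
      by (rule holomorphic_map_cong[OF atlas_bundle II[symmetric] D(2)])
    show "snd (?I p) = snd p" if "p \<in> ?C" for p
      using D(4)[OF I(1)[OF that]] I(2)[OF that] by simp
    show "?I (right_act K p g) = right_act K (?I p) g" if p: "p \<in> ?C" and g: "g \<in> carrier K" for p g
    proof -
      have "F (right_act K (?I p) g) = right_act K p g"
        using D(5)[OF I(1)[OF p] g] I(2)[OF p] by simp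
      then show ?thesis
        using inv_into_f_f[OF inj right_act_in[OF I(1)[OF p] g]] by simp
    qed
  qed
qed

lemma gauge_compose:
  assumes F: "gauge_transformation K S F" and G: "gauge_transformation K S G"
  shows "gauge_transformation K S (\<lambda>x. F (G x))"
proof -
  note F' = gaugeD[OF F] and G' = gaugeD[OF G]
  let ?C = "manifold_carrier P"
  have bij: "bij_betw (\<lambda>x. F (G x)) ?C ?C"
    using bij_betw_trans[OF G'(1) F'(1)] by (simp add: o_def)
  have GC: "G p \<in> ?C" if "p \<in> ?C" for p
    by (rule holomorphic_map_in[OF G'(2) that])
  have inv: "inv_into ?C G (inv_into ?C F p) = inv_into ?C (\<lambda>x. F (G x)) p" if p: "p \<in> ?C" for p
  proof -
    define q where "q = inv_into ?C G (inv_into ?C F p)"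
    have r: "inv_into ?C F p \<in> ?C" "F (inv_into ?C F p) = p"
      using F'(1) p by (auto simp: bij_betw_def intro: inv_into_into f_inv_into_f)
    then have q: "q \<in> ?C" "G q = inv_into ?C F p"
      using G'(1) unfolding q_def by (auto simp: bij_betw_def intro: inv_into_into f_inv_into_f)
    then have "F (G q) = p"
      using r by simp
    then show ?thesis
      using inv_into_f_f[OF bij_betw_imp_inj_on[OF bij] q(1)] by (simp add: q_def)
  qed
  show ?thesis
    unfolding gauge_transformation_def Let_def
  proof (intro conjI ballI)
    show "bij_betw (\<lambda>x. F (G x)) ?C ?C"
      by (rule bij)
    show "holomorphic_map P P (\<lambda>x. F (G x))"
      by (rule holomorphic_map_compose[OF atlas_bundle atlas_bundle G'(2) F'(2)])
    show "holomorphic_map P P (inv_into ?C (\<lambda>x. F (G x)))"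
      by (rule holomorphic_map_cong[OF atlas_bundle inv holomorphic_map_compose[OF atlas_bundle
        atlas_bundle F'(3) G'(3)]])
    show "snd (F (G p)) = snd p" if "p \<in> ?C" for p
      using F'(4)[OF GC[OF that]] G'(4)[OF that] by simp
    show "F (G (right_act K p g)) = right_act K (F (G p)) g" if "p \<in> ?C" "g \<in> carrier K" for p g
      using F'(5)[OF GC[OF that(1)] that(2)] G'(5)[OF that] by simp
  qed
qed

section \<open>Pullback of forms along gauge transformations\<close>

abbreviation "pullback \<equiv> pullback_form P P"

lemma pullback_eq:
  "p \<in> manifold_carrier P \<Longrightarrow> v \<in> tangent_space P p \<Longrightarrow>
    pullback F \<omega> p v = \<omega> (F p) (tangent_map P P F p v)"
  by (simp add: pullback_form_def)

lemma pullback_outside: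
  "\<not> (p \<in> manifold_carrier P \<and> v \<in> tangent_space P p) \<Longrightarrow> pullback F \<omega> p v = 0"
  by (auto simp: pullback_form_def)

lemma pullback_compose:
  assumes F: "holomorphic_map P P F" and G: "holomorphic_map P P G"
  shows "pullback G (pullback F \<omega>) = pullback (\<lambda>x. F (G x)) \<omega>"
proof (intro ext)
  fix p v e
  show "pullback G (pullback F \<omega>) p v e = pullback (\<lambda>x. F (G x)) \<omega> p v e"
  proof (cases "p \<in> manifold_carrier P \<and> v \<in> tangent_space P p")
    case True
    then have p: "p \<in> manifold_carrier P" and v: "v \<in> tangent_space P p"
      by auto
    show ?thesis
      unfolding pullback_eq[OF p v] pullback_eq[OF holomorphic_map_in[OF G p]
        tangent_map_in[OF atlas_bundle atlas_bundle G v p]]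
        tangent_map_compose[OF atlas_bundle atlas_bundle G F v p] ..
  next
    case False
    show ?thesis
      unfolding pullback_outside[OF False] ..
  qed
qed

text \<open>An inverse built with \<open>inv_into\<close> cancels F on the carrier only, hence the
  pointwise hypothesis; outside it the normalisation of forms takes over.\<close>

lemma pullback_cong_ident:
  assumes F: "\<And>p. p \<in> manifold_carrier P \<Longrightarrow> F p = p" and \<omega>: "equivariant_form \<omega>"
  shows "pullback F \<omega> = \<omega>"
proof (intro ext)
  fix p v e
  show "pullback F \<omega> p v e = \<omega> p v e"
  proof (cases "p \<in> manifold_carrier P \<and> v \<in> tangent_space P p")
    case True
    then have p: "p \<in> manifold_carrier P" and v: "v \<in> tangent_space P p"
      by auto
    show ?thesis
      using tangent_map_cong[OF atlas_bundle p F, where B = P and v = v]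
      by (simp add: pullback_eq[OF p v] F[OF p] tangent_map_ident[OF atlas_bundle v])
  next
    case False
    show ?thesis
      unfolding pullback_outside[OF False] equivariant_formD(1)[OF \<omega> False] ..
  qed
qed

text \<open>F commutes with the right action, so its differential sends fundamental vectors to
  fundamental vectors of the same X and intertwines right translations. This is what
  \<open>equivariant_form_eqI\<close> asks of a pullback.\<close>

lemma pullback_equivariant:
  assumes F: "gauge_transformation K S F" and \<omega>: "equivariant_form \<omega>"
  shows "equivariant_form (pullback F \<omega>)"
proof -
  note D = gaugeD[OF F] and W = equivariant_formD[OF \<omega>]
  have FC: "F p \<in> manifold_carrier P" if "p \<in> manifold_carrier P" for p
    by (rule holomorphic_map_in[OF D(2) that])
  have TF: "tangent_map P P F p v \<in> tangent_space P (F p)"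
    if "p \<in> manifold_carrier P" "v \<in> tangent_space P p" for p v
    by (rule tangent_map_in[OF atlas_bundle atlas_bundle D(2) that(2,1)])
  have 1: "pullback F \<omega> p u \<in> lie_algebra K" "pullback F \<omega> p (u + v) = pullback F \<omega> p u + pullback F \<omega> p v"
    if p: "p \<in> manifold_carrier P" and u: "u \<in> tangent_space P p" and v: "v \<in> tangent_space P p"
      for p u v
    unfolding pullback_eq[OF p u] pullback_eq[OF p v] pullback_eq[OF p tangent_space_add[OF atlas_bundle
      u v]]
      tangent_map_add[OF D(2) p]
    by (rule W(2)[OF FC[OF p] TF[OF p u]], rule W(3)[OF FC[OF p] TF[OF p u] TF[OF p v]])
  have 2: "pullback F \<omega> p (fundamental_vec K S p X) = X"
    if p: "p \<in> manifold_carrier P" and X: "X \<in> lie_algebra K" for p X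
  proof -
    obtain g s where gs: "p = (g, s)" "g \<in> carrier K" "s \<in> M"
      using p by auto
    have ec: "\<e> \<in> manifold_carrier A"
      by (simp add: carrier_eq)
    have R: "holomorphic_map A P (right_act K p)"
      using holomorphic_fibre[OF gs(3) holomorphic_left[OF gs(2)]]
      by (simp add: gs(1) right_act_def[abs_def])
    have rp: "right_act K p \<e> = p"
      by (simp add: gs right_act_def)
    have fv: "fundamental_vec K S p X \<in> tangent_space P p"
      using fundamental_vec_in[OF gs(2,3) X] by (simp add: gs(1))
    have "tangent_map P P F p (fundamental_vec K S p X) = tangent_map A P (\<lambda>x. F (right_act K p x)) \<e> X"
      unfolding fundamental_vec_def
      using tangent_map_compose[OF atlas_K atlas_bundle R D(2), of X \<e>] X ec
      by (simp add: rp lie_algebra_eq)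
    also have "\<dots> = fundamental_vec K S (F p) X"
      unfolding fundamental_vec_def
      by (rule tangent_map_cong[OF atlas_K ec]) (simp only: carrier_eq D(5)[OF p])
    finally show ?thesis
      by (simp add: pullback_eq[OF p fv] W(4)[OF FC[OF p] X])
  qed
  have 3: "pullback F \<omega> (right_act K p g) (tangent_map P P (\<lambda>q. right_act K q g) p v) = Ad K (\<iota> g) (pullback F \<omega> p v)"
    if g: "g \<in> carrier K" and p: "p \<in> manifold_carrier P" and v: "v \<in> tangent_space P p" for g p v
  proof -
    note R = holomorphic_right_act[OF g]
    have "tangent_map P P F (right_act K p g) (tangent_map P P (\<lambda>q. right_act K q g) p v)
        = tangent_map P P (\<lambda>q. F (right_act K q g)) p v"
      by (rule tangent_map_compose[OF atlas_bundle atlas_bundle R D(2) v p])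
    also have "\<dots> = tangent_map P P (\<lambda>q. right_act K (F q) g) p v"
      by (rule tangent_map_cong[OF atlas_bundle p]) (rule D(5)[OF _ g])
    also have "\<dots> = tangent_map P P (\<lambda>q. right_act K q g) (F p) (tangent_map P P F p v)"
      by (rule tangent_map_compose[OF atlas_bundle atlas_bundle D(2) R v p, symmetric])
    finally show ?thesis
      unfolding pullback_eq[OF p v] pullback_eq[OF right_act_in[OF p g] tangent_map_in[OF atlas_bundle
        atlas_bundle R v p]] D(5)[OF p g]
      using W(5)[OF g FC[OF p] TF[OF p v]] by simp
  qed
  show ?thesis
    unfolding equivariant_form_def using 1 2 3 pullback_outside by blast
qed

subsection \<open>Gauge transformations and the current group\<close>

text \<open>Multiplication from the left, as the map must commute with the right action of K on the
  fibres.\<close>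

definition gauge_of :: "('s \<Rightarrow> 'k) \<Rightarrow> 'k \<times> 's \<Rightarrow> 'k \<times> 's"
  where "gauge_of f p = (f (snd p) \<cdot> fst p, snd p)"

lemma current_groupD:
  assumes "f \<in> carrier (current_group K S)"
  shows "holomorphic_map S A f" "s \<in> M \<Longrightarrow> f s \<in> carrier K"
  using assms holomorphic_map_in[of S A f s] by (auto simp: current_group_def carrier_eq)

lemma gauge_of_gauge:
  assumes f: "f \<in> carrier (current_group K S)"
  shows "gauge_transformation K S (gauge_of f)"
proof -
  let ?C = "manifold_carrier P"
  note f' = current_groupD[OF f]
  have hol: "holomorphic_map P P (gauge_of h)" if "holomorphic_map S A h" for h
    unfolding gauge_of_def[abs_def]
    by (intro holomorphic_Pair holomorphic_mult[OF atlas_bundle] holomorphic_fst holomorphic_snd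
        holomorphic_map_compose[OF atlas_bundle atlas_S holomorphic_snd that])
  \<comment> \<open>The inverse is the gauge transformation of the pointwise inverse of f,
    holomorphic because inversion in K is.\<close>
  have inv: "gauge_of (\<lambda>s. \<iota> (f s)) (gauge_of f p) = p" "gauge_of f (gauge_of (\<lambda>s. \<iota> (f s)) p) = p"
    if "p \<in> ?C" for p
    using that f'(2) by (auto simp: gauge_of_def G.m_assoc[symmetric])
  have hol': "holomorphic_map P P (gauge_of (\<lambda>s. \<iota> (f s)))"
    by (intro hol holomorphic_inv[OF atlas_S] f')
  have bij: "bij_betw (gauge_of f) ?C ?C"
    by (rule bij_betw_byWitness[where f' = "gauge_of (\<lambda>s. \<iota> (f s))"])
      (use inv holomorphic_map_in[OF hol[OF f'(1)]] holomorphic_map_in[OF hol'] in blast)+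
  have inv_eq: "gauge_of (\<lambda>s. \<iota> (f s)) p = inv_into ?C (gauge_of f) p" if p: "p \<in> ?C" for p
    using inv_into_f_f[OF bij_betw_imp_inj_on[OF bij] holomorphic_map_in[OF hol' p]] inv(2)[OF p]
    by simp
  show ?thesis
    unfolding gauge_transformation_def Let_def
  proof (intro conjI ballI)
    show "holomorphic_map P P (inv_into ?C (gauge_of f))"
      by (rule holomorphic_map_cong[OF atlas_bundle inv_eq hol'])
  qed (use bij hol[OF f'(1)] f'(2) in \<open>auto simp: gauge_of_def right_act_def G.m_assoc\<close>)
qed

text \<open>Equivariance gives F(g, s) = F(1, s) g, so F is recovered from its values on the
  canonical section. The restriction to the surface makes the result extensional, as
  \<open>current_group\<close> demands.\<close>

definition current_of :: "('k \<times> 's \<Rightarrow> 'k \<times> 's) \<Rightarrow> 's \<Rightarrow> 'k"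
  where "current_of F = (\<lambda>s\<in>M. fst (F (\<e>, s)))"

lemma current_of_in:
  assumes F: "gauge_transformation K S F"
  shows "current_of F \<in> carrier (current_group K S)"
proof -
  have "holomorphic_map S A (\<lambda>s. fst (F (\<e>, s)))"
    by (rule holomorphic_map_compose[OF atlas_S atlas_bundle holomorphic_map_compose[OF atlas_S
      atlas_bundle
        holomorphic_slice[OF G.one_closed] gaugeD(2)[OF F]] holomorphic_fst])
  then have "holomorphic_map S A (current_of F)"
    by (rule holomorphic_map_cong[OF atlas_S, rotated]) (simp add: current_of_def)
  then show ?thesis
    by (simp add: current_group_def current_of_def)
qed

text \<open>Equality must hold off the surface too, where both sides take the default value of
  extensional functions.\<close>

lemma current_of_gauge_of:
  assumes f: "f \<in> carrier (current_group K S)"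
  shows "current_of (gauge_of f) = f"
proof
  fix s
  have "f \<in> extensional M"
    using f by (simp add: current_group_def)
  then show "current_of (gauge_of f) s = f s"
    using current_groupD(2)[OF f, of s] extensional_arb[of f M s]
    by (cases "s \<in> M") (simp_all add: current_of_def gauge_of_def)
qed

text \<open>F carries the canonical section to the graph s \<mapsto> (f(s), s). Its tangent vectors
  have fibre component df and surface component u, so the decomposition of an equivariant form
  yields the logarithmic derivative and the Ad term.\<close>

lemma coadjoint_base_form:
  assumes F: "gauge_transformation K S F" and \<omega>: "equivariant_form \<omega>"
  shows "coadjoint K S (current_of F) (l, base_form K S \<omega>) = (l, base_form K S (pullback F \<omega>))"
proof -
  note D = gaugeD[OF F]
  define f where "f = current_of F"
  have f: "holomorphic_map S A f" "\<And>s. s \<in> M \<Longrightarrow> f s \<in> carrier K"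
    unfolding f_def using current_groupD[OF current_of_in[OF F]] by auto
  have "log_deriv K S f s u + Ad K (\<iota> (f s)) (base_form K S \<omega> s u) = base_form K S (pullback F \<omega>) s u"
    if s: "s \<in> M" and u: "u \<in> tangent_space S s" for s u
  proof -
    note slice = holomorphic_slice[OF G.one_closed]
    have es: "(\<e>, s) \<in> manifold_carrier P"
      using s by simp
    have Fs: "F (\<e>, y) = (f y, y)" if "y \<in> M" for y
      using that D(4)[of "(\<e>, y)"] by (simp add: f_def current_of_def prod_eq_iff)
    define v where "v = tangent_map S P (\<lambda>y. (f y, y)) s u"
    have j: "holomorphic_map S P (\<lambda>y. (f y, y))"
      by (intro holomorphic_Pair f holomorphic_map_ident atlas_S)
    have v: "v \<in> tangent_space P (f s, s)"
      unfolding v_def by (rule tangent_map_in[OF atlas_S atlas_bundle j u s])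
    have "tangent_map P P F (\<e>, s) (tangent_map S P (\<lambda>s. (\<e>, s)) s u) = tangent_map S P (\<lambda>y. F (\<e>, y)) s u"
      by (rule tangent_map_compose[OF atlas_S atlas_bundle slice D(2) u s])
    also have "\<dots> = v"
      unfolding v_def by (rule tangent_map_cong[OF atlas_S s Fs])
    finally have "base_form K S (pullback F \<omega>) s u = \<omega> (f s, s) v"
      by (simp add: base_form_eq[OF s u] pullback_eq[OF es slice_in[OF s u G.one_closed]] Fs[OF s])
    also have "\<dots> = tangent_map A A (\<lambda>x. \<iota> (f s) \<cdot> x) (f s) (tangent_map P A fst (f s, s) v)
        + Ad K (\<iota> (f s)) (base_form K S \<omega> s (tangent_map P S snd (f s, s) v))"
      by (rule equivariant_form_decomp[OF \<omega> f(2)[OF s] s v])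
    also have "tangent_map P A fst (f s, s) v = tangent_map S A f s u"
      using tangent_map_compose[OF atlas_S atlas_bundle j holomorphic_fst u s] by (simp add: v_def)
    also have "tangent_map P S snd (f s, s) v = u"
      using tangent_map_compose[OF atlas_S atlas_bundle j holomorphic_snd u s]
      by (simp add: v_def tangent_map_ident[OF atlas_S u])
    finally show ?thesis
      using s u by (simp add: log_deriv_def plus_fun_def)
  qed
  moreover have "base_form K S (pullback F \<omega>) s u = 0" if "\<not> (s \<in> M \<and> u \<in> tangent_space S s)" for s u
    by (rule base_form_outside[OF that])
  ultimately show ?thesis
    unfolding coadjoint_def f_def[symmetric] by (auto simp: fun_eq_iff)
qed

text \<open>Replaces group elements by gauge transformations: each f acts as pullback along
  \<open>gauge_of f\<close>, and pullback along F is the action of \<open>current_of F\<close>.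
  Questions about orbits thereby become questions about composing gauge transformations.\<close>

lemma orbit_base_form:
  assumes \<omega>: "equivariant_form \<omega>"
  shows "orbit (current_group K S) (coadjoint K S) (l, base_form K S \<omega>)
    = {(l, base_form K S (pullback F \<omega>)) | F. gauge_transformation K S F}"
proof (intro equalityI subsetI)
  fix x assume "x \<in> orbit (current_group K S) (coadjoint K S) (l, base_form K S \<omega>)"
  then obtain f where f: "f \<in> carrier (current_group K S)" "x = coadjoint K S f (l, base_form K S \<omega>)"
    by (auto simp: orbit_def)
  then have "x = (l, base_form K S (pullback (gauge_of f) \<omega>))"
    using coadjoint_base_form[OF gauge_of_gauge[OF f(1)] \<omega>] current_of_gauge_of[OF f(1)] by simp
  with gauge_of_gauge[OF f(1)]
  show "x \<in> {(l, base_form K S (pullback F \<omega>)) | F. gauge_transformation K S F}"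
    by (intro CollectI exI[of _ "gauge_of f"] conjI)
next
  fix x assume "x \<in> {(l, base_form K S (pullback F \<omega>)) | F. gauge_transformation K S F}"
  then obtain F where F: "gauge_transformation K S F" "x = (l, base_form K S (pullback F \<omega>))"
    by blast
  then have "x = coadjoint K S (current_of F) (l, base_form K S \<omega>)"
    using coadjoint_base_form[OF F(1) \<omega>] by simp
  with current_of_in[OF F(1)] show "x \<in> orbit (current_group K S) (coadjoint K S) (l, base_form K S \<omega>)"
    unfolding orbit_def by (intro CollectI exI[of _ "current_of F"] conjI)
qed

section \<open>Gauge equivalence classes and coadjoint orbits\<close>

lemma gauge_equiv_iff:
  "(\<omega>, \<omega>') \<in> gauge_equiv K S \<longleftrightarrow> \<omega> \<in> connections K S \<and> \<omega>' \<in> connections K S \<and>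
    (\<exists>F. gauge_transformation K S F \<and> \<omega> = pullback F \<omega>')"
  by (simp add: gauge_equiv_def flat_connections_eq)

lemma equiv_gauge_equiv: "equiv (connections K S) (gauge_equiv K S)"
proof (rule equivI)
  show "gauge_equiv K S \<subseteq> connections K S \<times> connections K S"
    by (auto simp: gauge_equiv_iff)
  show "refl_on (connections K S) (gauge_equiv K S)"
  proof (rule refl_onI)
    fix \<omega> assume \<omega>: "\<omega> \<in> connections K S"
    then have "pullback (\<lambda>x. x) \<omega> = \<omega>"
      by (intro pullback_cong_ident) (auto simp: connections_iff)
    then show "(\<omega>, \<omega>) \<in> gauge_equiv K S"
      using \<omega> gauge_ident unfolding gauge_equiv_iff by metis
  qed
  show "sym (gauge_equiv K S)"
  proof (rule symI)
    fix \<omega> \<omega>' assume "(\<omega>, \<omega>') \<in> gauge_equiv K S"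
    then obtain F where C: "\<omega> \<in> connections K S" "\<omega>' \<in> connections K S"
      and F: "gauge_transformation K S F" and eq: "\<omega> = pullback F \<omega>'"
      unfolding gauge_equiv_iff by blast
    have "pullback (inv_into (manifold_carrier P) F) \<omega> = \<omega>'"
      unfolding eq pullback_compose[OF gaugeD(2,3)[OF F]]
      by (rule pullback_cong_ident)
        (use C bij_betw_inv_into_right[OF gaugeD(1)[OF F]] in \<open>auto simp: connections_iff\<close>)
    then show "(\<omega>', \<omega>) \<in> gauge_equiv K S"
      unfolding gauge_equiv_iff using C gauge_inverse[OF F] by metis
  qed
  show "trans (gauge_equiv K S)"
  proof (rule transI)
    fix \<omega> \<omega>' \<omega>'' assume "(\<omega>, \<omega>') \<in> gauge_equiv K S" "(\<omega>', \<omega>'') \<in> gauge_equiv K S"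
    then obtain F G where C: "\<omega> \<in> connections K S" "\<omega>'' \<in> connections K S"
      and F: "gauge_transformation K S F" and G: "gauge_transformation K S G"
      and eq: "\<omega> = pullback F \<omega>'" "\<omega>' = pullback G \<omega>''"
      unfolding gauge_equiv_iff by blast
    have "\<omega> = pullback (\<lambda>x. G (F x)) \<omega>''"
      unfolding eq by (rule pullback_compose[OF gaugeD(2)[OF G] gaugeD(2)[OF F]])
    then show "(\<omega>, \<omega>'') \<in> gauge_equiv K S"
      unfolding gauge_equiv_iff using C gauge_compose[OF G F] by metis
  qed
qed

text \<open>Pullback is contravariant: pulling \<omega>' back by F and then by G is pulling it back
  by F after G, again a gauge transformation.\<close>

lemma orbit_subset:
  assumes "(\<omega>, \<omega>') \<in> gauge_equiv K S"
  shows "orbit (current_group K S) (coadjoint K S) (l, base_form K S \<omega>)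
    \<subseteq> orbit (current_group K S) (coadjoint K S) (l, base_form K S \<omega>')"
proof -
  obtain F where C: "\<omega> \<in> connections K S" "\<omega>' \<in> connections K S"
    and F: "gauge_transformation K S F" and eq: "\<omega> = pullback F \<omega>'"
    using assms unfolding gauge_equiv_iff by blast
  have eqv: "equivariant_form \<omega>" "equivariant_form \<omega>'"
    using C by (auto simp: connections_iff)
  show ?thesis
    unfolding orbit_base_form[OF eqv(1)] orbit_base_form[OF eqv(2)]
  proof (intro subsetI, elim CollectE exE conjE)
    fix x G assume x: "x = (l, base_form K S (pullback G \<omega>))" and G: "gauge_transformation K S G"
    have "x = (l, base_form K S (pullback (\<lambda>x. F (G x)) \<omega>'))"
      unfolding x eq pullback_compose[OF gaugeD(2)[OF F] gaugeD(2)[OF G]] ..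
    with gauge_compose[OF F G]
    show "x \<in> {(l, base_form K S (pullback F \<omega>')) | F. gauge_transformation K S F}"
      by (intro CollectI exI[of _ "\<lambda>x. F (G x)"] conjI)
  qed
qed

text \<open>The identity puts the base form of \<omega> into its own orbit. Equal orbits thus
  provide F such that \<omega> and the pullback of \<omega>' by F have the same base form, and
  uniqueness upgrades this to equality of the forms on the bundle.\<close>

lemma orbit_eq_iff:
  assumes \<omega>: "\<omega> \<in> connections K S" and \<omega>': "\<omega>' \<in> connections K S"
  shows "orbit (current_group K S) (coadjoint K S) (l, base_form K S \<omega>)
      = orbit (current_group K S) (coadjoint K S) (l, base_form K S \<omega>')
    \<longleftrightarrow> (\<omega>, \<omega>') \<in> gauge_equiv K S"
    (is "?O \<omega> = ?O \<omega>' \<longleftrightarrow> _")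
proof
  have eqv: "equivariant_form \<omega>" "equivariant_form \<omega>'"
    using assms by (auto simp: connections_iff)
  assume eq: "?O \<omega> = ?O \<omega>'"
  have "(l, base_form K S (pullback (\<lambda>x. x) \<omega>)) \<in> ?O \<omega>"
    unfolding orbit_base_form[OF eqv(1)] using gauge_ident
    by (intro CollectI exI[of _ "\<lambda>x. x"] conjI refl)
  then have "(l, base_form K S \<omega>) \<in> ?O \<omega>'"
    by (simp add: pullback_cong_ident[OF _ eqv(1)] eq)
  then obtain F where F: "gauge_transformation K S F" and "base_form K S \<omega> = base_form K S (pullback F \<omega>')"
    unfolding orbit_base_form[OF eqv(2)] by blast
  then have "\<omega> = pullback F \<omega>'"
    by (intro equivariant_form_eqI[OF eqv(1) pullback_equivariant[OF F eqv(2)]])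
  then show "(\<omega>, \<omega>') \<in> gauge_equiv K S"
    using assms F unfolding gauge_equiv_iff by blast
next
  assume R: "(\<omega>, \<omega>') \<in> gauge_equiv K S"
  then have "(\<omega>', \<omega>) \<in> gauge_equiv K S"
    using equiv_gauge_equiv by (auto elim: equivE symE)
  with R show "?O \<omega> = ?O \<omega>'"
    by (intro equalityI orbit_subset)
qed

text \<open>The second conjunct pins the bijection down: it is induced by restriction to the
  canonical section, so more is claimed than equality of cardinalities.\<close>

theorem orbits_correspond_gauge_classes:
  "\<exists>\<Phi>. bij_betw \<Phi>
      (orbits (current_group K S) (hyperplane K S l) (coadjoint K S))
      (flat_connections K S // gauge_equiv K S) \<and>
    (\<forall>\<omega>\<in>flat_connections K S.
      \<Phi> (orbit (current_group K S) (coadjoint K S) (l, base_form K S \<omega>)) = gauge_equiv K S `` {\<omega>})"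
proof -
  define C where "C = connections K S"
  define orb where "orb \<omega> = orbit (current_group K S) (coadjoint K S) (l, base_form K S \<omega>)" for \<omega>
  define R where "R = gauge_equiv K S"
  \<comment> \<open>Some connection whose base form generates the orbit X is chosen;
    \<open>orb_iff\<close> makes the gauge class independent of the choice.\<close>
  define \<Phi> where "\<Phi> X = R `` {SOME \<omega>. \<omega> \<in> C \<and> orb \<omega> = X}" for X
  have equiv: "equiv C R"
    unfolding C_def R_def by (rule equiv_gauge_equiv)
  have orb_iff: "orb \<omega> = orb \<omega>' \<longleftrightarrow> (\<omega>, \<omega>') \<in> R" if "\<omega> \<in> C" "\<omega>' \<in> C" for \<omega> \<omega>'
    unfolding orb_def R_def using that orbit_eq_iff by (simp add: C_def)
  have \<Phi>: "\<Phi> (orb \<omega>) = R `` {\<omega>}" if \<omega>: "\<omega> \<in> C" for \<omega>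
  proof -
    define \<omega>' where "\<omega>' = (SOME \<omega>'. \<omega>' \<in> C \<and> orb \<omega>' = orb \<omega>)"
    have "\<omega>' \<in> C \<and> orb \<omega>' = orb \<omega>"
      unfolding \<omega>'_def by (rule someI[of _ \<omega>]) (simp add: \<omega>)
    then have "(\<omega>', \<omega>) \<in> R"
      using orb_iff \<omega> by blast
    then show ?thesis
      unfolding \<Phi>_def \<omega>'_def[symmetric] by (rule equiv_class_eq[OF equiv])
  qed
  have base: "base_form K S ` C = hol_forms K S"
  proof (intro equalityI subsetI)
    show "\<xi> \<in> hol_forms K S" if "\<xi> \<in> base_form K S ` C" for \<xi>
      using that base_form_in_hol_forms by (auto simp: C_def)
    show "\<xi> \<in> base_form K S ` C" if "\<xi> \<in> hol_forms K S" for \<xi>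
      using extended_form_connection[OF that] by (metis C_def imageI)
  qed
  \<comment> \<open>Every point of the hyperplane comes from a connection, so that all orbits, not
    just some, are reached.\<close>
  have hyp: "hyperplane K S l = (\<lambda>\<xi>. (l, \<xi>)) ` base_form K S ` C"
    unfolding base by (auto simp: hyperplane_def smooth_dual_def)
  have "orbits (current_group K S) (hyperplane K S l) (coadjoint K S)
      = orbit (current_group K S) (coadjoint K S) ` hyperplane K S l"
    by (auto simp: orbits_def)
  then have orbits: "orbits (current_group K S) (hyperplane K S l) (coadjoint K S) = orb ` C"
    by (simp add: hyp image_image orb_def)
  have "bij_betw \<Phi> (orb ` C) (C // R)"
    unfolding bij_betw_def
  proof
    show "inj_on \<Phi> (orb ` C)"
    proof (rule inj_onI, elim imageE)
      fix X Y \<omega> \<omega>' assume "\<Phi> X = \<Phi> Y" and X: "X = orb \<omega>" "\<omega> \<in> C" and Y: "Y = orb \<omega>'" "\<omega>' \<in> C"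
      then have "R `` {\<omega>} = R `` {\<omega>'}"
        using \<Phi> by simp
      then have "(\<omega>, \<omega>') \<in> R"
        by (rule eq_equiv_class[OF _ equiv Y(2)])
      then show "X = Y"
        using orb_iff X Y by simp
    qed
    show "\<Phi> ` orb ` C = C // R"
      unfolding quotient_def image_image by (auto simp: \<Phi>)
  qed
  then show ?thesis
    unfolding orbits flat_connections_eq using \<Phi> unfolding C_def R_def orb_def by blast
qed

end

section \<open>Passage to the punctured surface\<close>

lemma complex_atlas_minus_finite:
  assumes A: "complex_atlas A" and F: "finite F"
  shows "complex_atlas (open_submanifold A (manifold_carrier A - F))"
proof (rule complex_atlas_open_submanifold[OF A])
  fix c assume c: "c \<in> A"
  \<comment> \<open>Chart domains lie in the carrier, so only the finite set is removed, and it is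
    closed in a Hausdorff space.\<close>
  have "fst c \<inter> (manifold_carrier A - F) = fst c - F"
    using c by (auto simp: manifold_carrier_def)
  then show "open (fst c \<inter> (manifold_carrier A - F))"
    using atlas_open[OF A c] finite_imp_closed[OF F] by (simp add: open_Diff)
qed

theorem corollary4p4:
  fixes K :: "('k::t2_space, 'e::complex_euclidean_space) lie_group"
    and S S\<^sub>k :: "('s::t2_space, complex) chart set"
    and p :: "nat \<Rightarrow> 's" and k :: nat and l :: complex
  assumes "complex_lie_group K"
    and "connected (carrier K)" and "simply_connected (carrier K)"
    and "has_simple_lie_algebra K"
    and "riemann_surface S" and "compact (manifold_carrier S)"
    and "k \<ge> 1" and "inj_on p {1..k}" and "p ` {1..k} \<subseteq> manifold_carrier S"
    and "S\<^sub>k = open_submanifold S (manifold_carrier S - p ` {1..k})"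
  shows "\<exists>\<Phi>. bij_betw \<Phi>
      (orbits (current_group K S\<^sub>k) (hyperplane K S\<^sub>k l) (coadjoint K S\<^sub>k))
      (flat_connections K S\<^sub>k // gauge_equiv K S\<^sub>k) \<and>
    (\<forall>\<omega>\<in>flat_connections K S\<^sub>k.
      \<Phi> (orbit (current_group K S\<^sub>k) (coadjoint K S\<^sub>k) (l, base_form K S\<^sub>k \<omega>))
        = gauge_equiv K S\<^sub>k `` {\<omega>})"
proof -
  have "complex_atlas S\<^sub>k"
    unfolding assms(10) using assms(5)
    by (intro complex_atlas_minus_finite) (auto simp: riemann_surface_def)
  then interpret current_setup K S\<^sub>k
    using assms(1) by unfold_locales
  show ?thesis
    by (rule orbits_correspond_gauge_classes)
qed

end
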